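(* For each $N$ let $J=W/\sqrt N$, where $W\in\mathbb{R}^{N\times N}$ is a symmetric random matrix whose entries on and above the diagonal are independent and symmetric random variables ($W_{ij}\overset{d}{=}-W_{ij}$), with the off-diagonal entries identically distributed and the diagonal entries identically distributed (laws not depending on $N$), $\mathbb{E}W_{ij}=0$, $\mathbb{E}W_{ij}^2=1+\delta_{ij}$, and finite moments of all orders. Fix $\lambda>2$ and let $$M(\lambda)=(\lambda I_N-J)^{-1}-\frac{\mathrm{Tr}((\lambda I_N-J)^{-1})}{N}I_N$$ (defined on the event, of probability $1-o(1)$, that $\lambda$ exceeds the largest eigenvalue of $J$). Then $M(\lambda)$ satisfies the requirements of a semi-random matrix ensemble with constant $\sigma_\psi^2=-G_{\mathrm{sc}}'(\lambda)-G_{\mathrm{sc}}(\lambda)^2$ with probability $1-o_N(1)$. That is: $M(\lambda)\overset{d}{=}SM(\lambda)S$ for $S=\mathrm{diag}(s_1,\dots,s_N)$ with $s_i$ i.i.d. uniform on $\{\pm1\}$ and independent of $J$; there is a constant $C$ such that with probability $1-o_N(1)$, $\|M(\lambda)\|_{\mathrm{op}}\le C$; for every fixed $\epsilon>0$, with probability $1-o_N(1)$, $$\max_{i,j}|M(\lambda)_{ij}|\le N^{-1/2+\epsilon}\quad\text{and}\quad\max_{i\neq j}|(M(\lambda)M(\lambda)^{\mathsf T})_{ij}|\le N^{-1/2+\epsilon};$$ and for every fixed $\delta>0$, with probability $1-o_N(1)$, $\max_i|(M(\lambda)M(\lambda)^{\mathsf T})_{ii}-\sigma_\psi^2|\le\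delta$.
   Context: $G_{\mathrm{sc}}(\lambda)=\int\frac{\xi_{\mathrm{sc}}(dx)}{\lambda-x}$ for $\lambda>2$ is the Cauchy transform of the semicircle distribution $\xi_{\mathrm{sc}}(dx)=\frac{1}{2\pi}\sqrt{4-x^2}\,\mathbf 1_{[-2,2]}(x)\,dx$. *)

theory Defs
  imports
    "HOL-Probability.Probability"
    "Jordan_Normal_Form.Gauss_Jordan_Elimination"
    "Jordan_Normal_Form.Spectral_Radius"
begin

definition semicircle :: "real measure" where
  "semicircle =
     density lborel (\<lambda>x. ennreal (1 / (2 * pi) * sqrt (4 - x\<^sup>2) * indicator {-2..2} x))"

definition G_sc :: "real \<Rightarrow> real" where
  "G_sc z = (\<integral>x. 1 / (z - x) \<partial>semicircle)"

definition mat_trace :: "real mat \<Rightarrow> real" where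
  "mat_trace A = (\<Sum>i<dim_row A. A $$ (i, i))"

definition vec_norm2 :: "real vec \<Rightarrow> real" where
  "vec_norm2 v = sqrt (scalar_prod v v)"

definition op_norm :: "real mat \<Rightarrow> real" where
  "op_norm A = (SUP v \<in> {v \<in> carrier_vec (dim_col A). vec_norm2 v \<le> 1}. vec_norm2 (A *\<^sub>v v))"

definition largest_eigenvalue :: "real mat \<Rightarrow> real" where
  "largest_eigenvalue A = Max (spectrum A)"

definition resolvent :: "real \<Rightarrow> real mat \<Rightarrow> real mat" where
  "resolvent z A = the (mat_inverse (z \<cdot>\<^sub>m 1\<^sub>m (dim_row A) - A))"

text \<open>
  The centred resolvent is only meaningful when \<open>z\<close> exceeds the largest eigenvalue of \<open>A\<close>.
  Off that event it is set to the zero matrix. This value and the event itself are invariant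
  under conjugation by diagonal sign matrices, so that an equality in law of the totalised matrix
  and its sign conjugate says the same as the equality in law restricted to the event.
\<close>

definition centred_resolvent :: "real \<Rightarrow> real mat \<Rightarrow> real mat" where
  "centred_resolvent z A =
     (if largest_eigenvalue A < z
      then resolvent z A - (mat_trace (resolvent z A) / real (dim_row A)) \<cdot>\<^sub>m 1\<^sub>m (dim_row A)
      else 0\<^sub>m (dim_row A) (dim_row A))"

text \<open>
  The type of matrices carries no sigma-algebra; an \<open>n \<times> n\<close> random matrix is measured through
  its family of entries.
\<close>

definition mat_entries :: "nat \<Rightarrow> real mat \<Rightarrow> nat \<times> nat \<Rightarrow> real" where
  "mat_entries n A = restrict (\<lambda>ij. A $$ ij) ({..<n} \<times> {..<n})"

definition entry_space :: "nat \<Rightarrow> (nat \<times> nat \<Rightarrow> real) measure" where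
  "entry_space n = PiM ({..<n} \<times> {..<n}) (\<lambda>_. borel)"

definition random_mat :: "nat \<Rightarrow> 'w measure \<Rightarrow> ('w \<Rightarrow> real mat) \<Rightarrow> bool" where
  "random_mat n Q X \<longleftrightarrow>
     (\<forall>\<omega>\<in>space Q. X \<omega> \<in> carrier_mat n n) \<and> (\<lambda>\<omega>. mat_entries n (X \<omega>)) \<in> measurable Q (entry_space n)"

definition mat_law :: "nat \<Rightarrow> 'w measure \<Rightarrow> ('w \<Rightarrow> real mat) \<Rightarrow> (nat \<times> nat \<Rightarrow> real) measure" where
  "mat_law n Q X = distr Q (entry_space n) (\<lambda>\<omega>. mat_entries n (X \<omega>))"

definition sign_measure :: "nat \<Rightarrow> (nat \<Rightarrow> real) measure" where
  "sign_measure n = PiM {..<n} (\<lambda>_. measure_pmf (pmf_of_set {-1, 1}))"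

definition whp :: "(nat \<Rightarrow> 'w measure) \<Rightarrow> (nat \<Rightarrow> 'w \<Rightarrow> bool) \<Rightarrow> bool" where
  "whp P E \<longleftrightarrow> (\<lambda>N. measure (P N) {\<omega> \<in> space (P N). E N \<omega>}) \<longlonglongrightarrow> 1"

end

theory Submission
  imports Defs "HOL-Real_Asymp.Real_Asymp"
begin

text \<open>
  Upper edge: write \<open>\<lambda> = 2 + 4 * h\<close>. Revealing \<open>J\<close> row by row, positive definiteness of \<open>z - J\<close> is
  decided by Schur complements \<open>z - J\<^sub>k\<^sub>k - \<langle>x, G x\<rangle>\<close>, where \<open>G\<close> is the resolvent of the leading block and
  \<open>x\<close> an independent row. While \<open>z\<close> slowly rises with the size of the block, a
  supermartingale keeps the normalised trace of \<open>G\<close> below \<open>1 + h\<close> and hence, by concentration of the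
  quadratic form, all pivots positive; so \<open>\<lambda> - h - J\<close> is positive definite with high probability.
  No moments of traces of powers of \<open>J\<close> are needed.

  Local law: on that event the resolvents at \<open>\<lambda>\<close> of \<open>J\<close> and of all its minors are bounded by \<open>1 / h\<close>.
  High moments of linear and quadratic forms in the independent row of a minor, Schur's complement
  formula and the stability of \<open>m * (\<lambda> - m) = 1\<close> give entrywise control of the resolvent and of its
  square with error \<open>N powr (-1/2 + \<epsilon>)\<close>.

  Sign symmetry: conjugation by a diagonal sign matrix multiplies the independent symmetric entries
  of \<open>W\<close> by signs, which preserves their joint law, and it commutes with the formation of resolvents.
\<close>

section \<open>Inverses on index sets\<close>

text \<open>The trace of the resolvent at a fixed parameter is not a closed process: a new row adds
  about (1 + tr G^2 / n) / pivot to it, and near the edge tr G^2 is uncontrolled. Raising the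
  parameter by (1 + h) / n per row lowers the trace by at least (1 + h) tr G^2 / n, more than the
  row adds through tr G^2 in the mean. What is left is a growth of the normalised trace by at most 1
  / n per row, which the rise of the parameter matches. The gap between parameter and normalised
  trace thus stays above 1, and pivots of size at least 1 sustain themselves. Besides, tr G^2 / n
  needs a crude bound; since it may fluctuate by factors, its logarithm is followed, and the failure
  probability is of order 1 / ln n, enough for 1 - o(1). Matrices are functions on all index pairs,
  cut off at n and supported on an index set, so that all blocks and minors share one type.
  Definiteness and inverses are recursions by field operations in the entries; measurability and
  independence of rows not yet revealed then follow by induction.\<close>

definition dot :: "nat \<Rightarrow> (nat \<Rightarrow> real) \<Rightarrow> (nat \<Rightarrow> real) \<Rightarrow> real" where
  "dot n x y = (\<Sum>i<n. x i * y i)"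

definition mv :: "nat \<Rightarrow> (nat \<Rightarrow> nat \<Rightarrow> real) \<Rightarrow> (nat \<Rightarrow> real) \<Rightarrow> nat \<Rightarrow> real" where
  "mv n A x = (\<lambda>i. \<Sum>j<n. A i j * x j)"

definition mm :: "nat \<Rightarrow> (nat \<Rightarrow> nat \<Rightarrow> real) \<Rightarrow> (nat \<Rightarrow> nat \<Rightarrow> real) \<Rightarrow> nat \<Rightarrow> nat \<Rightarrow> real" where
  "mm n A C = (\<lambda>i j. \<Sum>k<n. A i k * C k j)"

definition tr :: "nat \<Rightarrow> (nat \<Rightarrow> nat \<Rightarrow> real) \<Rightarrow> real" where
  "tr n A = (\<Sum>i<n. A i i)"

definition form :: "nat \<Rightarrow> (nat \<Rightarrow> nat \<Rightarrow> real) \<Rightarrow> (nat \<Rightarrow> real) \<Rightarrow> real" where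
  "form n A x = dot n x (mv n A x)"

definition symm_mat :: "(nat \<Rightarrow> nat \<Rightarrow> real) \<Rightarrow> bool" where
  "symm_mat A \<longleftrightarrow> (\<forall>i j. A i j = A j i)"

text \<open>The inverse of the S-block, padded by zeros to the whole index set. Rows of
  \<open>mm n B G\<close> outside S are left free, since B may couple S to its complement.\<close>

definition inverse_on ::
  "nat \<Rightarrow> (nat \<Rightarrow> nat \<Rightarrow> real) \<Rightarrow> nat set \<Rightarrow> (nat \<Rightarrow> nat \<Rightarrow> real) \<Rightarrow> bool" where
  "inverse_on n B S G \<longleftrightarrow> S \<subseteq> {..<n} \<and> symm_mat G \<and> (\<forall>i j. i \<notin> S \<longrightarrow> G i j = 0) \<and>
     (\<forall>i\<in>S. \<forall>j. mm n B G i j = (if i = j then 1 else 0))"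

definition pd :: "nat \<Rightarrow> (nat \<Rightarrow> nat \<Rightarrow> real) \<Rightarrow> nat set \<Rightarrow> bool" where
  "pd n B S \<longleftrightarrow> (\<forall>x. (\<forall>i. i \<notin> S \<longrightarrow> x i = 0) \<longrightarrow> (\<exists>i\<in>S. x i \<noteq> 0) \<longrightarrow> form n B x > 0)"

lemma sum_mult_if:
  fixes n :: nat
  shows "(\<Sum>j<n. f j * (if j = k then 1 else 0)) = (if k < n then f k else (0::real))"
proof -
  have "f j * (if j = k then 1 else 0) = (if j = k then f j else 0)" for j by simp
  then show ?thesis by simp
qed

lemma dot_commute: "dot n x y = dot n y x"
  by (simp add: dot_def mult.commute)

lemma dot_add_left: "dot n (\<lambda>i. x i + y i) z = dot n x z + dot n y z"
  by (simp add: dot_def algebra_simps sum.distrib)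

lemma dot_add_right: "dot n z (\<lambda>i. x i + y i) = dot n z x + dot n z y"
  by (simp add: dot_def algebra_simps sum.distrib)

lemma dot_scale_left: "dot n (\<lambda>i. c * x i) z = c * dot n x z"
  by (simp add: dot_def algebra_simps sum_distrib_left)

lemma dot_scale_right: "dot n z (\<lambda>i. c * x i) = c * dot n z x"
  by (simp add: dot_def algebra_simps sum_distrib_left)

lemma dot_self_nonneg: "dot n x x \<ge> 0"
  by (simp add: dot_def sum_nonneg)

lemma mv_add: "mv n A (\<lambda>i. x i + y i) = (\<lambda>i. mv n A x i + mv n A y i)"
  by (simp add: mv_def algebra_simps sum.distrib)

lemma mv_scale: "mv n A (\<lambda>i. c * x i) = (\<lambda>i. c * mv n A x i)"
  by (simp add: mv_def algebra_simps sum_distrib_left)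

lemma mv_mm: "mv n (mm n A C) x = mv n A (mv n C x)"
proof
  fix i
  have "mv n (mm n A C) x i = (\<Sum>j<n. \<Sum>k<n. A i k * C k j * x j)"
    by (simp add: mv_def mm_def sum_distrib_right)
  also have "\<dots> = (\<Sum>k<n. \<Sum>j<n. A i k * C k j * x j)" by (rule sum.swap)
  also have "\<dots> = mv n A (mv n C x) i"
    by (simp add: mv_def sum_distrib_left mult.assoc)
  finally show "mv n (mm n A C) x i = mv n A (mv n C x) i" .
qed

lemma mm_column: "mm n A C i j = mv n A (\<lambda>k. C k j) i"
  by (simp add: mm_def mv_def)

lemma mm_assoc: "mm n (mm n A C) D = mm n A (mm n C D)"
proof (intro ext)
  fix i j
  have "(\<lambda>k. mm n C D k j) = mv n C (\<lambda>k. D k j)" by (simp add: mm_column)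
  then show "mm n (mm n A C) D i j = mm n A (mm n C D) i j"
    by (simp add: mm_column mv_mm)
qed

lemma dot_mv:
  assumes "symm_mat A"
  shows "dot n (mv n A x) y = dot n x (mv n A y)"
proof -
  have "dot n (mv n A x) y = (\<Sum>i<n. \<Sum>j<n. A i j * x j * y i)"
    by (simp add: dot_def mv_def sum_distrib_right)
  also have "\<dots> = (\<Sum>j<n. \<Sum>i<n. A i j * x j * y i)" by (rule sum.swap)
  also have "\<dots> = (\<Sum>j<n. \<Sum>i<n. A j i * x j * y i)"
    using assms unfolding symm_mat_def by (intro sum.cong refl) simp
  also have "\<dots> = dot n x (mv n A y)"
    by (simp add: dot_def mv_def sum_distrib_left mult_ac)
  finally show ?thesis .
qed

lemma dot_cong: "(\<And>i. i < n \<Longrightarrow> x i = x' i) \<Longrightarrow> (\<And>i. i < n \<Longrightarrow> y i = y' i) \<Longrightarrow> dot n x y = dot n x' y'"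
  by (simp add: dot_def)

lemma mv_cong: "(\<And>i. i < n \<Longrightarrow> x i = y i) \<Longrightarrow> mv n A x = mv n A y"
  by (simp add: mv_def)

lemma dot_le_sqrt: "(dot n x y)\<^sup>2 \<le> dot n x x * dot n y y"
  unfolding dot_def using Cauchy_Schwarz_ineq_sum[of x y "{..<n}"] by (simp add: power2_eq_square)

lemma inverse_onD:
  assumes "inverse_on n B S G"
  shows "S \<subseteq> {..<n}" "symm_mat G" "\<And>i j. i \<notin> S \<Longrightarrow> G i j = 0" "\<And>i j. j \<notin> S \<Longrightarrow> G i j = 0"
    "\<And>i j. i \<in> S \<Longrightarrow> mm n B G i j = (if i = j then 1 else 0)" "\<And>i j. G i j = G j i"
  using assms unfolding inverse_on_def symm_mat_def by (blast, blast, blast, metis, blast, blast)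

lemma inverse_on_left:
  assumes G: "inverse_on n B S G" and B: "symm_mat B" and "j \<in> S"
  shows "mm n G B i j = (if i = j then 1 else 0)"
proof -
  have "mm n G B i j = mm n B G j i"
    unfolding mm_def using inverse_onD(6)[OF G] B unfolding symm_mat_def
    by (metis mult.commute)
  then show ?thesis using inverse_onD(5)[OF G \<open>j \<in> S\<close>] by auto
qed

lemma inverse_on_mv:
  assumes G: "inverse_on n B S G" and "i \<in> S"
  shows "mv n B (mv n G x) i = x i"
proof -
  have i: "i < n" using inverse_onD(1)[OF G] assms(2) by auto
  have "mv n B (mv n G x) i = mv n (mm n B G) x i" by (simp add: mv_mm)
  also have "\<dots> = (\<Sum>j<n. if i = j then x j else 0)"
    unfolding mv_def by (intro sum.cong refl) (simp add: inverse_onD(5)[OF G \<open>i \<in> S\<close>])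
  finally show ?thesis using i by simp
qed

lemma inverse_on_mv_support:
  assumes G: "inverse_on n B S G" and "i \<notin> S"
  shows "mv n G x i = 0"
  unfolding mv_def by (simp add: inverse_onD(3)[OF G assms(2)])

lemma inverse_on_mv_left:
  assumes G: "inverse_on n B S G" and B: "symm_mat B" and x: "\<And>i. i \<notin> S \<Longrightarrow> x i = 0"
  shows "mv n G (mv n B x) i = x i"
proof -
  have "mv n G (mv n B x) i = (\<Sum>j<n. mm n G B i j * x j)"
    unfolding mv_mm[symmetric] by (simp only: mv_def)
  also have "\<dots> = (\<Sum>j<n. if i = j then x j else 0)"
    by (intro sum.cong refl) (use inverse_on_left[OF G B] x in force)
  also have "\<dots> = x i" using x[of i] inverse_onD(1)[OF G] by (auto simp: subset_iff)
  finally show ?thesis .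
qed

lemma inverse_on_form_eq:
  assumes G: "inverse_on n B S G"
  shows "form n G x = form n B (mv n G x)"
proof -
  have "form n B (mv n G x) = dot n (mv n G x) x"
    unfolding form_def dot_def
    by (intro sum.cong refl) (metis inverse_on_mv[OF G] inverse_on_mv_support[OF G] mult_zero_left)
  then show ?thesis by (simp add: form_def dot_commute)
qed

lemma form_zero: "(\<And>i. i < n \<Longrightarrow> x i = 0) \<Longrightarrow> form n B x = 0"
  by (simp add: form_def dot_def)

lemma pd_form_nonneg:
  assumes "pd n B S" "\<And>i. i \<notin> S \<Longrightarrow> x i = 0"
  shows "form n B x \<ge> 0"
proof (cases "\<exists>i\<in>S. x i \<noteq> 0")
  case True
  then show ?thesis using assms unfolding pd_def by (meson less_imp_le)
next
  case False
  then have "x i = 0" for i using assms(2) by auto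
  then show ?thesis by (simp add: form_zero)
qed

lemma inverse_on_form_nonneg:
  assumes "inverse_on n B S G" "pd n B S"
  shows "form n G x \<ge> 0"
  unfolding inverse_on_form_eq[OF assms(1)]
  by (rule pd_form_nonneg[OF assms(2)]) (rule inverse_on_mv_support[OF assms(1)])

text \<open>Identifies resolvents computed in different elimination orders; in particular any index
  may be treated as the one added last.\<close>

lemma inverse_on_unique:
  assumes G: "inverse_on n B S G" and H: "inverse_on n B S H" and B: "symm_mat B"
  shows "G = H"
proof (intro ext)
  fix i j
  show "G i j = H i j"
  proof -
    have e: "mv n B (\<lambda>k. H k j) k = (if k = j then 1 else 0)" if "k \<in> S" for k
      using inverse_onD(5)[OF H that, of j] by (simp add: mm_column)
    have "H i j = mv n G (mv n B (\<lambda>k. H k j)) i"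
      using inverse_on_mv_left[OF G B, of "\<lambda>k. H k j" i] inverse_onD(3)[OF H] by simp
    also have "\<dots> = mv n G (\<lambda>k. if k = j then 1 else 0) i"
      unfolding mv_def[of n G] using inverse_onD(4)[OF G] e
      by (intro sum.cong refl) (metis mult_zero_left)
    also have "\<dots> = (if j < n then G i j else 0)"
      by (simp add: mv_def sum_mult_if)
    also have "\<dots> = G i j" using inverse_onD(1,4)[OF G] by auto
    finally show ?thesis by simp
  qed
qed

lemma pd_mono: "pd n B T \<Longrightarrow> S \<subseteq> T \<Longrightarrow> pd n B S"
  unfolding pd_def by (meson subsetD)

subsection \<open>Bordering\<close>

text \<open>Block inversion: for G inverse to B on S, this is the vector with entry 1 at k that B
  maps to 0 on S. At k, B maps it to the Schur complement \<open>pivot\<close>, and the inverse on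
  the larger block is a rank-one update of G along it. For B = z - J the vector
  \<open>\<lambda>j. - B j k\<close> is, off k, the column of J.\<close>

definition border_vec :: "nat \<Rightarrow> (nat \<Rightarrow> nat \<Rightarrow> real) \<Rightarrow> nat \<Rightarrow> (nat \<Rightarrow> nat \<Rightarrow> real) \<Rightarrow> nat \<Rightarrow> real" where
  "border_vec n B k G i = (if i = k then 1 else mv n G (\<lambda>j. - B j k) i)"

definition pivot :: "nat \<Rightarrow> (nat \<Rightarrow> nat \<Rightarrow> real) \<Rightarrow> nat \<Rightarrow> (nat \<Rightarrow> nat \<Rightarrow> real) \<Rightarrow> real" where
  "pivot n B k G = B k k - form n G (\<lambda>j. - B j k)"

definition border :: "nat \<Rightarrow> (nat \<Rightarrow> nat \<Rightarrow> real) \<Rightarrow> nat \<Rightarrow> (nat \<Rightarrow> nat \<Rightarrow> real) \<Rightarrow> nat \<Rightarrow> nat \<Rightarrow> real" where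
  "border n B k G i j = G i j + border_vec n B k G i * border_vec n B k G j / pivot n B k G"

context
  fixes n B S G k
  assumes G: "inverse_on n B S G" and B: "symm_mat B" and k: "k < n" "k \<notin> S"
begin

lemma border_vec_eq: "border_vec n B k G i = mv n G (\<lambda>j. - B j k) i + (if i = k then 1 else 0)"
  unfolding border_vec_def using inverse_on_mv_support[OF G k(2)] by simp

lemma mv_border_vec_in:
  assumes "i \<in> S" shows "mv n B (border_vec n B k G) i = 0"
proof -
  have "mv n B (border_vec n B k G) = (\<lambda>i. mv n B (mv n G (\<lambda>j. - B j k)) i + mv n B (\<lambda>i. if i = k then 1 else 0) i)"
    by (subst mv_add[symmetric]) (simp add: border_vec_eq[abs_def])
  moreover have "mv n B (\<lambda>i. if i = k then 1 else 0) i = B i k"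
    using k by (simp add: mv_def sum_mult_if)
  ultimately show ?thesis using inverse_on_mv[OF G assms] by simp
qed

lemma mv_border_vec_k: "mv n B (border_vec n B k G) k = pivot n B k G"
proof -
  have "mv n B (border_vec n B k G) k = mv n B (mv n G (\<lambda>j. - B j k)) k + mv n B (\<lambda>i. if i = k then 1 else 0) k"
    by (subst border_vec_eq[abs_def]) (simp add: mv_add)
  moreover have "mv n B (\<lambda>i. if i = k then 1 else 0) k = B k k"
    using k by (simp add: mv_def sum_mult_if)
  moreover have "mv n B (mv n G (\<lambda>j. - B j k)) k = - form n G (\<lambda>j. - B j k)"
    unfolding form_def dot_def mv_def[of n B] using B unfolding symm_mat_def
    by (simp add: sum_negf[symmetric])
  ultimately show ?thesis by (simp add: pivot_def)
qed

lemma form_border_vec: "form n B (border_vec n B k G) = pivot n B k G"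
proof -
  have "form n B (border_vec n B k G) =
     (\<Sum>i<n. if i = k then pivot n B k G else 0)"
    unfolding form_def dot_def
  proof (intro sum.cong refl)
    fix i
    show "border_vec n B k G i * mv n B (border_vec n B k G) i = (if i = k then pivot n B k G else 0)"
      using mv_border_vec_in[of i] mv_border_vec_k inverse_on_mv_support[OF G, of i]
      by (cases "i \<in> S") (auto simp: border_vec_def k)
  qed
  then show ?thesis using k by simp
qed

lemma inverse_on_border:
  assumes piv: "pivot n B k G \<noteq> 0"
  shows "inverse_on n B (insert k S) (border n B k G)"
  unfolding inverse_on_def
proof (intro conjI ballI allI impI)
  let ?u = "border_vec n B k G" and ?s = "pivot n B k G"
  show "insert k S \<subseteq> {..<n}" using inverse_onD(1)[OF G] k by auto
  show "symm_mat (border n B k G)"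
    unfolding symm_mat_def border_def using inverse_onD(6)[OF G] by (simp add: mult.commute)
  show "border n B k G i j = 0" if "i \<notin> insert k S" for i j
    using that inverse_onD(3)[OF G] inverse_on_mv_support[OF G, of i]
    by (auto simp: border_def border_vec_def)
  fix i j assume i: "i \<in> insert k S"
  have eq: "mm n B (border n B k G) i j = mm n B G i j + mv n B ?u i * (?u j / ?s)"
    by (simp add: mm_def border_def mv_def algebra_simps sum.distrib sum_distrib_left sum_divide_distrib)
  show "mm n B (border n B k G) i j = (if i = j then 1 else 0)"
  proof (cases "i = k")
    case False
    then show ?thesis using i inverse_onD(5)[OF G] mv_border_vec_in eq by auto
  next
    case True
    have "mm n B G k j = - mv n G (\<lambda>j. - B j k) j"
      unfolding mm_def mv_def using B inverse_onD(6)[OF G] unfolding symm_mat_def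
      by (simp add: sum_negf[symmetric] mult.commute)
    then show ?thesis using True eq piv mv_border_vec_k border_vec_eq[of j] by auto
  qed
qed

text \<open>\<open>border_vec\<close> is B-orthogonal to all vectors supported on S, so the form of
  x = y + x k * u splits into the form of y plus (x k)^2 times the pivot.\<close>

lemma pd_insert_iff: "pd n B (insert k S) \<longleftrightarrow> pd n B S \<and> pivot n B k G > 0"
proof
  let ?u = "border_vec n B k G" and ?s = "pivot n B k G"
  assume pd: "pd n B (insert k S)"
  have "form n B ?u > 0"
  proof (rule pd[unfolded pd_def, rule_format])
    show "?u i = 0" if "i \<notin> insert k S" for i
      using that inverse_on_mv_support[OF G, of i] by (auto simp: border_vec_def)
    show "\<exists>i\<in>insert k S. ?u i \<noteq> 0" by (simp add: border_vec_def)
  qed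
  then show "pd n B S \<and> ?s > 0" using pd_mono[OF pd, of S] form_border_vec by auto
next
  let ?u = "border_vec n B k G" and ?s = "pivot n B k G"
  assume a: "pd n B S \<and> ?s > 0"
  show "pd n B (insert k S)"
    unfolding pd_def
  proof (intro allI impI)
    fix x assume x0: "\<forall>i. i \<notin> insert k S \<longrightarrow> x i = 0" and x1: "\<exists>i\<in>insert k S. x i \<noteq> (0::real)"
    define y where "y i = x i - x k * ?u i" for i
    have y0: "y i = 0" if "i \<notin> S" for i
      using that x0 inverse_on_mv_support[OF G, of i] by (auto simp: y_def border_vec_def)
    have xy: "x = (\<lambda>i. y i + x k * ?u i)" by (simp add: y_def)
    have yu: "dot n y (mv n B ?u) = 0"
      unfolding dot_def
    proof (rule sum.neutral, rule ballI)
      fix i show "y i * mv n B ?u i = 0"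
        using y0[of i] mv_border_vec_in[of i] by (cases "i \<in> S") auto
    qed
    have "form n B x = form n B (\<lambda>i. y i + x k * ?u i)" using xy by simp
    also have "\<dots> = form n B y + 2 * x k * dot n y (mv n B ?u) + (x k)\<^sup>2 * form n B ?u"
    proof -
      have "dot n ?u (mv n B y) = dot n y (mv n B ?u)"
        using dot_mv[OF B, of n y ?u] by (simp add: dot_commute)
      then show ?thesis
        unfolding form_def mv_add mv_scale dot_add_left dot_add_right dot_scale_left dot_scale_right
        by (simp add: power2_eq_square algebra_simps)
    qed
    finally have fx: "form n B x = form n B y + (x k)\<^sup>2 * ?s"
      using yu form_border_vec by simp
    show "form n B x > 0"
    proof (cases "x k = 0")
      case True
      then have "y = x" by (auto simp: y_def)
      moreover have "\<exists>i\<in>S. x i \<noteq> 0" using x1 True by auto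
      ultimately have "form n B y > 0" using a y0 unfolding pd_def by blast
      then show ?thesis using fx True by simp
    next
      case False
      then have "(x k)\<^sup>2 * ?s > 0" using a by simp
      then show ?thesis using fx pd_form_nonneg[of n B S y] a y0 by fastforce
    qed
  qed
qed

end

text \<open>Gaussian elimination that starts at the end of the list, so \<open>rev [0..<k]\<close>
  adds the indices in increasing order. As total recursions by field operations, \<open>res\<close>
  and \<open>pivots_pos\<close> are measurable and local in the entries whether or not the matrix is
  definite.\<close>

primrec res :: "nat \<Rightarrow> (nat \<Rightarrow> nat \<Rightarrow> real) \<Rightarrow> nat list \<Rightarrow> nat \<Rightarrow> nat \<Rightarrow> real" where
  "res n B [] = (\<lambda>i j. 0)"
| "res n B (k # ks) = border n B k (res n B ks)"

primrec pivots_pos :: "nat \<Rightarrow> (nat \<Rightarrow> nat \<Rightarrow> real) \<Rightarrow> nat list \<Rightarrow> bool" where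
  "pivots_pos n B [] = True"
| "pivots_pos n B (k # ks) = (pivots_pos n B ks \<and> pivot n B k (res n B ks) > 0)"

lemma pd_empty: "pd n B {}"
  by (simp add: pd_def)

lemma inverse_on_empty: "inverse_on n B {} (\<lambda>i j. 0)"
  by (simp add: inverse_on_def symm_mat_def)

lemma res_correct:
  assumes "symm_mat B" "distinct ks" "set ks \<subseteq> {..<n}"
  shows "pivots_pos n B ks \<longleftrightarrow> pd n B (set ks)"
    and "pd n B (set ks) \<Longrightarrow> inverse_on n B (set ks) (res n B ks)"
proof -
  have "(pivots_pos n B ks \<longleftrightarrow> pd n B (set ks)) \<and>
      (pd n B (set ks) \<longrightarrow> inverse_on n B (set ks) (res n B ks))"
    using assms(2,3)
  proof (induction ks)
    case Nil
    then show ?case by (simp add: pd_empty inverse_on_empty)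
  next
    case (Cons k ks)
    then have IH: "pivots_pos n B ks \<longleftrightarrow> pd n B (set ks)"
      "pd n B (set ks) \<Longrightarrow> inverse_on n B (set ks) (res n B ks)"
      and k: "k < n" "k \<notin> set ks" by auto
    have 1: "pd n B (insert k (set ks)) \<longleftrightarrow> pd n B (set ks) \<and> pivot n B k (res n B ks) > 0"
      using pd_insert_iff[OF IH(2) assms(1) k] pd_mono[of n B "insert k (set ks)" "set ks"] by auto
    then show ?case using IH inverse_on_border[OF IH(2) assms(1) k] by auto
  qed
  then show "pivots_pos n B ks \<longleftrightarrow> pd n B (set ks)"
    and "pd n B (set ks) \<Longrightarrow> inverse_on n B (set ks) (res n B ks)" by auto
qed

text \<open>Holds without positivity, unlike the support clause of \<open>inverse_on\<close> that
  \<open>res_correct\<close> provides; this makes the congruence rules below unconditional.\<close>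

lemma res_support: "i \<notin> set ks \<or> j \<notin> set ks \<Longrightarrow> res n B ks i j = 0"
proof (induction ks arbitrary: i j)
  case Nil
  then show ?case by simp
next
  case (Cons k ks)
  have "border_vec n B k (res n B ks) l = 0" if "l \<notin> set (k # ks)" for l
    using that Cons.IH by (simp add: border_vec_def mv_def)
  then show ?case using Cons by (auto simp: border_def)
qed

lemma pivot_border_vec_cong:
  assumes "\<And>i j. i \<in> insert k (set ks) \<Longrightarrow> j \<in> insert k (set ks) \<Longrightarrow> B i j = C i j"
  shows "pivot n B k (res n D ks) = pivot n C k (res n D ks)"
    and "border_vec n B k (res n D ks) = border_vec n C k (res n D ks)"
proof -
  have eq: "res n D ks i j * - B j k = res n D ks i j * - C j k" for i j
    using assms res_support[of i ks j n D] by (cases "j \<in> set ks") auto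
  have mv: "mv n (res n D ks) (\<lambda>j. - B j k) = mv n (res n D ks) (\<lambda>j. - C j k)"
    by (simp only: mv_def eq)
  have "mv n (res n D ks) (\<lambda>j. - C j k) i = 0" if "i \<notin> set ks" for i
    using that res_support by (simp add: mv_def)
  then have "- B i k * mv n (res n D ks) (\<lambda>j. - C j k) i = - C i k * mv n (res n D ks) (\<lambda>j. - C j k) i" for i
    using assms by (cases "i \<in> set ks") auto
  then have "form n (res n D ks) (\<lambda>j. - B j k) = form n (res n D ks) (\<lambda>j. - C j k)"
    by (simp only: form_def dot_def mv)
  then show "pivot n B k (res n D ks) = pivot n C k (res n D ks)"
    and "border_vec n B k (res n D ks) = border_vec n C k (res n D ks)"
    using assms by (auto simp: border_vec_def mv pivot_def fun_eq_iff)
qed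

text \<open>Locality: resampling a row outside the list does not change the resolvent of the
  block.\<close>

lemma res_cong:
  assumes "\<And>i j. i \<in> set ks \<Longrightarrow> j \<in> set ks \<Longrightarrow> B i j = C i j"
  shows "res n B ks = res n C ks"
  using assms
proof (induction ks)
  case (Cons k ks)
  then have IH: "res n B ks = res n C ks" by auto
  show ?case
    using pivot_border_vec_cong[of k ks B C n C] Cons.prems by (simp add: IH border_def fun_eq_iff)
qed simp

lemma pivots_pos_cong:
  assumes "\<And>i j. i \<in> set ks \<Longrightarrow> j \<in> set ks \<Longrightarrow> B i j = C i j"
  shows "pivots_pos n B ks = pivots_pos n C ks"
  using assms
proof (induction ks)
  case (Cons k ks)
  have R: "res n B ks = res n C ks" using Cons.prems by (intro res_cong) auto
  show ?case
    using pivot_border_vec_cong(1)[of k ks B C n C] Cons by (simp add: R)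
qed simp

section \<open>Shifts of the spectral parameter\<close>

definition shift :: "real \<Rightarrow> (nat \<Rightarrow> nat \<Rightarrow> real) \<Rightarrow> nat \<Rightarrow> nat \<Rightarrow> real" where
  "shift \<eta> B i j = B i j + (if i = j then \<eta> else 0)"

lemma symm_mat_shift: "symm_mat B \<Longrightarrow> symm_mat (shift \<eta> B)"
  by (auto simp: symm_mat_def shift_def)

lemma mv_shift: "i < n \<Longrightarrow> mv n (shift \<eta> B) x i = mv n B x i + \<eta> * x i"
proof -
  assume "i < n"
  have "mv n (shift \<eta> B) x i = (\<Sum>j<n. B i j * x j + (\<eta> * x j) * (if j = i then 1 else 0))"
    unfolding mv_def shift_def by (intro sum.cong refl) (simp add: algebra_simps)
  also have "\<dots> = mv n B x i + \<eta> * x i"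
    using \<open>i < n\<close> by (simp only: sum.distrib sum_mult_if mv_def) simp
  finally show ?thesis .
qed

lemma form_shift: "form n (shift \<eta> B) x = form n B x + \<eta> * dot n x x"
proof -
  have "form n (shift \<eta> B) x = dot n x (\<lambda>i. mv n B x i + \<eta> * x i)"
    unfolding form_def by (intro dot_cong) (simp_all add: mv_shift)
  then show ?thesis by (simp add: dot_add_right dot_scale_right form_def)
qed

lemma pd_shift:
  assumes "pd n B S" "\<eta> \<ge> 0"
  shows "pd n (shift \<eta> B) S"
  using assms unfolding pd_def form_shift
  by (meson add_pos_nonneg dot_self_nonneg mult_nonneg_nonneg)

text \<open>The norm bound 1 / h for the inverse of B + h without eigenvalues: y = G x satisfies <x,
  y> = <y, B y> + h |y|^2 \<ge> h |y|^2, and Cauchy-Schwarz for <x, y> does the rest.\<close>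

lemma inverse_on_shift_bound:
  assumes G: "inverse_on n (shift h B) S G" and pd: "pd n B S" and h: "h > 0"
  shows "dot n (mv n G x) (mv n G x) \<le> dot n x x / h\<^sup>2"
    and "form n G x \<le> dot n x x / h"
proof -
  let ?y = "mv n G x"
  have "form n G x = form n B ?y + h * dot n ?y ?y"
    using inverse_on_form_eq[OF G] form_shift by simp
  moreover have "form n B ?y \<ge> 0"
    by (rule pd_form_nonneg[OF pd]) (rule inverse_on_mv_support[OF G])
  ultimately have 1: "h * dot n ?y ?y \<le> form n G x" by simp
  have 2: "(form n G x)\<^sup>2 \<le> dot n x x * dot n ?y ?y"
    unfolding form_def by (rule dot_le_sqrt)
  have y0: "dot n ?y ?y \<ge> 0" by (rule dot_self_nonneg)
  have "(h * dot n ?y ?y)\<^sup>2 \<le> (form n G x)\<^sup>2"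
    using 1 y0 h by (intro power_mono) auto
  with 2 have 3: "(h\<^sup>2 * dot n ?y ?y) * dot n ?y ?y \<le> dot n x x * dot n ?y ?y"
    by (simp add: power_mult_distrib power2_eq_square algebra_simps)
  have 4: "h\<^sup>2 * dot n ?y ?y \<le> dot n x x"
  proof (cases "dot n ?y ?y = 0")
    case True
    then show ?thesis by (simp add: dot_self_nonneg)
  next
    case False
    then show ?thesis using 3 y0 by (simp add: mult_le_cancel_right)
  qed
  then show "dot n ?y ?y \<le> dot n x x / h\<^sup>2"
    using h by (simp add: pos_le_divide_eq mult.commute)
  have "(h * form n G x)\<^sup>2 \<le> dot n x x * (h\<^sup>2 * dot n ?y ?y)"
    using mult_left_mono[OF 2, of "h\<^sup>2"] by (simp add: power_mult_distrib algebra_simps)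
  also have "\<dots> \<le> dot n x x * dot n x x"
    using 4 dot_self_nonneg by (intro mult_left_mono)
  finally have "(h * form n G x)\<^sup>2 \<le> (dot n x x)\<^sup>2" by (simp add: power2_eq_square)
  then have "h * form n G x \<le> dot n x x"
    using dot_self_nonneg by (rule power2_le_imp_le)
  then show "form n G x \<le> dot n x x / h"
    using h by (simp add: pos_le_divide_eq mult.commute)
qed

definition unit_vec_at :: "nat \<Rightarrow> nat \<Rightarrow> real" where
  "unit_vec_at j i = (if i = j then 1 else 0)"

lemma mv_unit_vec_at: "j < n \<Longrightarrow> mv n A (unit_vec_at j) i = A i j"
  by (simp add: mv_def unit_vec_at_def sum_mult_if)

lemma dot_unit_vec_at: "j < n \<Longrightarrow> dot n x (unit_vec_at j) = x j"
  by (simp add: dot_def unit_vec_at_def sum_mult_if)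

lemma tr_eq_sum_form: "tr n A = (\<Sum>j<n. form n A (unit_vec_at j))"
  unfolding tr_def form_def
  by (intro sum.cong refl) (simp add: dot_commute[of n "unit_vec_at _"] dot_unit_vec_at mv_unit_vec_at)

lemma form_mm_self:
  assumes "symm_mat G"
  shows "form n (mm n G G) x = dot n (mv n G x) (mv n G x)"
  by (simp add: form_def mv_mm dot_mv[OF assms])

lemma form_mm_cube:
  assumes "symm_mat G"
  shows "form n (mm n G (mm n G G)) x = form n G (mv n G x)"
  by (simp add: form_def mv_mm dot_mv[OF assms])

lemma tr_mm_self: "symm_mat G \<Longrightarrow> tr n (mm n G G) = (\<Sum>i<n. \<Sum>j<n. (G i j)\<^sup>2)"
  unfolding tr_def mm_def symm_mat_def by (intro sum.cong refl) (metis power2_eq_square)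

context
  fixes n B S G G' \<eta>
  assumes B: "symm_mat B" and G: "inverse_on n B S G" and G': "inverse_on n (shift \<eta> B) S G'"
    and pd: "pd n B S" and \<eta>: "\<eta> \<ge> 0"
begin

lemma resolvent_identity_mv: "mv n G x i = mv n G' x i + \<eta> * mv n G' (mv n G x) i"
proof -
  let ?y = "mv n G x"
  have y0: "?y i = 0" if "i \<notin> S" for i using inverse_on_mv_support[OF G that] .
  have "?y i = mv n G' (mv n (shift \<eta> B) ?y) i"
    using inverse_on_mv_left[OF G' symm_mat_shift[OF B], of ?y i] y0 by simp
  also have "\<dots> = (\<Sum>j<n. G' i j * (x j + \<eta> * ?y j))"
    unfolding mv_def[of n G']
  proof (intro sum.cong refl)
    fix j assume "j \<in> {..<n}"
    then show "G' i j * mv n (shift \<eta> B) ?y j = G' i j * (x j + \<eta> * ?y j)"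
      using inverse_onD(4)[OF G', of j i] inverse_on_mv[OF G, of j x]
      by (cases "j \<in> S") (auto simp: mv_shift)
  qed
  also have "\<dots> = mv n G' x i + \<eta> * mv n G' ?y i"
    by (simp add: mv_def[of n G'] algebra_simps sum.distrib sum_distrib_left)
  finally show ?thesis .
qed

text \<open>The transpose of the identity above, G = G' + \<eta> G G', read off by testing against
  unit vectors and using symmetry.\<close>

lemma resolvent_identity_mv': "mv n G x = (\<lambda>i. mv n G' x i + \<eta> * mv n G (mv n G' x) i)"
proof
  fix i
  have sG: "symm_mat G" and sG': "symm_mat G'" using inverse_onD(2) G G' by auto
  show "mv n G x i = mv n G' x i + \<eta> * mv n G (mv n G' x) i"
  proof (cases "i < n")
    case True
    let ?e = "unit_vec_at i"
    have "dot n (mv n G ?e) x = dot n (\<lambda>l. mv n G' ?e l + \<eta> * mv n G' (mv n G ?e) l) x"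
      by (intro dot_cong resolvent_identity_mv refl)
    then have "dot n ?e (mv n G x) = dot n ?e (mv n G' x) + \<eta> * dot n ?e (mv n G (mv n G' x))"
      by (simp add: dot_add_left dot_scale_left dot_mv[OF sG] dot_mv[OF sG'])
    then show ?thesis using True by (simp add: dot_commute[of n ?e] dot_unit_vec_at)
  next
    case False
    then have "i \<notin> S" using inverse_onD(1)[OF G] by auto
    then show ?thesis using inverse_on_mv_support[OF G] inverse_on_mv_support[OF G'] by simp
  qed
qed

text \<open>This is the form of G' G, which the resolvent identity turns into a square plus a
  nonnegative form of G.\<close>

lemma dot_mv_shift_mv_nonneg: "dot n (mv n G' w) (mv n G w) \<ge> 0"
proof -
  have "dot n (mv n G' w) (mv n G w) = dot n (mv n G' w) (mv n G' w) + \<eta> * form n G (mv n G' w)"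
    by (subst resolvent_identity_mv') (simp add: dot_add_right dot_scale_right form_def)
  then show ?thesis
    using dot_self_nonneg[of n "mv n G' w"] inverse_on_form_nonneg[OF G pd] \<eta> by simp
qed

text \<open>Applying the resolvent identity twice gives G = G' + \<eta> G'^2 + \<eta>^2 G' G G', and
  the last term is positive semidefinite.\<close>

lemma form_shift_le: "form n G x \<ge> form n G' x + \<eta> * dot n (mv n G' x) (mv n G' x)"
proof -
  have sG': "symm_mat G'" using inverse_onD(2) G' by auto
  have "form n G x = dot n x (\<lambda>i. mv n G' x i + \<eta> * mv n G' (mv n G x) i)"
    unfolding form_def by (intro dot_cong resolvent_identity_mv refl)
  also have "\<dots> = form n G' x + \<eta> * dot n (mv n G' x) (mv n G x)"
    by (simp add: dot_add_right dot_scale_right form_def dot_mv[OF sG'])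
  also have "dot n (mv n G' x) (mv n G x) =
      dot n (mv n G' x) (mv n G' x) + \<eta> * form n G (mv n G' x)"
    by (subst resolvent_identity_mv') (simp add: dot_add_right dot_scale_right form_def)
  finally show ?thesis
    using inverse_on_form_nonneg[OF G pd, of "mv n G' x"] \<eta> by (simp add: mult_left_mono)
qed

text \<open>G^2 is expanded with G = G' + \<eta> G' G. Beyond the two terms kept there remain 2
  \<eta>^2 times the form of G' G at G' x and \<eta>^2 |G' G x|^2, both nonnegative.\<close>

lemma dot_shift_le:
  "dot n (mv n G x) (mv n G x) \<ge> dot n (mv n G' x) (mv n G' x) + 2 * \<eta> * form n G' (mv n G' x)"
proof -
  have sG': "symm_mat G'" using inverse_onD(2) G' by auto
  let ?a = "mv n G' x" and ?b = "mv n G' (mv n G x)"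
  have eq: "mv n G x = (\<lambda>i. ?a i + \<eta> * ?b i)" by (intro ext resolvent_identity_mv)
  have "dot n (mv n G x) (mv n G x) = dot n ?a ?a + 2 * \<eta> * dot n ?a ?b + \<eta>\<^sup>2 * dot n ?b ?b"
    by (subst (1 2) eq) (simp add: dot_add_left dot_add_right dot_scale_left dot_scale_right
        dot_commute[of n ?b ?a] power2_eq_square algebra_simps)
  moreover have "dot n ?a ?b = dot n (mv n G' ?a) (mv n G x)"
    by (simp add: dot_mv[OF sG'])
  moreover have "\<dots> = form n G' ?a + \<eta> * dot n (mv n G' ?a) (mv n G ?a)"
    by (subst resolvent_identity_mv') (simp add: dot_add_right dot_scale_right form_def dot_mv[OF sG'])
  moreover have "\<eta> * (\<eta> * dot n (mv n G' ?a) (mv n G ?a)) \<ge> 0"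
    using \<eta> dot_mv_shift_mv_nonneg by simp
  moreover have "\<eta>\<^sup>2 * dot n ?b ?b \<ge> 0" using dot_self_nonneg by simp
  ultimately show ?thesis by (simp add: algebra_simps)
qed

text \<open>Convexity in the spectral parameter: tr G and tr G^2 lie above their tangents, whose
  slopes are - tr G^2 and - 2 tr G^3. The tangent is taken at the raised parameter, so later
  compensators are evaluated there.\<close>

lemma tr_shift_le: "tr n G \<ge> tr n G' + \<eta> * tr n (mm n G' G')"
proof -
  have sG': "symm_mat G'" using inverse_onD(2) G' by auto
  show ?thesis
    unfolding tr_eq_sum_form form_mm_self[OF sG'] sum_distrib_left sum.distrib[symmetric]
    by (intro sum_mono form_shift_le)
qed

lemma tr_square_shift_le: "tr n (mm n G G) \<ge> tr n (mm n G' G') + 2 * \<eta> * tr n (mm n G' (mm n G' G'))"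
proof -
  have sG: "symm_mat G" and sG': "symm_mat G'" using inverse_onD(2) G G' by auto
  show ?thesis
    unfolding tr_eq_sum_form form_mm_self[OF sG'] form_mm_self[OF sG] form_mm_cube[OF sG']
      sum_distrib_left sum.distrib[symmetric]
    by (intro sum_mono dot_shift_le)
qed

end

section \<open>Traces under rank-one updates\<close>

lemma tr_rank_one: "tr n (\<lambda>i j. A i j + u i * u j / s) = tr n A + dot n u u / s"
  by (simp add: tr_def dot_def sum.distrib sum_divide_distrib)

lemma tr_square_rank_one:
  assumes "symm_mat A"
  shows "tr n (mm n (\<lambda>i j. A i j + u i * u j / s) (\<lambda>i j. A i j + u i * u j / s)) =
    tr n (mm n A A) + 2 / s * form n A u + (dot n u u / s)\<^sup>2"
proof -
  have "tr n (mm n (\<lambda>i j. A i j + u i * u j / s) (\<lambda>i j. A i j + u i * u j / s)) =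
    (\<Sum>i<n. \<Sum>k<n. (A i k + u i * u k / s)\<^sup>2)"
    unfolding tr_def mm_def using assms unfolding symm_mat_def
    by (intro sum.cong refl) (simp add: power2_eq_square mult.commute)
  also have "\<dots> = (\<Sum>i<n. \<Sum>k<n. (A i k)\<^sup>2) + (\<Sum>i<n. \<Sum>k<n. (2 / s) * (u i * (A i k * u k)))
      + (\<Sum>i<n. \<Sum>k<n. (u i * u i / s) * (u k * u k / s))"
    unfolding sum.distrib[symmetric]
    by (intro sum.cong refl) (simp add: power2_eq_square add_divide_distrib algebra_simps)
  also have "(\<Sum>i<n. \<Sum>k<n. (2 / s) * (u i * (A i k * u k))) = 2 / s * form n A u"
    by (simp only: form_def dot_def mv_def sum_distrib_left)
  also have "(\<Sum>i<n. \<Sum>k<n. (u i * u i / s) * (u k * u k / s)) = (dot n u u / s)\<^sup>2"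
    by (simp add: dot_def power2_eq_square sum_product sum_divide_distrib)
  finally show ?thesis by (simp add: tr_mm_self[OF assms])
qed

text \<open>The vector is G applied to the new column plus a unit vector at k, where G vanishes. Its
  norm and its G-form are therefore forms of G^2 and G^3 in the new column.\<close>

lemma border_vec_dot:
  assumes G: "inverse_on n B S G" and k: "k < n" "k \<notin> S"
  shows "dot n (border_vec n C k G) (border_vec n C k G) = 1 + form n (mm n G G) (\<lambda>j. - C j k)"
    and "form n G (border_vec n C k G) = form n (mm n G (mm n G G)) (\<lambda>j. - C j k)"
proof -
  let ?w = "mv n G (\<lambda>j. - C j k)"
  have sG: "symm_mat G" using inverse_onD(2) G by auto
  have wk: "?w k = 0" using inverse_on_mv_support[OF G k(2)] .
  have u: "border_vec n C k G = (\<lambda>i. ?w i + unit_vec_at k i)"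
    using wk by (auto simp: border_vec_def unit_vec_at_def fun_eq_iff)
  have e: "dot n (unit_vec_at k) y = y k" for y
    using k by (simp add: dot_commute[of n "unit_vec_at k"] dot_unit_vec_at)
  have "dot n (border_vec n C k G) (border_vec n C k G) = dot n ?w ?w + 1"
    unfolding u dot_add_left dot_add_right e using k wk
    by (simp add: dot_unit_vec_at) (simp add: unit_vec_at_def)
  then show "dot n (border_vec n C k G) (border_vec n C k G) = 1 + form n (mm n G G) (\<lambda>j. - C j k)"
    by (simp add: form_mm_self[OF sG])
  have "mv n G (border_vec n C k G) = mv n G ?w"
    unfolding mv_def[of n G "border_vec n C k G"] mv_def[of n G ?w]
    by (intro ext sum.cong refl) (simp add: border_vec_def inverse_onD(4)[OF G k(2)])
  moreover have "mv n G ?w k = 0" using inverse_on_mv_support[OF G k(2)] .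
  ultimately show "form n G (border_vec n C k G) = form n (mm n G (mm n G G)) (\<lambda>j. - C j k)"
    unfolding form_mm_cube[OF sG] unfolding form_def by (simp add: u dot_add_left e)
qed

text \<open>Asking the pivot to be at least 1, not just positive, removes the division by it: all
  added terms are nonnegative, and what remains is polynomial in the new row.\<close>

lemma border_traces:
  assumes G: "inverse_on n B S G" and pd: "pd n B S" and k: "k < n" "k \<notin> S"
    and s: "pivot n B k G \<ge> 1"
  defines "\<xi>2 \<equiv> form n (mm n G G) (\<lambda>j. - B j k)" and "\<xi>3 \<equiv> form n (mm n G (mm n G G)) (\<lambda>j. - B j k)"
  shows "\<xi>2 \<ge> 0" "\<xi>3 \<ge> 0" "tr n (border n B k G) \<le> tr n G + 1 + \<xi>2"
    "tr n (mm n (border n B k G) (border n B k G)) \<le> tr n (mm n G G) + 2 * \<xi>3 + (1 + \<xi>2)\<^sup>2"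
proof -
  have sG: "symm_mat G" using inverse_onD(2) G by auto
  let ?u = "border_vec n B k G" and ?s = "pivot n B k G"
  note uu = border_vec_dot[OF G k, of B, folded \<xi>2_def \<xi>3_def]
  show 2: "\<xi>2 \<ge> 0" unfolding \<xi>2_def form_mm_self[OF sG] by (rule dot_self_nonneg)
  show 3: "\<xi>3 \<ge> 0" unfolding \<xi>3_def form_mm_cube[OF sG] by (rule inverse_on_form_nonneg[OF G pd])
  have b: "border n B k G = (\<lambda>i j. G i j + ?u i * ?u j / ?s)"
    by (intro ext) (simp add: border_def)
  have le: "(1 + \<xi>2) / ?s \<le> 1 + \<xi>2"
    using 2 s by (simp add: divide_le_eq mult_le_cancel_left1)
  then show "tr n (border n B k G) \<le> tr n G + 1 + \<xi>2"
    unfolding b tr_rank_one uu by simp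
  have "((1 + \<xi>2) / ?s)\<^sup>2 \<le> (1 + \<xi>2)\<^sup>2"
    using le 2 s by (intro power_mono) auto
  moreover have "2 / ?s * \<xi>3 \<le> 2 * \<xi>3"
    using 3 s by (simp add: divide_le_eq mult_le_cancel_left1)
  ultimately show "tr n (mm n (border n B k G) (border n B k G)) \<le> tr n (mm n G G) + 2 * \<xi>3 + (1 + \<xi>2)\<^sup>2"
    unfolding b tr_square_rank_one[OF sG] uu by simp
qed

section \<open>Moments of linear and quadratic forms\<close>

text \<open>A class closed under sums and products, so that integrability of any polynomial in the
  entries is a matter of introduction rules.\<close>

definition all_moments :: "'a measure \<Rightarrow> ('a \<Rightarrow> real) \<Rightarrow> bool" where
  "all_moments M f \<longleftrightarrow> f \<in> borel_measurable M \<and> (\<forall>p::nat. integrable M (\<lambda>\<omega>. \<bar>f \<omega>\<bar> ^ p))"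

lemma power_add_le: "\<bar>x + y :: real\<bar> ^ p \<le> 2 ^ p * (\<bar>x\<bar> ^ p + \<bar>y\<bar> ^ p)"
proof -
  have "\<bar>x + y\<bar> \<le> 2 * max \<bar>x\<bar> \<bar>y\<bar>" by auto
  then have "\<bar>x + y\<bar> ^ p \<le> (2 * max \<bar>x\<bar> \<bar>y\<bar>) ^ p" by (intro power_mono) auto
  also have "\<dots> = 2 ^ p * (max \<bar>x\<bar> \<bar>y\<bar>) ^ p" by (simp add: power_mult_distrib)
  also have "(max \<bar>x\<bar> \<bar>y\<bar>) ^ p \<le> \<bar>x\<bar> ^ p + \<bar>y\<bar> ^ p" by (auto simp: max_def)
  finally show ?thesis by simp
qed

lemma all_moments_integrable: "all_moments M f \<Longrightarrow> integrable M f"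
proof -
  assume f: "all_moments M f"
  then have "integrable M (\<lambda>\<omega>. \<bar>f \<omega>\<bar> ^ 1)" unfolding all_moments_def by blast
  then show "integrable M f" using f by (simp add: all_moments_def integrable_abs_iff)
qed

lemma all_moments_add:
  assumes "all_moments M f" "all_moments M g"
  shows "all_moments M (\<lambda>\<omega>. f \<omega> + g \<omega>)"
  unfolding all_moments_def
proof (intro conjI allI)
  fix p
  have [measurable]: "f \<in> borel_measurable M" "g \<in> borel_measurable M"
    using assms by (auto simp: all_moments_def)
  show "(\<lambda>\<omega>. f \<omega> + g \<omega>) \<in> borel_measurable M" by simp
  show "integrable M (\<lambda>\<omega>. \<bar>f \<omega> + g \<omega>\<bar> ^ p)"
  proof (rule Bochner_Integration.integrable_bound)
    show "integrable M (\<lambda>\<omega>. 2 ^ p * (\<bar>f \<omega>\<bar> ^ p + \<bar>g \<omega>\<bar> ^ p))"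
      using assms by (auto simp: all_moments_def)
    show "AE \<omega> in M. norm (\<bar>f \<omega> + g \<omega>\<bar> ^ p) \<le> norm (2 ^ p * (\<bar>f \<omega>\<bar> ^ p + \<bar>g \<omega>\<bar> ^ p))"
      by (auto intro!: order_trans[OF power_add_le])
  qed simp
qed

lemma all_moments_mult:
  assumes "all_moments M f" "all_moments M g"
  shows "all_moments M (\<lambda>\<omega>. f \<omega> * g \<omega>)"
  unfolding all_moments_def
proof (intro conjI allI)
  fix p
  have [measurable]: "f \<in> borel_measurable M" "g \<in> borel_measurable M"
    using assms by (auto simp: all_moments_def)
  show "(\<lambda>\<omega>. f \<omega> * g \<omega>) \<in> borel_measurable M" by simp
  have le: "x * y \<le> x ^ 2 + y ^ 2" for x y :: real
    using sum_squares_bound[of x y] zero_le_power2[of x] zero_le_power2[of y] by linarith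
  show "integrable M (\<lambda>\<omega>. \<bar>f \<omega> * g \<omega>\<bar> ^ p)"
  proof (rule Bochner_Integration.integrable_bound)
    show "integrable M (\<lambda>\<omega>. \<bar>f \<omega>\<bar> ^ (p * 2) + \<bar>g \<omega>\<bar> ^ (p * 2))"
      using assms by (auto simp: all_moments_def)
    show "AE \<omega> in M. norm (\<bar>f \<omega> * g \<omega>\<bar> ^ p) \<le> norm (\<bar>f \<omega>\<bar> ^ (p * 2) + \<bar>g \<omega>\<bar> ^ (p * 2))"
      using le[of "\<bar>f _\<bar> ^ p" "\<bar>g _\<bar> ^ p"]
      by (simp add: abs_mult power_mult_distrib flip: power_mult)
  qed simp
qed

lemma (in prob_space) all_moments_const: "all_moments M (\<lambda>\<omega>. c)"
  by (simp add: all_moments_def)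

lemma (in prob_space) all_moments_scale: "all_moments M f \<Longrightarrow> all_moments M (\<lambda>\<omega>. c * f \<omega>)"
  by (intro all_moments_mult all_moments_const)

lemma (in prob_space) all_moments_diff:
  assumes "all_moments M f" "all_moments M g"
  shows "all_moments M (\<lambda>\<omega>. f \<omega> - g \<omega>)"
  using all_moments_add[OF assms(1) all_moments_scale[OF assms(2), of "-1"]] by simp

lemma (in prob_space) all_moments_power: "all_moments M f \<Longrightarrow> all_moments M (\<lambda>\<omega>. f \<omega> ^ p)"
  by (induction p) (simp_all add: all_moments_const all_moments_mult)

lemma (in prob_space) all_moments_sum:
  assumes "\<And>i. i \<in> S \<Longrightarrow> all_moments M (f i)"
  shows "all_moments M (\<lambda>\<omega>. \<Sum>i\<in>S. f i \<omega>)"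
  using assms
proof (induction S rule: infinite_finite_induct)
  case (insert k S)
  then show ?case by (simp add: all_moments_add)
qed (simp_all add: all_moments_const)

lemmas (in prob_space) all_moments_intros =
  all_moments_const all_moments_add all_moments_diff all_moments_mult all_moments_power all_moments_sum

section \<open>Second-order expansion of powers and weighted inequalities\<close>

lemma power_add_taylor_bound:
  fixes s d :: real
  shows "\<bar>(s + d) ^ (m + 2) - s ^ (m + 2) - real (m + 2) * s ^ (m + 1) * d\<bar>
    \<le> (real (m + 2))\<^sup>2 * (\<bar>s\<bar> + \<bar>d\<bar>) ^ m * d\<^sup>2"
proof (induction m)
  case 0
  then show ?case by (simp add: power2_eq_square algebra_simps)
next
  case (Suc m)
  let ?R = "(s + d) ^ (m + 2) - s ^ (m + 2) - real (m + 2) * s ^ (m + 1) * d"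
  \<comment> \<open>The old remainder is multiplied by s + d; the only new contribution is d times
    the old linear term.\<close>
  have eq: "(s + d) ^ (Suc m + 2) - s ^ (Suc m + 2) - real (Suc m + 2) * s ^ (Suc m + 1) * d
      = real (m + 2) * s ^ (m + 1) * d\<^sup>2 + (s + d) * ?R"
    by (simp add: algebra_simps power2_eq_square)
  have a: "\<bar>s ^ (m + 1)\<bar> \<le> (\<bar>s\<bar> + \<bar>d\<bar>) ^ (m + 1)"
    unfolding power_abs by (intro power_mono) auto
  have "\<bar>(s + d) * ?R\<bar> \<le> (\<bar>s\<bar> + \<bar>d\<bar>) * ((real (m + 2))\<^sup>2 * (\<bar>s\<bar> + \<bar>d\<bar>) ^ m * d\<^sup>2)"
    unfolding abs_mult by (intro mult_mono Suc.IH) auto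
  moreover have "\<bar>real (m + 2) * s ^ (m + 1) * d\<^sup>2\<bar> \<le> real (m + 2) * (\<bar>s\<bar> + \<bar>d\<bar>) ^ (m + 1) * d\<^sup>2"
    unfolding abs_mult using a by (intro mult_mono) auto
  ultimately have "\<bar>real (m + 2) * s ^ (m + 1) * d\<^sup>2 + (s + d) * ?R\<bar>
      \<le> real (m + 2) * (\<bar>s\<bar> + \<bar>d\<bar>) ^ (m + 1) * d\<^sup>2 +
        (\<bar>s\<bar> + \<bar>d\<bar>) * ((real (m + 2))\<^sup>2 * (\<bar>s\<bar> + \<bar>d\<bar>) ^ m * d\<^sup>2)"
    by (intro order_trans[OF abs_triangle_ineq] add_mono)
  also have "\<dots> = (real (m + 2) + (real (m + 2))\<^sup>2) * ((\<bar>s\<bar> + \<bar>d\<bar>) ^ Suc m * d\<^sup>2)"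
  proof -
    have "c * P ^ (m + 1) * e + P * (c\<^sup>2 * P ^ m * e) = (c + c\<^sup>2) * (P ^ Suc m * e)" for c P e :: real
      by (simp add: algebra_simps)
    then show ?thesis .
  qed
  also have "\<dots> \<le> (real (Suc m + 2))\<^sup>2 * ((\<bar>s\<bar> + \<bar>d\<bar>) ^ Suc m * d\<^sup>2)"
  proof (rule mult_right_mono)
    show "real (m + 2) + (real (m + 2))\<^sup>2 \<le> (real (Suc m + 2))\<^sup>2"
      by (simp add: power2_eq_square algebra_simps)
  qed simp
  finally show ?case unfolding eq by (simp add: mult.assoc)
qed

definition taylor_const :: "nat \<Rightarrow> real" where
  "taylor_const p = (real (2 * p + 2))\<^sup>2 * 4 ^ p"

lemma taylor_const_pos: "taylor_const p > 0"
  by (simp add: taylor_const_def)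

text \<open>The linear term stays exact because its expectation will vanish; only the second-order
  remainder is estimated, and the even exponent makes all powers in it nonnegative.\<close>

lemma even_power_add_le:
  fixes s d :: real
  shows "(s + d) ^ (2 * p + 2) \<le> s ^ (2 * p + 2) + real (2 * p + 2) * (s ^ (2 * p + 1) * d)
    + taylor_const p * (s ^ (2 * p) * d\<^sup>2 + d ^ (2 * p + 2))"
proof -
  have "(\<bar>s\<bar> + \<bar>d\<bar>) ^ (2 * p) \<le> 4 ^ p * (s ^ (2 * p) + d ^ (2 * p))"
    using power_add_le[of "\<bar>s\<bar>" "\<bar>d\<bar>" "2 * p"] by (simp add: power_mult)
  then have "(real (2 * p + 2))\<^sup>2 * (\<bar>s\<bar> + \<bar>d\<bar>) ^ (2 * p) * d\<^sup>2 \<le>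
      (real (2 * p + 2))\<^sup>2 * (4 ^ p * (s ^ (2 * p) + d ^ (2 * p))) * d\<^sup>2"
    by (intro mult_right_mono mult_left_mono) auto
  also have "\<dots> = taylor_const p * (s ^ (2 * p) * d\<^sup>2 + d ^ (2 * p + 2))"
    unfolding taylor_const_def power_add by (simp add: algebra_simps)
  finally show ?thesis
    using power_add_taylor_bound[of s d "2 * p"] by (simp add: algebra_simps)
qed

text \<open>Lets the growth of \<theta> by t pay for both error terms of a peeling step, so that
  moment constants do not grow with the number of indices.\<close>

lemma power_Suc_add_ge:
  fixes \<theta> t :: real
  assumes "\<theta> \<ge> 0" "t \<ge> 0"
  shows "\<theta> ^ Suc p + \<theta> ^ p * t \<le> (\<theta> + t) ^ Suc p" "\<theta> ^ Suc p + t ^ Suc p \<le> (\<theta> + t) ^ Suc p"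
proof -
  have 1: "\<theta> ^ p \<le> (\<theta> + t) ^ p" "t ^ p \<le> (\<theta> + t) ^ p"
    using assms by (auto intro!: power_mono)
  show "\<theta> ^ Suc p + \<theta> ^ p * t \<le> (\<theta> + t) ^ Suc p"
    using mult_left_mono[OF 1(1), of "\<theta> + t"] assms by (simp add: algebra_simps)
  show "\<theta> ^ Suc p + t ^ Suc p \<le> (\<theta> + t) ^ Suc p"
    using mult_left_mono[OF 1(1) assms(1)] mult_left_mono[OF 1(2) assms(2)] by (simp add: algebra_simps)
qed

text \<open>Split at b = w * a: in each case one of the two terms alone bounds the product.\<close>

lemma weighted_young:
  fixes a b w :: real
  assumes "a \<ge> 0" "b \<ge> 0" "w > 0"
  shows "a ^ p * b \<le> w * a ^ Suc p + (1 / w) ^ p * b ^ Suc p"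
proof (cases "b \<le> w * a")
  case True
  then have "a ^ p * b \<le> a ^ p * (w * a)" using assms by (intro mult_left_mono) auto
  then show ?thesis using assms by (simp add: algebra_simps add_increasing2)
next
  case False
  then have "a \<le> 1 / w * b" using assms by (simp add: field_simps)
  then have "a ^ p \<le> (1 / w * b) ^ p" using assms by (intro power_mono) auto
  then have "a ^ p * b \<le> (1 / w * b) ^ p * b" using assms by (intro mult_right_mono) auto
  then show ?thesis using assms by (simp add: power_mult_distrib power_divide algebra_simps add_increasing)
qed

text \<open>A peeling step either lowers the exponent by two at the price of a variance, or puts the
  full power 2 * p + 2 on the new variable; the recursion records these two terms.\<close>

fun linear_const :: "(nat \<Rightarrow> real) \<Rightarrow> nat \<Rightarrow> real" where
  "linear_const \<kappa> 0 = 1"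
| "linear_const \<kappa> (Suc p) = taylor_const p * (linear_const \<kappa> p * \<kappa> 2 + \<kappa> (2 * p + 2))"

lemma linear_const_nonneg: "(\<And>p. \<kappa> p \<ge> 0) \<Longrightarrow> linear_const \<kappa> p \<ge> 0"
proof (induction p)
  case (Suc p)
  then show ?case using less_imp_le[OF taylor_const_pos[of p]] by simp
qed simp

context prob_space
begin

definition centred_family :: "(nat \<Rightarrow> real) \<Rightarrow> (nat \<Rightarrow> 'a \<Rightarrow> real) \<Rightarrow> nat set \<Rightarrow> bool" where
  "centred_family \<kappa> \<xi> S \<longleftrightarrow> finite S \<and> indep_vars (\<lambda>_. borel) \<xi> S \<and> (\<forall>p. \<kappa> p \<ge> 0) \<and>
     (\<forall>j\<in>S. all_moments M (\<xi> j) \<and> expectation (\<xi> j) = 0 \<and> (\<forall>p. expectation (\<lambda>\<omega>. \<bar>\<xi> j \<omega>\<bar> ^ p) \<le> \<kappa> p))"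

lemma centred_family_mono: "centred_family \<kappa> \<xi> T \<Longrightarrow> S \<subseteq> T \<Longrightarrow> centred_family \<kappa> \<xi> S"
  unfolding centred_family_def using indep_vars_subset by (metis finite_subset subsetD)

text \<open>F receives the restricted family, which makes it visibly a function of the variables in
  S alone and hence independent of \<xi> k.\<close>

lemma expectation_mult_indep:
  assumes ind: "indep_vars (\<lambda>_. borel) \<xi> (insert k S)" and k: "k \<notin> S"
    and F: "F \<in> borel_measurable (PiM S (\<lambda>_. borel))" and g: "g \<in> borel_measurable borel"
    and iF: "integrable M (\<lambda>\<omega>. F (\<lambda>j\<in>S. \<xi> j \<omega>) :: real)" and ig: "integrable M (\<lambda>\<omega>. g (\<xi> k \<omega>) :: real)"
  shows "expectation (\<lambda>\<omega>. F (\<lambda>j\<in>S. \<xi> j \<omega>) * g (\<xi> k \<omega>)) =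
    expectation (\<lambda>\<omega>. F (\<lambda>j\<in>S. \<xi> j \<omega>)) * expectation (\<lambda>\<omega>. g (\<xi> k \<omega> :: real))"
proof -
  have "indep_var (PiM S (\<lambda>_. borel)) (\<lambda>\<omega>. restrict (\<lambda>i. \<xi> i \<omega>) S)
      (PiM {k} (\<lambda>_. borel)) (\<lambda>\<omega>. restrict (\<lambda>i. \<xi> i \<omega>) {k})"
    using ind k by (intro indep_var_restrict[where I = "insert k S"]) auto
  moreover have "(\<lambda>y. g (y k)) \<in> borel_measurable (PiM {k} (\<lambda>_. borel :: real measure))"
    using g by measurable
  ultimately have "indep_var borel (F \<circ> (\<lambda>\<omega>. restrict (\<lambda>i. \<xi> i \<omega>) S))
      borel ((\<lambda>y. g (y k)) \<circ> (\<lambda>\<omega>. restrict (\<lambda>i. \<xi> i \<omega>) {k}))"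
    using F by (intro indep_var_compose)
  then have "indep_var borel (\<lambda>\<omega>. F (\<lambda>j\<in>S. \<xi> j \<omega>)) borel (\<lambda>\<omega>. g (\<xi> k \<omega>))"
    by (simp add: comp_def)
  then show ?thesis using iF ig by (rule indep_var_lebesgue_integral)
qed

lemma expectation_combination:
  assumes "integrable M f1" "integrable M f2" "integrable M f3" "integrable M f4"
  shows "expectation (\<lambda>\<omega>. f1 \<omega> + c * f2 \<omega> + a * (t * f3 \<omega> + u * f4 \<omega>) :: real) =
    expectation f1 + c * expectation f2 + a * (t * expectation f3 + u * expectation f4)"
  using assms by simp

text \<open>Indices are peeled off inside an induction on the exponent. Independence and mean zero
  remove the linear term, and the increments add up by superadditivity of powers of the sum of
  squares, so the constant does not depend on S.\<close>

lemma linear_moment: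
  assumes "centred_family \<kappa> \<xi> S"
  shows "expectation (\<lambda>\<omega>. (\<Sum>j\<in>S. a j * \<xi> j \<omega>) ^ (2 * p)) \<le> linear_const \<kappa> p * (\<Sum>j\<in>S. (a j)\<^sup>2) ^ p"
  using assms
proof (induction p arbitrary: S)
  case 0
  then show ?case by (simp add: prob_space)
next
  case (Suc p)
  have "finite S" using Suc.prems by (simp add: centred_family_def)
  then show ?case using Suc.prems
  proof (induction S)
    case empty
    then show ?case by simp
  next
    case (insert k S)
    have fam: "centred_family \<kappa> \<xi> S" using centred_family_mono insert.prems by blast
    have ind: "indep_vars (\<lambda>_. borel) \<xi> (insert k S)" using insert.prems by (simp add: centred_family_def)
    have am: "all_moments M (\<xi> j)" if "j \<in> insert k S" for j
      using insert.prems that by (auto simp: centred_family_def)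
    have \<kappa>: "\<kappa> p \<ge> 0" for p using insert.prems by (simp add: centred_family_def)
    define L where "L \<omega> = (\<Sum>j\<in>S. a j * \<xi> j \<omega>)" for \<omega>
    define \<sigma> where "\<sigma> = (\<Sum>j\<in>S. (a j)\<^sup>2)"
    let ?t = "(a k)\<^sup>2"
    have \<sigma>: "\<sigma> \<ge> 0" by (simp add: \<sigma>_def sum_nonneg)
    have amL: "all_moments M L" unfolding L_def
      by (intro all_moments_intros am) auto
    have amk: "all_moments M (\<xi> k)" using am by simp
    have LF: "L \<omega> = (\<Sum>j\<in>S. a j * (\<lambda>j\<in>S. \<xi> j \<omega>) j)" for \<omega>
      unfolding L_def by (intro sum.cong) auto
    have prod: "expectation (\<lambda>\<omega>. L \<omega> ^ q * (\<xi> k \<omega>) ^ r) = expectation (\<lambda>\<omega>. L \<omega> ^ q) * expectation (\<lambda>\<omega>. \<xi> k \<omega> ^ r)" for q r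
      unfolding LF
      by (rule expectation_mult_indep[OF ind \<open>k \<notin> S\<close>, where F = "\<lambda>x. (\<Sum>j\<in>S. a j * x j) ^ q" and g = "\<lambda>y. y ^ r"])
        (use all_moments_integrable[OF all_moments_power[OF amL]] all_moments_integrable[OF all_moments_power[OF amk]]
          in \<open>auto simp: L_def\<close>)
    have m1: "expectation (\<xi> k) = 0" using insert.prems by (simp add: centred_family_def)
    have m2: "expectation (\<lambda>\<omega>. \<xi> k \<omega> ^ (2 * r)) \<le> \<kappa> (2 * r)" for r
    proof -
      have "expectation (\<lambda>\<omega>. \<bar>\<xi> k \<omega>\<bar> ^ (2 * r)) \<le> \<kappa> (2 * r)"
        using insert.prems unfolding centred_family_def by blast
      then show ?thesis by (simp add: power_even_abs)
    qed
    have ints: "integrable M (\<lambda>\<omega>. L \<omega> ^ q * \<xi> k \<omega> ^ r)" for q r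
      by (intro all_moments_integrable all_moments_intros amL amk)
    have ints': "integrable M (\<lambda>\<omega>. L \<omega> ^ q)" "integrable M (\<lambda>\<omega>. \<xi> k \<omega> ^ q)"
      "integrable M (\<lambda>\<omega>. (L \<omega> + a k * \<xi> k \<omega>) ^ q)" for q
      by (intro all_moments_integrable all_moments_intros amL amk)+
    have "expectation (\<lambda>\<omega>. (\<Sum>j\<in>insert k S. a j * \<xi> j \<omega>) ^ (2 * Suc p))
        = expectation (\<lambda>\<omega>. (L \<omega> + a k * \<xi> k \<omega>) ^ (2 * p + 2))"
      using insert.hyps by (simp add: L_def add.commute)
    also have "\<dots> \<le> expectation (\<lambda>\<omega>. L \<omega> ^ (2 * p + 2) + real (2 * p + 2) * a k * (L \<omega> ^ (2 * p + 1) * \<xi> k \<omega> ^ 1)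
        + taylor_const p * (?t * (L \<omega> ^ (2 * p) * \<xi> k \<omega> ^ 2) + ?t ^ Suc p * \<xi> k \<omega> ^ (2 * Suc p)))"
    proof (rule integral_mono)
      fix \<omega>
      show "(L \<omega> + a k * \<xi> k \<omega>) ^ (2 * p + 2) \<le> L \<omega> ^ (2 * p + 2) + real (2 * p + 2) * a k * (L \<omega> ^ (2 * p + 1) * \<xi> k \<omega> ^ 1)
        + taylor_const p * (?t * (L \<omega> ^ (2 * p) * \<xi> k \<omega> ^ 2) + ?t ^ Suc p * \<xi> k \<omega> ^ (2 * Suc p))"
        using even_power_add_le[of "L \<omega>" "a k * \<xi> k \<omega>" p]
        by (simp add: power_mult_distrib power_mult[symmetric] algebra_simps) (simp add: power2_eq_square power_add algebra_simps)
    qed (intro ints ints' Bochner_Integration.integrable_add integrable_mult_right)+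
    also have "\<dots> = expectation (\<lambda>\<omega>. L \<omega> ^ (2 * p + 2)) +
        taylor_const p * (?t * (expectation (\<lambda>\<omega>. L \<omega> ^ (2 * p)) * expectation (\<lambda>\<omega>. \<xi> k \<omega> ^ 2))
          + ?t ^ Suc p * expectation (\<lambda>\<omega>. \<xi> k \<omega> ^ (2 * Suc p)))"
      unfolding expectation_combination[OF ints'(1) ints ints ints'(2)] prod by (simp add: m1)
    also have "\<dots> \<le> linear_const \<kappa> (Suc p) * \<sigma> ^ Suc p +
        taylor_const p * (?t * (linear_const \<kappa> p * \<sigma> ^ p * \<kappa> 2) + ?t ^ Suc p * \<kappa> (2 * Suc p))"
    proof (intro add_mono mult_left_mono mult_mono)
      show "expectation (\<lambda>\<omega>. L \<omega> ^ (2 * p + 2)) \<le> linear_const \<kappa> (Suc p) * \<sigma> ^ Suc p"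
        using insert.IH[OF fam] by (simp add: L_def \<sigma>_def)
      show "expectation (\<lambda>\<omega>. L \<omega> ^ (2 * p)) \<le> linear_const \<kappa> p * \<sigma> ^ p"
        using Suc.IH[OF fam] by (simp add: L_def \<sigma>_def)
      show "expectation (\<lambda>\<omega>. \<xi> k \<omega> ^ 2) \<le> \<kappa> 2" using m2[of 1] by simp
      show "expectation (\<lambda>\<omega>. \<xi> k \<omega> ^ (2 * Suc p)) \<le> \<kappa> (2 * Suc p)" by (rule m2)
      show "0 \<le> linear_const \<kappa> p * \<sigma> ^ p" using \<kappa> \<sigma> linear_const_nonneg by simp
    qed (use taylor_const_pos less_imp_le in auto)
    also have "\<dots> \<le> linear_const \<kappa> (Suc p) * (\<sigma> + ?t) ^ Suc p"
    proof -
      have "\<sigma> ^ p * ?t \<le> (\<sigma> + ?t) ^ Suc p - \<sigma> ^ Suc p" "?t ^ Suc p \<le> (\<sigma> + ?t) ^ Suc p - \<sigma> ^ Suc p"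
        using power_Suc_add_ge[OF \<sigma>, of ?t p] by auto
      then have "(taylor_const p * (linear_const \<kappa> p * \<kappa> 2)) * (\<sigma> ^ p * ?t) + (taylor_const p * \<kappa> (2 * p + 2)) * ?t ^ Suc p
          \<le> (taylor_const p * (linear_const \<kappa> p * \<kappa> 2)) * ((\<sigma> + ?t) ^ Suc p - \<sigma> ^ Suc p)
          + (taylor_const p * \<kappa> (2 * p + 2)) * ((\<sigma> + ?t) ^ Suc p - \<sigma> ^ Suc p)"
        using \<kappa> linear_const_nonneg taylor_const_pos[of p]
        by (intro add_mono mult_left_mono mult_nonneg_nonneg) auto
      then show ?thesis by (simp add: algebra_simps)
    qed
    finally show ?case using insert.hyps by (simp add: \<sigma>_def add.commute)
  qed
qed

end

context prob_space
begin

section \<open>Centred quadratic forms\<close>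

definition normalised_family :: "(nat \<Rightarrow> real) \<Rightarrow> (nat \<Rightarrow> 'a \<Rightarrow> real) \<Rightarrow> nat set \<Rightarrow> bool" where
  "normalised_family \<kappa> \<xi> S \<longleftrightarrow> centred_family \<kappa> \<xi> S \<and> (\<forall>j\<in>S. expectation (\<lambda>\<omega>. (\<xi> j \<omega>)\<^sup>2) = 1)"

definition centred_form :: "(nat \<Rightarrow> nat \<Rightarrow> real) \<Rightarrow> (nat \<Rightarrow> 'a \<Rightarrow> real) \<Rightarrow> nat set \<Rightarrow> 'a \<Rightarrow> real" where
  "centred_form A \<xi> S \<omega> = (\<Sum>i\<in>S. \<Sum>j\<in>S. A i j * \<xi> i \<omega> * \<xi> j \<omega>) - (\<Sum>i\<in>S. A i i)"

text \<open>The martingale difference of the centred form when index k is added; the factor 2 merges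
  the row and column contributions of a symmetric A.\<close>

definition form_increment :: "(nat \<Rightarrow> nat \<Rightarrow> real) \<Rightarrow> (nat \<Rightarrow> 'a \<Rightarrow> real) \<Rightarrow> nat set \<Rightarrow> nat \<Rightarrow> 'a \<Rightarrow> real" where
  "form_increment A \<xi> S k \<omega> =
     2 * ((\<Sum>j\<in>S. A k j * \<xi> j \<omega>) * \<xi> k \<omega>) + A k k * ((\<xi> k \<omega>)\<^sup>2 - 1)"

lemma normalised_familyD:
  assumes "normalised_family \<kappa> \<xi> S"
  shows "finite S" "indep_vars (\<lambda>_. borel) \<xi> S" "\<And>p. \<kappa> p \<ge> 0" "\<And>j. j \<in> S \<Longrightarrow> all_moments M (\<xi> j)"
    "\<And>j. j \<in> S \<Longrightarrow> expectation (\<xi> j) = 0" "\<And>j p. j \<in> S \<Longrightarrow> expectation (\<lambda>\<omega>. \<bar>\<xi> j \<omega>\<bar> ^ p) \<le> \<kappa> p"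
    "\<And>j. j \<in> S \<Longrightarrow> expectation (\<lambda>\<omega>. (\<xi> j \<omega>)\<^sup>2) = 1" "centred_family \<kappa> \<xi> S"
  using assms unfolding normalised_family_def centred_family_def by blast+

lemma normalised_family_mono: "normalised_family \<kappa> \<xi> T \<Longrightarrow> S \<subseteq> T \<Longrightarrow> normalised_family \<kappa> \<xi> S"
  unfolding normalised_family_def using centred_family_mono by blast

lemma all_moments_centred_form:
  assumes "\<And>j. j \<in> S \<Longrightarrow> all_moments M (\<xi> j)"
  shows "all_moments M (centred_form A \<xi> S)"
  unfolding centred_form_def[abs_def] using assms by (intro all_moments_intros) auto

lemma all_moments_form_increment:
  assumes "\<And>j. j \<in> insert k S \<Longrightarrow> all_moments M (\<xi> j)"
  shows "all_moments M (form_increment A \<xi> S k)"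
  unfolding form_increment_def[abs_def] using assms by (intro all_moments_intros) auto

lemma centred_form_insert:
  assumes "finite S" "k \<notin> S" "symm_mat A"
  shows "centred_form A \<xi> (insert k S) \<omega> = centred_form A \<xi> S \<omega> + form_increment A \<xi> S k \<omega>"
proof -
  have "(\<Sum>i\<in>S. A i k * \<xi> i \<omega> * \<xi> k \<omega>) = (\<Sum>j\<in>S. A k j * \<xi> j \<omega>) * \<xi> k \<omega>"
    using assms(3) unfolding symm_mat_def sum_distrib_right by (intro sum.cong refl) simp
  moreover have "(\<Sum>j\<in>S. A k j * \<xi> k \<omega> * \<xi> j \<omega>) = (\<Sum>j\<in>S. A k j * \<xi> j \<omega>) * \<xi> k \<omega>"
    unfolding sum_distrib_right by (intro sum.cong refl) simp
  ultimately show ?thesis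
    using assms(1,2) by (simp add: centred_form_def form_increment_def sum.distrib
        power2_eq_square algebra_simps)
qed

text \<open>The form on S is independent of \<xi> k; the off-diagonal part of the increment dies by
  mean zero and the diagonal part by unit variance.\<close>

lemma expectation_form_increment:
  assumes fam: "normalised_family \<kappa> \<xi> (insert k S)" and k: "k \<notin> S"
  shows "expectation (\<lambda>\<omega>. centred_form A \<xi> S \<omega> ^ q * form_increment A \<xi> S k \<omega>) = 0"
proof -
  note F = normalised_familyD[OF fam]
  define Q where "Q = centred_form A \<xi> S"
  define L where "L \<omega> = (\<Sum>j\<in>S. A k j * \<xi> j \<omega>)" for \<omega>
  have amQ: "all_moments M Q" unfolding Q_def using F(4) by (intro all_moments_centred_form) auto
  have amL: "all_moments M L" unfolding L_def[abs_def] using F(4) by (intro all_moments_intros) auto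
  have amk: "all_moments M (\<xi> k)" using F(4) by simp
  have QF: "Q \<omega> = (\<Sum>i\<in>S. \<Sum>j\<in>S. A i j * (\<lambda>j\<in>S. \<xi> j \<omega>) i * (\<lambda>j\<in>S. \<xi> j \<omega>) j) - (\<Sum>i\<in>S. A i i)" for \<omega>
    unfolding Q_def centred_form_def by (intro arg_cong2[where f = "(-)"] sum.cong) auto
  have LF: "L \<omega> = (\<Sum>j\<in>S. A k j * (\<lambda>j\<in>S. \<xi> j \<omega>) j)" for \<omega>
    unfolding L_def by (intro sum.cong) auto
  let ?QF = "\<lambda>x. (\<Sum>i\<in>S. \<Sum>j\<in>S. A i j * x i * x j) - (\<Sum>i\<in>S. A i i)"
  have 1: "expectation (\<lambda>\<omega>. (Q \<omega> ^ q * L \<omega>) * \<xi> k \<omega>) = expectation (\<lambda>\<omega>. Q \<omega> ^ q * L \<omega>) * expectation (\<lambda>\<omega>. \<xi> k \<omega>)"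
    unfolding QF LF
    by (rule expectation_mult_indep[OF F(2) k, where F = "\<lambda>x. ?QF x ^ q * (\<Sum>j\<in>S. A k j * x j)" and g = "\<lambda>y. y"])
      (use all_moments_integrable[OF all_moments_mult[OF all_moments_power[OF amQ] amL]]
          all_moments_integrable[OF amk] in \<open>auto simp: QF LF\<close>)
  have 2: "expectation (\<lambda>\<omega>. Q \<omega> ^ q * ((\<xi> k \<omega>)\<^sup>2 - 1)) = expectation (\<lambda>\<omega>. Q \<omega> ^ q) * expectation (\<lambda>\<omega>. (\<xi> k \<omega>)\<^sup>2 - 1)"
    unfolding QF
    by (rule expectation_mult_indep[OF F(2) k, where F = "\<lambda>x. ?QF x ^ q" and g = "\<lambda>y. y\<^sup>2 - 1"])
      (use all_moments_integrable[OF all_moments_power[OF amQ]]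
          all_moments_integrable[OF all_moments_power[OF amk, of 2]] in \<open>auto simp: QF\<close>)
  have i: "integrable M (\<lambda>\<omega>. (Q \<omega> ^ q * L \<omega>) * \<xi> k \<omega>)" "integrable M (\<lambda>\<omega>. Q \<omega> ^ q * ((\<xi> k \<omega>)\<^sup>2 - 1))"
    "integrable M (\<lambda>\<omega>. (\<xi> k \<omega>)\<^sup>2)"
    by (intro all_moments_integrable all_moments_intros amQ amL amk)+
  have "expectation (\<lambda>\<omega>. Q \<omega> ^ q * form_increment A \<xi> S k \<omega>) =
      expectation (\<lambda>\<omega>. 2 * ((Q \<omega> ^ q * L \<omega>) * \<xi> k \<omega>) + A k k * (Q \<omega> ^ q * ((\<xi> k \<omega>)\<^sup>2 - 1)))"
    by (intro Bochner_Integration.integral_cong refl) (simp add: form_increment_def L_def algebra_simps)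
  also have "\<dots> = 0"
    using i F(5)[of k] F(7)[of k] by (simp add: 1 2 prob_space)
  finally show ?thesis by (simp add: Q_def)
qed

lemma expectation_centred_form:
  assumes "normalised_family \<kappa> \<xi> S" "symm_mat A"
  shows "expectation (centred_form A \<xi> S) = 0"
proof -
  have "finite S" using assms normalised_familyD by blast
  then show ?thesis using assms(1)
  proof (induction S)
    case empty
    then show ?case by (simp add: centred_form_def)
  next
    case (insert k S)
    have fam: "normalised_family \<kappa> \<xi> S" using normalised_family_mono insert.prems by blast
    have i: "integrable M (centred_form A \<xi> S)" "integrable M (form_increment A \<xi> S k)"
      using normalised_familyD(4)[OF insert.prems]
      by (auto intro!: all_moments_integrable all_moments_centred_form all_moments_form_increment)
    show ?case
      using i insert.IH[OF fam] expectation_form_increment[OF insert.prems insert.hyps(2), of A 0]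
      by (simp add: centred_form_insert[OF insert.hyps assms(2), abs_def])
  qed
qed

end

text \<open>The outer 4 ^ q comes from splitting the increment into its two parts, the inner ones
  from the factor 2 of the off-diagonal part and from splitting (\<xi> k)^2 - 1.\<close>

definition increment_const :: "(nat \<Rightarrow> real) \<Rightarrow> nat \<Rightarrow> real" where
  "increment_const \<kappa> q = 4 ^ q * (4 ^ q * (\<kappa> (2 * q) * linear_const \<kappa> q) + 4 ^ q * (\<kappa> (4 * q) + 1))"

text \<open>The solution K of K = K / 2 + T * ((2 * T) ^ p * c + c), with T the Taylor constant and
  c the increment constant; the K / 2 is what the weighted Young inequality returns.\<close>

definition quadratic_const :: "(nat \<Rightarrow> real) \<Rightarrow> nat \<Rightarrow> real" where
  "quadratic_const \<kappa> p =
     2 * taylor_const p * ((2 * taylor_const p) ^ p * increment_const \<kappa> (Suc p) + increment_const \<kappa> (Suc p))"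

lemma increment_const_nonneg: "(\<And>p. \<kappa> p \<ge> 0) \<Longrightarrow> increment_const \<kappa> q \<ge> 0"
  by (simp add: increment_const_def linear_const_nonneg)

lemma quadratic_const_nonneg: "(\<And>p. \<kappa> p \<ge> 0) \<Longrightarrow> quadratic_const \<kappa> q \<ge> 0"
  using taylor_const_pos[of q] increment_const_nonneg[of \<kappa> "Suc q"] by (simp add: quadratic_const_def)

context prob_space
begin

text \<open>For symmetric A the base of the power is the amount by which the sum of squared entries
  grows when k joins S, which is what the peeling induction needs.\<close>

lemma form_increment_moment:
  assumes fam: "normalised_family \<kappa> \<xi> (insert k S)" and k: "k \<notin> S" and q: "q > 0"
  shows "expectation (\<lambda>\<omega>. form_increment A \<xi> S k \<omega> ^ (2 * q))
    \<le> increment_const \<kappa> q * (2 * (\<Sum>j\<in>S. (A k j)\<^sup>2) + (A k k)\<^sup>2) ^ q"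
proof -
  note F = normalised_familyD[OF fam]
  define L where "L \<omega> = (\<Sum>j\<in>S. A k j * \<xi> j \<omega>)" for \<omega>
  define l where "l = (\<Sum>j\<in>S. (A k j)\<^sup>2)"
  have l: "l \<ge> 0" by (simp add: l_def sum_nonneg)
  have amL: "all_moments M L" unfolding L_def[abs_def] using F(4) by (intro all_moments_intros) auto
  have amk: "all_moments M (\<xi> k)" using F(4) by simp
  have LF: "L \<omega> = (\<Sum>j\<in>S. A k j * (\<lambda>j\<in>S. \<xi> j \<omega>) j)" for \<omega>
    unfolding L_def by (intro sum.cong) auto
  have i: "integrable M (\<lambda>\<omega>. L \<omega> ^ (2 * q) * \<xi> k \<omega> ^ (2 * q))" "integrable M (\<lambda>\<omega>. ((\<xi> k \<omega>)\<^sup>2 - 1) ^ (2 * q))"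
    "integrable M (\<lambda>\<omega>. L \<omega> ^ (2 * q))" "integrable M (\<lambda>\<omega>. \<xi> k \<omega> ^ (2 * q))" "integrable M (\<lambda>\<omega>. \<xi> k \<omega> ^ (4 * q))"
    by (intro all_moments_integrable all_moments_intros amL amk)+
  have pw: "(x + y) ^ (2 * q) \<le> 4 ^ q * (x ^ (2 * q) + y ^ (2 * q))" for x y :: real
    using power_add_le[of x y "2 * q"] by (simp add: power_even_abs power_mult)
  have mk: "expectation (\<lambda>\<omega>. \<xi> k \<omega> ^ (2 * r)) \<le> \<kappa> (2 * r)" for r
    using F(6)[of k "2 * r"] by (simp add: power_even_abs)
  have "expectation (\<lambda>\<omega>. L \<omega> ^ (2 * q) * \<xi> k \<omega> ^ (2 * q)) =
      expectation (\<lambda>\<omega>. L \<omega> ^ (2 * q)) * expectation (\<lambda>\<omega>. \<xi> k \<omega> ^ (2 * q))"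
    unfolding LF
    by (rule expectation_mult_indep[OF F(2) k, where F = "\<lambda>x. (\<Sum>j\<in>S. A k j * x j) ^ (2 * q)" and g = "\<lambda>y. y ^ (2 * q)"])
      (use i(3,4) in \<open>auto simp: LF\<close>)
  also have "\<dots> \<le> (linear_const \<kappa> q * l ^ q) * \<kappa> (2 * q)"
  proof (intro mult_mono mk)
    show "expectation (\<lambda>\<omega>. L \<omega> ^ (2 * q)) \<le> linear_const \<kappa> q * l ^ q"
      unfolding L_def l_def
      by (rule linear_moment) (use normalised_familyD(8)[OF normalised_family_mono[OF fam]] in blast)
    show "0 \<le> linear_const \<kappa> q * l ^ q" using l F(3) by (simp add: linear_const_nonneg)
  qed (simp add: power_mult)
  finally have 1: "expectation (\<lambda>\<omega>. L \<omega> ^ (2 * q) * \<xi> k \<omega> ^ (2 * q)) \<le> (linear_const \<kappa> q * l ^ q) * \<kappa> (2 * q)" .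
  have "expectation (\<lambda>\<omega>. ((\<xi> k \<omega>)\<^sup>2 - 1) ^ (2 * q)) \<le> expectation (\<lambda>\<omega>. 4 ^ q * (\<xi> k \<omega> ^ (4 * q) + 1))"
  proof (rule integral_mono)
    show "((\<xi> k \<omega>)\<^sup>2 - 1) ^ (2 * q) \<le> 4 ^ q * (\<xi> k \<omega> ^ (4 * q) + 1)" for \<omega>
      using pw[of "(\<xi> k \<omega>)\<^sup>2" "-1"] by (simp add: power_mult[symmetric])
  qed (use i in auto)
  also have "\<dots> \<le> 4 ^ q * (\<kappa> (4 * q) + 1)"
    using mk[of "2 * q"] i by (simp add: prob_space)
  finally have 2: "expectation (\<lambda>\<omega>. ((\<xi> k \<omega>)\<^sup>2 - 1) ^ (2 * q)) \<le> 4 ^ q * (\<kappa> (4 * q) + 1)" .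
  let ?t = "2 * l + (A k k)\<^sup>2"
  have t: "l ^ q \<le> ?t ^ q" "((A k k)\<^sup>2) ^ q \<le> ?t ^ q" using l by (auto intro!: power_mono)
  have "expectation (\<lambda>\<omega>. form_increment A \<xi> S k \<omega> ^ (2 * q)) \<le>
     expectation (\<lambda>\<omega>. 4 ^ q * (4 ^ q * (L \<omega> ^ (2 * q) * \<xi> k \<omega> ^ (2 * q)) + ((A k k)\<^sup>2) ^ q * ((\<xi> k \<omega>)\<^sup>2 - 1) ^ (2 * q)))"
  proof (rule integral_mono)
    show "integrable M (\<lambda>\<omega>. form_increment A \<xi> S k \<omega> ^ (2 * q))"
      using F(4) by (intro all_moments_integrable all_moments_power all_moments_form_increment)
    show "form_increment A \<xi> S k \<omega> ^ (2 * q) \<le>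
       4 ^ q * (4 ^ q * (L \<omega> ^ (2 * q) * \<xi> k \<omega> ^ (2 * q)) + ((A k k)\<^sup>2) ^ q * ((\<xi> k \<omega>)\<^sup>2 - 1) ^ (2 * q))" for \<omega>
      using pw[of "2 * (L \<omega> * \<xi> k \<omega>)" "A k k * ((\<xi> k \<omega>)\<^sup>2 - 1)"]
      by (simp add: form_increment_def L_def[symmetric] power_mult_distrib) (simp add: power_mult)
  qed (intro i Bochner_Integration.integrable_add integrable_mult_right)
  also have "\<dots> = 4 ^ q * (4 ^ q * expectation (\<lambda>\<omega>. L \<omega> ^ (2 * q) * \<xi> k \<omega> ^ (2 * q)) + ((A k k)\<^sup>2) ^ q * expectation (\<lambda>\<omega>. ((\<xi> k \<omega>)\<^sup>2 - 1) ^ (2 * q)))"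
    using i by simp
  also have "\<dots> \<le> 4 ^ q * (4 ^ q * ((linear_const \<kappa> q * l ^ q) * \<kappa> (2 * q)) + ((A k k)\<^sup>2) ^ q * (4 ^ q * (\<kappa> (4 * q) + 1)))"
    using 1 2 by (intro mult_left_mono add_mono) auto
  also have "\<dots> \<le> 4 ^ q * (4 ^ q * ((linear_const \<kappa> q * ?t ^ q) * \<kappa> (2 * q)) + ?t ^ q * (4 ^ q * (\<kappa> (4 * q) + 1)))"
    using t F(3) linear_const_nonneg[of \<kappa>]
    by (intro mult_left_mono add_mono mult_right_mono mult_nonneg_nonneg add_nonneg_nonneg) auto
  also have "\<dots> = increment_const \<kappa> q * ?t ^ q"
    by (simp add: increment_const_def algebra_simps)
  finally show ?thesis by (simp add: l_def)
qed

text \<open>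
  Peeling off one index at a time, the increment has conditional mean zero, so that only the
  terms of second and higher order in it survive. Hoelder's inequality is avoided by a weighted
  Young inequality; starting from \<open>1\<close> instead of \<open>0\<close> keeps the weights positive.
\<close>

lemma quadratic_moment:
  assumes "normalised_family \<kappa> \<xi> S" and A: "symm_mat A"
  shows "expectation (\<lambda>\<omega>. centred_form A \<xi> S \<omega> ^ (2 * p + 2))
    \<le> quadratic_const \<kappa> p * (1 + (\<Sum>i\<in>S. \<Sum>j\<in>S. (A i j)\<^sup>2)) ^ Suc p"
proof -
  have "finite S" using assms normalised_familyD by blast
  then show ?thesis using assms(1)
  proof (induction S)
    case empty
    then show ?case using normalised_familyD(3)[OF empty] by (simp add: centred_form_def quadratic_const_nonneg)
  next
    case (insert k S)
    note F = normalised_familyD[OF insert.prems]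
    have fam: "normalised_family \<kappa> \<xi> S" using normalised_family_mono insert.prems by blast
    define Q where "Q = centred_form A \<xi> S"
    define D where "D = form_increment A \<xi> S k"
    define \<theta> where "\<theta> = 1 + (\<Sum>i\<in>S. \<Sum>j\<in>S. (A i j)\<^sup>2)"
    define l where "l = (\<Sum>j\<in>S. (A k j)\<^sup>2)"
    define t where "t = 2 * l + (A k k)\<^sup>2"
    let ?K = "quadratic_const \<kappa> p" and ?c = "increment_const \<kappa> (Suc p)" and ?T = "taylor_const p"
    have \<theta>: "\<theta> \<ge> 1" by (simp add: \<theta>_def sum_nonneg)
    have l: "l \<ge> 0" by (simp add: l_def sum_nonneg)
    have t: "t \<ge> 0" using l by (simp add: t_def)
    have T: "?T > 0" by (rule taylor_const_pos)
    have c: "?c \<ge> 0" using F(3) by (rule increment_const_nonneg)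
    have amQ: "all_moments M Q" unfolding Q_def using F(4) by (intro all_moments_centred_form) auto
    have amD: "all_moments M D" unfolding D_def using F(4) by (intro all_moments_form_increment) auto
    have ints: "integrable M (\<lambda>\<omega>. Q \<omega> ^ q * D \<omega> ^ r)" "integrable M (\<lambda>\<omega>. Q \<omega> ^ q)" "integrable M (\<lambda>\<omega>. D \<omega> ^ r)"
      "integrable M (\<lambda>\<omega>. (Q \<omega> + D \<omega>) ^ q)" for q r
      by (intro all_moments_integrable all_moments_intros amQ amD)+
    have EQ: "expectation (\<lambda>\<omega>. Q \<omega> ^ (2 * p + 2)) \<le> ?K * \<theta> ^ Suc p"
      using insert.IH[OF fam] by (simp add: Q_def \<theta>_def)
    have ED: "expectation (\<lambda>\<omega>. D \<omega> ^ (2 * p + 2)) \<le> ?c * t ^ Suc p"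
      using form_increment_moment[OF insert.prems insert.hyps(2), of "Suc p" A]
      by (simp add: D_def t_def l_def)
    have EQD: "expectation (\<lambda>\<omega>. Q \<omega> ^ (2 * p) * D \<omega> ^ 2) \<le>
        (1 / (2 * ?T) * ?K + (2 * ?T) ^ p * ?c) * (\<theta> ^ p * t)"
    \<comment> \<open>For t = 0 the Young weight would vanish; then row k of A is zero on the index
      set and the increment is identically 0.\<close>
    proof (cases "t = 0")
      case True
      then have "l = 0" "A k k = 0" using l by (auto simp: t_def add_nonneg_eq_0_iff)
      then have "A k j = 0" if "j \<in> insert k S" for j
        using that insert.hyps(1) by (auto simp: l_def sum_nonneg_eq_0_iff)
      then have "D \<omega> = 0" for \<omega> by (simp add: D_def form_increment_def)
      then show ?thesis using True by simp
    next
      case False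
      then have t0: "t > 0" using t by simp
      \<comment> \<open>The ratio t / \<theta> turns \<theta> ^ Suc p into \<theta> ^ p * t, and 1 /
        (2 * ?T) makes the returned share of the constant one half after multiplication by
        \<open>?T\<close>.\<close>
      define w where "w = 1 / (2 * ?T) * (t / \<theta>)"
      have w: "w > 0" using T t0 \<theta> by (simp add: w_def)
      have "expectation (\<lambda>\<omega>. Q \<omega> ^ (2 * p) * D \<omega> ^ 2) \<le>
          expectation (\<lambda>\<omega>. w * Q \<omega> ^ (2 * p + 2) + (1 / w) ^ p * D \<omega> ^ (2 * p + 2))"
      proof (rule integral_mono)
        show "Q \<omega> ^ (2 * p) * D \<omega> ^ 2 \<le> w * Q \<omega> ^ (2 * p + 2) + (1 / w) ^ p * D \<omega> ^ (2 * p + 2)" for \<omega>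
        proof -
          have e: "(x\<^sup>2) ^ p = x ^ (2 * p)" "(x\<^sup>2) ^ Suc p = x ^ (2 * p + 2)" for x :: real
            unfolding power_mult[symmetric] by simp_all
          show ?thesis
            using weighted_young[of "(Q \<omega>)\<^sup>2" "(D \<omega>)\<^sup>2" w p] w unfolding e by simp
        qed
      qed (intro ints Bochner_Integration.integrable_add integrable_mult_right)+
      also have "\<dots> = w * expectation (\<lambda>\<omega>. Q \<omega> ^ (2 * p + 2)) + (1 / w) ^ p * expectation (\<lambda>\<omega>. D \<omega> ^ (2 * p + 2))"
        using ints(2)[of "2 * p + 2"] ints(3)[of "2 * p + 2"] by simp
      also have "\<dots> \<le> w * (?K * \<theta> ^ Suc p) + (1 / w) ^ p * (?c * t ^ Suc p)"
        using EQ ED w by (intro add_mono mult_left_mono) auto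
      also have "w * (?K * \<theta> ^ Suc p) = 1 / (2 * ?T) * ?K * (\<theta> ^ p * t)"
        using \<theta> by (simp add: w_def)
      also have "(1 / w) ^ p * (?c * t ^ Suc p) = (2 * ?T) ^ p * ?c * (\<theta> ^ p * t)"
      proof -
        have "(1 / w) ^ p * t ^ p = (1 / w * t) ^ p" by (simp only: power_mult_distrib)
        also have "1 / w * t = 2 * ?T * \<theta>" using t0 T \<theta> by (simp add: w_def)
        finally show ?thesis by (simp add: power_mult_distrib algebra_simps)
      qed
      finally show ?thesis by (simp add: algebra_simps)
    qed
    have "expectation (\<lambda>\<omega>. centred_form A \<xi> (insert k S) \<omega> ^ (2 * p + 2)) = expectation (\<lambda>\<omega>. (Q \<omega> + D \<omega>) ^ (2 * p + 2))"
      by (simp only: centred_form_insert[OF insert.hyps A] Q_def D_def)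
    also have "\<dots> \<le> expectation (\<lambda>\<omega>. Q \<omega> ^ (2 * p + 2) + real (2 * p + 2) * (Q \<omega> ^ (2 * p + 1) * D \<omega> ^ 1)
        + ?T * (1 * (Q \<omega> ^ (2 * p) * D \<omega> ^ 2) + 1 * D \<omega> ^ (2 * p + 2)))"
    proof (rule integral_mono)
      fix \<omega>
      show "(Q \<omega> + D \<omega>) ^ (2 * p + 2) \<le> Q \<omega> ^ (2 * p + 2) + real (2 * p + 2) * (Q \<omega> ^ (2 * p + 1) * D \<omega> ^ 1)
        + ?T * (1 * (Q \<omega> ^ (2 * p) * D \<omega> ^ 2) + 1 * D \<omega> ^ (2 * p + 2))"
        using even_power_add_le[of "Q \<omega>" "D \<omega>" p] by (simp only: power_one_right mult_1)
    qed (intro ints Bochner_Integration.integrable_add integrable_mult_right)+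
    also have "\<dots> = expectation (\<lambda>\<omega>. Q \<omega> ^ (2 * p + 2)) +
        ?T * (expectation (\<lambda>\<omega>. Q \<omega> ^ (2 * p) * D \<omega> ^ 2) + expectation (\<lambda>\<omega>. D \<omega> ^ (2 * p + 2)))"
      unfolding expectation_combination[OF ints(2) ints(1) ints(1) ints(3)]
      using expectation_form_increment[OF insert.prems insert.hyps(2), of A "2 * p + 1"]
      by (simp only: Q_def D_def power_one_right) simp
    also have "\<dots> \<le> ?K * \<theta> ^ Suc p + ?T * ((1 / (2 * ?T) * ?K + (2 * ?T) ^ p * ?c) * (\<theta> ^ p * t) + ?c * t ^ Suc p)"
      using EQ EQD ED T by (intro add_mono mult_left_mono) auto
    also have "\<dots> \<le> ?K * (\<theta> + t) ^ Suc p"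
    proof -
      \<comment> \<open>The coefficients \<open>X\<close> and \<open>?T * ?c\<close> add up to
        \<open>?K\<close>: this is the equation that defines \<open>quadratic_const\<close>.\<close>
      define X where "X = ?T * (1 / (2 * ?T) * ?K + (2 * ?T) ^ p * ?c)"
      define \<Delta> where "\<Delta> = (\<theta> + t) ^ Suc p - \<theta> ^ Suc p"
      have "X = ?K / 2 + ?T * ((2 * ?T) ^ p * ?c)"
        using T by (simp add: X_def algebra_simps)
      then have XK: "X + ?T * ?c = ?K" "X \<ge> 0"
        using T c F(3) quadratic_const_nonneg[of \<kappa> p] by (auto simp: quadratic_const_def algebra_simps)
      have "\<theta> ^ p * t \<le> \<Delta>" "t ^ Suc p \<le> \<Delta>"
        using power_Suc_add_ge[of \<theta> t p] \<theta> t by (auto simp: \<Delta>_def)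
      then have "X * (\<theta> ^ p * t) + (?T * ?c) * t ^ Suc p \<le> X * \<Delta> + (?T * ?c) * \<Delta>"
        using XK c T by (intro add_mono mult_left_mono) auto
      also have "\<dots> = ?K * \<Delta>" by (simp only: XK(1)[symmetric] distrib_right)
      finally have 1: "X * (\<theta> ^ p * t) + (?T * ?c) * t ^ Suc p \<le> ?K * \<Delta>" .
      have 2: "?T * ((1 / (2 * ?T) * ?K + (2 * ?T) ^ p * ?c) * (\<theta> ^ p * t) + ?c * t ^ Suc p) =
          X * (\<theta> ^ p * t) + (?T * ?c) * t ^ Suc p"
        unfolding X_def by (simp only: distrib_left[of ?T "_ * (\<theta> ^ p * t)"] mult.assoc)
      have 3: "?K * \<Delta> = ?K * (\<theta> + t) ^ Suc p - ?K * \<theta> ^ Suc p"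
        by (simp only: \<Delta>_def right_diff_distrib)
      show ?thesis unfolding 2 using 1 unfolding 3 by simp
    qed
    also have "\<theta> + t = 1 + (\<Sum>i\<in>insert k S. \<Sum>j\<in>insert k S. (A i j)\<^sup>2)"
    proof -
      have "(\<Sum>i\<in>S. (A i k)\<^sup>2) = l" using A unfolding l_def symm_mat_def by simp
      then show ?thesis using insert.hyps
        by (simp add: \<theta>_def t_def l_def[symmetric] sum.distrib)
    qed
    finally show ?case .
  qed
qed

end

section \<open>Wigner matrices\<close>

text \<open>One position per independent entry. A point of \<open>fam_space n\<close> is a sample of
  these entries, \<open>pair_of\<close> folds the lower triangle onto them, and all matrix
  quantities become functions of such a point.\<close>

definition pairs :: "nat \<Rightarrow> (nat \<times> nat) set" where
  "pairs n = {(i, j). i \<le> j \<and> j < n}"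

definition pair_of :: "nat \<Rightarrow> nat \<Rightarrow> nat \<times> nat" where
  "pair_of i j = (min i j, max i j)"

definition entry :: "nat \<Rightarrow> (nat \<times> nat \<Rightarrow> real) \<Rightarrow> nat \<Rightarrow> nat \<Rightarrow> real" where
  "entry n f i j = f (pair_of i j) / sqrt (real n)"

definition Bmat :: "nat \<Rightarrow> real \<Rightarrow> (nat \<times> nat \<Rightarrow> real) \<Rightarrow> nat \<Rightarrow> nat \<Rightarrow> real" where
  "Bmat n z f i j = (if i = j then z else 0) - entry n f i j"

abbreviation fam_space :: "nat \<Rightarrow> (nat \<times> nat \<Rightarrow> real) measure" where
  "fam_space n \<equiv> PiM (pairs n) (\<lambda>_. borel)"

lemma pair_of_commute: "pair_of i j = pair_of j i"
  by (simp add: pair_of_def min.commute max.commute)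

lemma pair_of_in_pairs: "i < n \<Longrightarrow> j < n \<Longrightarrow> pair_of i j \<in> pairs n"
  by (auto simp: pair_of_def pairs_def)

lemma pair_of_eq_iff: "pair_of i j = pair_of k l \<longleftrightarrow> (i = k \<and> j = l) \<or> (i = l \<and> j = k)"
  by (auto simp: pair_of_def min_def max_def)

lemma entry_commute: "entry n f i j = entry n f j i"
  by (simp add: entry_def pair_of_commute)

lemma symm_mat_Bmat: "symm_mat (Bmat n z f)"
  by (auto simp: symm_mat_def Bmat_def entry_commute)

lemma Bmat_shift: "Bmat n (z + \<eta>) f = shift \<eta> (Bmat n z f)"
  by (intro ext) (simp add: Bmat_def shift_def)

section \<open>Measurability of resolvents and pivots\<close>

lemma measurable_entry:
  "i < n \<Longrightarrow> j < n \<Longrightarrow> (\<lambda>f. entry n f i j) \<in> borel_measurable (fam_space n)"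
  unfolding entry_def using pair_of_in_pairs by measurable

lemma measurable_Bmat:
  "i < n \<Longrightarrow> j < n \<Longrightarrow> (\<lambda>f. Bmat n z f i j) \<in> borel_measurable (fam_space n)"
  unfolding Bmat_def using measurable_entry[of i n j] by simp

lemma measurable_mv:
  assumes "\<And>i j. (\<lambda>f. A f i j) \<in> borel_measurable Q" "\<And>j. j < n \<Longrightarrow> (\<lambda>f. x f j) \<in> borel_measurable Q"
  shows "(\<lambda>f. mv n (A f) (x f) i) \<in> borel_measurable Q"
  unfolding mv_def using assms by (intro borel_measurable_sum borel_measurable_times) auto

lemma measurable_mm:
  assumes "\<And>i j. (\<lambda>f. A f i j) \<in> borel_measurable Q" "\<And>i j. (\<lambda>f. C f i j) \<in> borel_measurable Q"
  shows "(\<lambda>f. mm n (A f) (C f) i j) \<in> borel_measurable Q"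
  unfolding mm_def using assms by (intro borel_measurable_sum borel_measurable_times) auto

lemma measurable_dot:
  assumes "\<And>j. j < n \<Longrightarrow> (\<lambda>f. x f j) \<in> borel_measurable Q" "\<And>j. j < n \<Longrightarrow> (\<lambda>f. y f j) \<in> borel_measurable Q"
  shows "(\<lambda>f. dot n (x f) (y f)) \<in> borel_measurable Q"
  unfolding dot_def using assms by (intro borel_measurable_sum borel_measurable_times) auto

lemma measurable_form:
  assumes "\<And>i j. (\<lambda>f. A f i j) \<in> borel_measurable Q" "\<And>j. j < n \<Longrightarrow> (\<lambda>f. x f j) \<in> borel_measurable Q"
  shows "(\<lambda>f. form n (A f) (x f)) \<in> borel_measurable Q"
  unfolding form_def by (intro measurable_dot measurable_mv assms)

lemma measurable_tr:
  assumes "\<And>i j. (\<lambda>f. A f i j) \<in> borel_measurable Q"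
  shows "(\<lambda>f. tr n (A f)) \<in> borel_measurable Q"
  unfolding tr_def by (intro borel_measurable_sum assms)

context
  fixes n :: nat and Q :: "'q measure" and B :: "'q \<Rightarrow> nat \<Rightarrow> nat \<Rightarrow> real"
  assumes B: "\<And>i j. i < n \<Longrightarrow> j < n \<Longrightarrow> (\<lambda>f. B f i j) \<in> borel_measurable Q"
begin

lemma measurable_pivot_family:
  assumes "\<And>i j. (\<lambda>f. G f i j) \<in> borel_measurable Q" "k < n"
  shows "(\<lambda>f. pivot n (B f) k (G f)) \<in> borel_measurable Q"
  unfolding pivot_def using B assms
  by (intro borel_measurable_diff measurable_form borel_measurable_uminus) auto

lemma measurable_res_family:
  assumes "set ks \<subseteq> {..<n}"
  shows "(\<lambda>f. res n (B f) ks i j) \<in> borel_measurable Q"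
  using assms
proof (induction ks arbitrary: i j)
  case (Cons k ks)
  then have IH: "(\<lambda>f. res n (B f) ks i j) \<in> borel_measurable Q" for i j by auto
  have k: "k < n" using Cons.prems by auto
  have u: "(\<lambda>f. border_vec n (B f) k (res n (B f) ks) i) \<in> borel_measurable Q" for i
    unfolding border_vec_def
    by (cases "i = k") (auto intro!: measurable_mv borel_measurable_uminus IH B k)
  show ?case
    unfolding res.simps border_def
    by (intro borel_measurable_add borel_measurable_divide borel_measurable_times u IH measurable_pivot_family k)
qed simp

lemma measurable_pivots_pos_family:
  assumes "set ks \<subseteq> {..<n}"
  shows "Measurable.pred Q (\<lambda>f. pivots_pos n (B f) ks)"
  using assms
proof (induction ks)
  case (Cons k ks)
  have "(\<lambda>f. pivot n (B f) k (res n (B f) ks)) \<in> borel_measurable Q"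
    using Cons.prems by (intro measurable_pivot_family measurable_res_family) auto
  then have "Measurable.pred Q (\<lambda>f. pivot n (B f) k (res n (B f) ks) > 0)"
    by simp
  then show ?case using Cons by simp
qed simp

end

lemmas measurable_pivot = measurable_pivot_family[OF measurable_Bmat]
lemmas measurable_res = measurable_res_family[OF measurable_Bmat]
lemmas measurable_pivots_pos = measurable_pivots_pos_family[OF measurable_Bmat]

text \<open>Carries independence of the entries over to a single row, whose positions are an
  injective image of its column indices.\<close>

lemma (in prob_space) indep_vars_comp_inj:
  assumes ind: "indep_vars M' X (f ` S)" and inj: "inj_on f S"
  shows "indep_vars (\<lambda>j. M' (f j)) (\<lambda>j. X (f j)) S"
proof -
  have "indep_sets (\<lambda>j. {X (f j) -` A \<inter> space M |A. A \<in> sets (M' (f j))}) S"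
  proof (rule indep_setsI)
    show "{X (f j) -` A \<inter> space M |A. A \<in> sets (M' (f j))} \<subseteq> events" if "j \<in> S" for j
      using ind that unfolding indep_vars_def2 by (auto intro: measurable_sets)
    fix A J assume J: "J \<noteq> {}" "J \<subseteq> S" "finite J"
      and A: "\<forall>j\<in>J. A j \<in> {X (f j) -` A \<inter> space M |A. A \<in> sets (M' (f j))}"
    let ?g = "inv_into J f"
    have inj': "inj_on f J" using inj J(2) by (rule inj_on_subset)
    have "prob (\<Inter>i\<in>f ` J. A (?g i)) = (\<Prod>i\<in>f ` J. prob (A (?g i)))"
    proof (rule indep_setsD)
      show "indep_sets (\<lambda>i. {X i -` A \<inter> space M |A. A \<in> sets (M' i)}) (f ` S)"
        using ind by (simp add: indep_vars_def2)
      show "\<forall>i\<in>f ` J. A (?g i) \<in> {X i -` A \<inter> space M |A. A \<in> sets (M' i)}"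
        using A by (simp add: inj')
    qed (use J in auto)
    then show "prob (\<Inter>j\<in>J. A j) = (\<Prod>j\<in>J. prob (A j))"
      using inj' by (simp add: prod.reindex)
  qed
  then show ?thesis using ind by (simp add: indep_vars_def2)
qed

text \<open>The moment bounds \<kappa> are a parameter, so one \<kappa> can serve all n and the
  constants built from it are uniform in n.\<close>

locale wigner = prob_space M for M :: "'a measure" +
  fixes n :: nat and X :: "nat \<times> nat \<Rightarrow> 'a \<Rightarrow> real" and \<kappa> :: "nat \<Rightarrow> real"
  assumes n_pos: "n > 0"
    and indep_X: "indep_vars (\<lambda>_. borel) X (pairs n)"
    and moments_X: "\<And>p. p \<in> pairs n \<Longrightarrow> all_moments M (X p)"
    and mean_X: "\<And>p. p \<in> pairs n \<Longrightarrow> expectation (X p) = 0"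
    and second_X: "\<And>i j. i < j \<Longrightarrow> j < n \<Longrightarrow> expectation (\<lambda>\<omega>. (X (i, j) \<omega>)\<^sup>2) = 1"
    and bound_X: "\<And>p r. p \<in> pairs n \<Longrightarrow> expectation (\<lambda>\<omega>. \<bar>X p \<omega>\<bar> ^ r) \<le> \<kappa> r"
    and \<kappa>_nonneg: "\<And>r. \<kappa> r \<ge> 0"
begin

definition fam :: "'a \<Rightarrow> nat \<times> nat \<Rightarrow> real" where
  "fam \<omega> = (\<lambda>p\<in>pairs n. X p \<omega>)"

definition row_pairs :: "nat \<Rightarrow> (nat \<times> nat) set" where
  "row_pairs k = pair_of k ` {..<n}"

text \<open>Row and column k are read from a second sample \<omega>', everything else from \<omega>.
  Integrating over \<omega>' with \<omega> fixed plays the part of the conditional expectation given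
  the minor without k.\<close>

definition mix :: "nat \<Rightarrow> 'a \<Rightarrow> 'a \<Rightarrow> nat \<times> nat \<Rightarrow> real" where
  "mix k \<omega>' \<omega> = (\<lambda>p\<in>pairs n. if p \<in> row_pairs k then X p \<omega>' else X p \<omega>)"

definition row :: "nat \<Rightarrow> nat \<Rightarrow> 'a \<Rightarrow> real" where
  "row k j = X (pair_of k j)"

lemma X_measurable: "p \<in> pairs n \<Longrightarrow> X p \<in> borel_measurable M"
  using moments_X by (simp add: all_moments_def)

lemma fam_measurable: "fam \<in> measurable M (fam_space n)"
  unfolding fam_def[abs_def] by (intro measurable_restrict X_measurable)

lemma row_pairs_subset: "k < n \<Longrightarrow> row_pairs k \<subseteq> pairs n"
  by (auto simp: row_pairs_def pair_of_in_pairs)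

text \<open>Row k and the other entries are independent, so their joint law is a product and Tonelli
  applies. With nonnegative integrals no integrability has to be known in advance, and the inner
  integral can be bounded for each single \<omega>.\<close>

lemma nn_integral_decouple:
  assumes F: "F \<in> borel_measurable (fam_space n)" and k: "k < n"
  shows "(\<integral>\<^sup>+\<omega>. F (fam \<omega>) \<partial>M) = (\<integral>\<^sup>+\<omega>. (\<integral>\<^sup>+\<omega>'. F (mix k \<omega>' \<omega>) \<partial>M) \<partial>M)"
proof -
  let ?R = "row_pairs k" and ?Q = "pairs n - row_pairs k"
  let ?PR = "PiM ?R (\<lambda>_. borel :: real measure)" and ?PQ = "PiM ?Q (\<lambda>_. borel :: real measure)"
  let ?x = "\<lambda>\<omega>. restrict (\<lambda>p. X p \<omega>) ?R" and ?y = "\<lambda>\<omega>. restrict (\<lambda>p. X p \<omega>) ?Q"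
  note R = row_pairs_subset[OF k]
  have RQ: "?R \<union> ?Q = pairs n" using R by auto
  have ind: "indep_var ?PR ?x ?PQ ?y"
    using R by (intro indep_var_restrict[OF indep_X]) auto
  then have mx: "?x \<in> measurable M ?PR" and my: "?y \<in> measurable M ?PQ"
    and eq: "distr M ?PR ?x \<Otimes>\<^sub>M distr M ?PQ ?y = distr M (?PR \<Otimes>\<^sub>M ?PQ) (\<lambda>\<omega>. (?x \<omega>, ?y \<omega>))"
    by (auto simp: indep_var_distribution_eq)
  have mm: "merge ?R ?Q \<in> measurable (?PR \<Otimes>\<^sub>M ?PQ) (fam_space n)"
    using measurable_merge[of ?R ?Q "\<lambda>_. borel"] by (simp only: RQ)
  have Fm: "(\<lambda>z. F (merge ?R ?Q z)) \<in> borel_measurable (?PR \<Otimes>\<^sub>M ?PQ)"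
    using measurable_compose[OF mm F] .
  interpret px: prob_space "distr M ?PR ?x" by (rule prob_space_distr[OF mx])
  interpret py: prob_space "distr M ?PQ ?y" by (rule prob_space_distr[OF my])
  interpret pp: pair_sigma_finite "distr M ?PR ?x" "distr M ?PQ ?y" ..
  have 1: "merge ?R ?Q (?x \<omega>', ?y \<omega>) = mix k \<omega>' \<omega>" for \<omega>' \<omega>
    using R by (auto simp: fun_eq_iff mix_def merge_def)
  have 2: "mix k \<omega> \<omega> = fam \<omega>" for \<omega> by (auto simp: mix_def fam_def fun_eq_iff)
  have "(\<integral>\<^sup>+\<omega>. F (fam \<omega>) \<partial>M) = (\<integral>\<^sup>+z. F (merge ?R ?Q z) \<partial>distr M (?PR \<Otimes>\<^sub>M ?PQ) (\<lambda>\<omega>. (?x \<omega>, ?y \<omega>)))"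
    using mx my Fm by (subst nn_integral_distr) (simp_all only: 1 2 measurable_Pair measurable_distr_eq1)
  also have "\<dots> = (\<integral>\<^sup>+z. F (merge ?R ?Q z) \<partial>(distr M ?PR ?x \<Otimes>\<^sub>M distr M ?PQ ?y))"
    by (simp only: eq)
  also have "\<dots> = (\<integral>\<^sup>+b. (\<integral>\<^sup>+a. F (merge ?R ?Q (a, b)) \<partial>distr M ?PR ?x) \<partial>distr M ?PQ ?y)"
    using Fm by (subst pp.nn_integral_snd[symmetric]) simp_all
  also have "\<dots> = (\<integral>\<^sup>+\<omega>. (\<integral>\<^sup>+a. F (merge ?R ?Q (a, ?y \<omega>)) \<partial>distr M ?PR ?x) \<partial>M)"
  proof (rule nn_integral_distr[OF my])
    show "(\<lambda>b. \<integral>\<^sup>+a. F (merge ?R ?Q (a, b)) \<partial>distr M ?PR ?x) \<in> borel_measurable (distr M ?PQ ?y)"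
      by (rule px.borel_measurable_nn_integral) (use Fm in simp)
  qed
  also have "\<dots> = (\<integral>\<^sup>+\<omega>. (\<integral>\<^sup>+\<omega>'. F (mix k \<omega>' \<omega>) \<partial>M) \<partial>M)"
  proof (rule nn_integral_cong)
    fix \<omega> assume \<omega>: "\<omega> \<in> space M"
    have "?y \<omega> \<in> space ?PQ" using measurable_space[OF my \<omega>] .
    then have "(\<lambda>a. F (merge ?R ?Q (a, ?y \<omega>))) \<in> borel_measurable ?PR"
      by (rule measurable_Pair2'[THEN measurable_compose[OF _ Fm]])
    then show "(\<integral>\<^sup>+a. F (merge ?R ?Q (a, ?y \<omega>)) \<partial>distr M ?PR ?x) = (\<integral>\<^sup>+\<omega>'. F (mix k \<omega>' \<omega>) \<partial>M)"
      using mx by (subst nn_integral_distr) (simp_all only: 1 measurable_distr_eq1)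
  qed
  finally show ?thesis .
qed

lemma normalised_row:
  assumes "k < n"
  shows "normalised_family \<kappa> (row k) ({..<n} - {k})"
proof -
  let ?S = "{..<n} - {k}"
  have inj: "inj_on (pair_of k) ?S" by (auto simp: inj_on_def pair_of_eq_iff)
  have sub: "pair_of k ` ?S \<subseteq> pairs n" using assms pair_of_in_pairs by auto
  have "indep_vars (\<lambda>_. borel) X (pair_of k ` ?S)" by (rule indep_vars_subset[OF indep_X sub])
  then have ind: "indep_vars (\<lambda>_. borel) (row k) ?S"
    unfolding row_def by (rule indep_vars_comp_inj[OF _ inj])
  have sec: "expectation (\<lambda>\<omega>. (row k j \<omega>)\<^sup>2) = 1" if "j \<in> ?S" for j
    using that assms second_X[of "min k j" "max k j"] by (auto simp: row_def pair_of_def)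
  have "pair_of k j \<in> pairs n" if "j \<in> ?S" for j using that sub by auto
  then have "\<forall>j\<in>?S. all_moments M (row k j) \<and> expectation (row k j) = 0 \<and>
      (\<forall>p. expectation (\<lambda>\<omega>. \<bar>row k j \<omega>\<bar> ^ p) \<le> \<kappa> p)"
    unfolding row_def using moments_X mean_X bound_X by auto
  then show ?thesis
    unfolding normalised_family_def centred_family_def using ind sec \<kappa>_nonneg by simp
qed

lemma all_moments_row: "k < n \<Longrightarrow> j < n \<Longrightarrow> all_moments M (row k j)"
  unfolding row_def by (intro moments_X pair_of_in_pairs)

lemma entry_mix_row: "k < n \<Longrightarrow> j < n \<Longrightarrow> entry n (mix k \<omega>' \<omega>) j k = row k j \<omega>' / sqrt (real n)"
  unfolding entry_def mix_def row_def using pair_of_in_pairs[of j n k]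
  by (auto simp: row_pairs_def pair_of_commute)

lemma entry_mix_block:
  assumes "i < n" "j < n" "i \<noteq> k" "j \<noteq> k"
  shows "entry n (mix k \<omega>' \<omega>) i j = entry n (fam \<omega>) i j"
proof -
  have "pair_of i j \<notin> row_pairs k" using assms by (auto simp: row_pairs_def pair_of_eq_iff)
  then show ?thesis by (simp add: entry_def mix_def fam_def)
qed

lemma form_row:
  assumes k: "k < n" and A: "\<And>j. A k j = 0" "\<And>j. A j k = 0"
  shows "form n A (\<lambda>j. - Bmat n z (mix k \<omega>' \<omega>) j k) =
    (centred_form A (row k) ({..<n} - {k}) \<omega>' + tr n A) / real n"
proof -
  let ?S = "{..<n} - {k}"
  have "form n A (\<lambda>j. - Bmat n z (mix k \<omega>' \<omega>) j k) =
      (\<Sum>i<n. \<Sum>j<n. A i j * (- Bmat n z (mix k \<omega>' \<omega>) i k) * (- Bmat n z (mix k \<omega>' \<omega>) j k))"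
    by (simp add: form_def dot_def mv_def sum_distrib_left mult_ac)
  also have "\<dots> = (\<Sum>i\<in>?S. \<Sum>j\<in>?S. A i j * (- Bmat n z (mix k \<omega>' \<omega>) i k) * (- Bmat n z (mix k \<omega>' \<omega>) j k))"
  proof -
    have 1: "(\<Sum>j<n. g j) = (\<Sum>j\<in>?S. g j)" if "g k = 0" for g :: "nat \<Rightarrow> real"
      using that by (intro sum.mono_neutral_right) auto
    show ?thesis by (subst (1 2) 1) (simp_all add: A)
  qed
  also have "\<dots> = (\<Sum>i\<in>?S. \<Sum>j\<in>?S. (A i j * row k i \<omega>' * row k j \<omega>') / real n)"
  proof (intro sum.cong refl)
    fix i j assume "i \<in> ?S" "j \<in> ?S"
    then have "- Bmat n z (mix k \<omega>' \<omega>) i k = row k i \<omega>' / sqrt (real n)"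
      "- Bmat n z (mix k \<omega>' \<omega>) j k = row k j \<omega>' / sqrt (real n)"
      using k by (auto simp: Bmat_def entry_mix_row)
    moreover have "sqrt (real n) * sqrt (real n) = real n" by simp
    ultimately show "A i j * (- Bmat n z (mix k \<omega>' \<omega>) i k) * (- Bmat n z (mix k \<omega>' \<omega>) j k)
        = (A i j * row k i \<omega>' * row k j \<omega>') / real n"
      by (simp add: mult.assoc)
  qed
  also have "\<dots> = (\<Sum>i\<in>?S. \<Sum>j\<in>?S. A i j * row k i \<omega>' * row k j \<omega>') / real n"
    by (simp add: sum_divide_distrib)
  also have "tr n A = (\<Sum>i\<in>?S. A i i)"
    unfolding tr_def using A by (intro sum.mono_neutral_right) auto
  then have "(\<Sum>i\<in>?S. \<Sum>j\<in>?S. A i j * row k i \<omega>' * row k j \<omega>') / real n =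
      (centred_form A (row k) ?S \<omega>' + tr n A) / real n"
    by (simp add: centred_form_def)
  finally show ?thesis .
qed

text \<open>Off-diagonal entries of J have variance 1 / n, so the form is the centred form plus tr
  A, divided by n. Since A vanishes in row and column k, the diagonal entry of J does not
  enter.\<close>

lemma row_form_moment:
  fixes z and \<omega> :: 'a
  assumes k: "k < n" and A: "symm_mat A" "\<And>j. A k j = 0"
  defines "\<xi> \<equiv> \<lambda>\<omega>'. form n A (\<lambda>j. - Bmat n z (mix k \<omega>' \<omega>) j k)"
  shows "all_moments M \<xi>" "expectation \<xi> = tr n A / real n"
    "expectation (\<lambda>\<omega>'. (\<xi> \<omega>' - tr n A / real n) ^ (2 * p + 2)) \<le>
      quadratic_const \<kappa> p * (1 + tr n (mm n A A)) ^ Suc p / real n ^ (2 * p + 2)"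
proof -
  let ?S = "{..<n} - {k}"
  let ?Q = "centred_form A (row k) ?S"
  have A': "A j k = 0" for j using A unfolding symm_mat_def by metis
  have eq: "\<xi> \<omega>' = (?Q \<omega>' + tr n A) / real n" for \<omega>'
    unfolding \<xi>_def by (rule form_row) (simp_all add: k A(2) A')
  have amQ: "all_moments M ?Q"
    using all_moments_row[OF k] by (intro all_moments_centred_form) auto
  have \<xi>: "\<xi> = (\<lambda>\<omega>'. (1 / real n) * (?Q \<omega>' + tr n A))" by (simp add: fun_eq_iff eq)
  then show "all_moments M \<xi>" by (simp only:) (intro all_moments_intros amQ)
  show "expectation \<xi> = tr n A / real n"
    using expectation_centred_form[OF normalised_row[OF k] A(1)] all_moments_integrable[OF amQ]
    by (simp add: \<xi> prob_space)
  have "expectation (\<lambda>\<omega>'. (\<xi> \<omega>' - tr n A / real n) ^ (2 * p + 2)) =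
      expectation (\<lambda>\<omega>'. ?Q \<omega>' ^ (2 * p + 2) / real n ^ (2 * p + 2))"
    unfolding eq by (intro Bochner_Integration.integral_cong refl) (simp only: power_divide[symmetric] add_divide_distrib add_diff_cancel_right')
  also have "\<dots> = expectation (\<lambda>\<omega>'. ?Q \<omega>' ^ (2 * p + 2)) / real n ^ (2 * p + 2)"
    by simp
  also have "\<dots> \<le> quadratic_const \<kappa> p * (1 + (\<Sum>i\<in>?S. \<Sum>j\<in>?S. (A i j)\<^sup>2)) ^ Suc p / real n ^ (2 * p + 2)"
    by (intro divide_right_mono quadratic_moment normalised_row k A) simp
  also have "(\<Sum>i\<in>?S. \<Sum>j\<in>?S. (A i j)\<^sup>2) = tr n (mm n A A)"
  proof -
    have 1: "(\<Sum>j<n. g j) = (\<Sum>j\<in>?S. g j)" if "g k = 0" for g :: "nat \<Rightarrow> real"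
      using that by (intro sum.mono_neutral_right) auto
    show ?thesis unfolding tr_mm_self[OF A(1)] by (subst (1 2) 1) (simp_all add: A A')
  qed
  finally show "expectation (\<lambda>\<omega>'. (\<xi> \<omega>' - tr n A / real n) ^ (2 * p + 2)) \<le>
      quadratic_const \<kappa> p * (1 + tr n (mm n A A)) ^ Suc p / real n ^ (2 * p + 2)" .
qed

end

section \<open>The upper edge\<close>

text \<open>
  The rows of the matrix are revealed one at a time while the spectral parameter is raised from
  \<open>1 + 2 * h\<close> to \<open>2 + 3 * h\<close>. The potential below is, up to small errors, a supermartingale; it
  controls the normalised traces \<open>T\<close> and \<open>\<phi>\<close> of the resolvent and of its square, and it is at
  least \<open>1\<close> as soon as one of them leaves its allowed range.
\<close>

definition potential :: "real \<Rightarrow> real \<Rightarrow> real \<Rightarrow> real \<Rightarrow> real \<Rightarrow> real \<Rightarrow> real" where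
  "potential \<alpha> K h \<phi> T Y = \<alpha> * (ln (1 + \<phi>) + K * T) + (max 0 Y)\<^sup>2 / h\<^sup>2"

text \<open>The potential after one step, majorised by the tangent of ln at 1 + \<phi> and by a
  quadratic in the increment of Y. It is a polynomial in the random inputs \<xi>2 and \<xi>3, so its
  mean needs only their means and the variance of \<xi>2.\<close>

definition potential_bound ::
  "real \<Rightarrow> real \<Rightarrow> real \<Rightarrow> real \<Rightarrow> real \<Rightarrow> real \<Rightarrow> real \<Rightarrow> real \<Rightarrow> real \<Rightarrow> real \<Rightarrow> real \<Rightarrow> real" where
  "potential_bound \<alpha> K h N \<phi> T Y \<phi>' \<tau>' \<xi>2 \<xi>3 =
     \<alpha> * (ln (1 + \<phi>) + (2 * \<xi>3 - 2 * (1 + h) * \<tau>' + (1 + \<xi>2)\<^sup>2) / (N * (1 + \<phi>))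
       + K * (T + (1 + \<xi>2 - (1 + h) * \<phi>') / N))
     + ((max 0 Y)\<^sup>2 + 2 * max 0 Y * ((\<xi>2 - (1 + h) * \<phi>') / N) + ((\<xi>2 - (1 + h) * \<phi>') / N)\<^sup>2) / h\<^sup>2"

lemma potential_nonneg:
  "\<alpha> \<ge> 0 \<Longrightarrow> K \<ge> 0 \<Longrightarrow> \<phi> \<ge> 0 \<Longrightarrow> T \<ge> 0 \<Longrightarrow> potential \<alpha> K h \<phi> T Y \<ge> 0"
  by (simp add: potential_def)

text \<open>A second-order bound for the squared positive part that remains valid across the kink at
  0.\<close>

lemma max_zero_add_square: "(max 0 (y + z))\<^sup>2 \<le> (max 0 y)\<^sup>2 + 2 * max 0 y * z + (z :: real)\<^sup>2"
proof (cases "y \<ge> 0")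
  case True
  have "(max 0 (y + z))\<^sup>2 \<le> (y + z)\<^sup>2" by (auto simp: max_def)
  then show ?thesis using True by (simp add: power2_sum)
next
  case False
  have "(max 0 (y + z))\<^sup>2 \<le> z\<^sup>2"
  proof (cases "y + z \<ge> 0")
    case True
    then show ?thesis using False by (simp add: power_mono)
  qed simp
  then show ?thesis using False by simp
qed

lemma potential_le_bound:
  assumes "N > 0" "\<alpha> \<ge> 0" "K \<ge> 0" "\<phi> \<ge> 0" "\<phi>1 \<ge> 0"
    and \<phi>1: "\<phi>1 \<le> \<phi> + (2 * \<xi>3 - 2 * (1 + h) * \<tau>' + (1 + \<xi>2)\<^sup>2) / N"
    and T1: "T1 \<le> T + (1 + \<xi>2 - (1 + h) * \<phi>') / N"
    and Y1: "Y1 \<le> Y + (\<xi>2 - (1 + h) * \<phi>') / N"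
  shows "potential \<alpha> K h \<phi>1 T1 Y1 \<le> potential_bound \<alpha> K h N \<phi> T Y \<phi>' \<tau>' \<xi>2 \<xi>3"
proof -
  let ?\<zeta> = "(\<xi>2 - (1 + h) * \<phi>') / N"
  have "ln (1 + \<phi>1) - ln (1 + \<phi>) = ln ((1 + \<phi>1) / (1 + \<phi>))"
    using assms by (simp add: ln_div)
  also have "\<dots> \<le> (1 + \<phi>1) / (1 + \<phi>) - 1"
    using assms by (intro ln_le_minus_one) (auto intro!: divide_pos_pos)
  also have "\<dots> = (\<phi>1 - \<phi>) / (1 + \<phi>)" using assms by (simp add: field_simps)
  also have "\<dots> \<le> ((2 * \<xi>3 - 2 * (1 + h) * \<tau>' + (1 + \<xi>2)\<^sup>2) / N) / (1 + \<phi>)"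
    using assms by (intro divide_right_mono) auto
  finally have 1: "ln (1 + \<phi>1) \<le> ln (1 + \<phi>) + (2 * \<xi>3 - 2 * (1 + h) * \<tau>' + (1 + \<xi>2)\<^sup>2) / (N * (1 + \<phi>))"
    by simp
  have "(max 0 Y1)\<^sup>2 \<le> (max 0 (Y + ?\<zeta>))\<^sup>2" using Y1 by (intro power_mono) auto
  also have "\<dots> \<le> (max 0 Y)\<^sup>2 + 2 * max 0 Y * ?\<zeta> + ?\<zeta>\<^sup>2" by (rule max_zero_add_square)
  finally have 2: "(max 0 Y1)\<^sup>2 \<le> (max 0 Y)\<^sup>2 + 2 * max 0 Y * ?\<zeta> + ?\<zeta>\<^sup>2" .
  show ?thesis
    unfolding potential_def potential_bound_def
    using 1 2 T1 assms by (intro add_mono mult_left_mono divide_right_mono) auto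
qed

lemma potential_ge_1:
  assumes "h > 0" "\<alpha> \<ge> 0" "K \<ge> 0" "\<phi> \<ge> 0" "T \<ge> 0" "Y > h \<or> \<phi> > b" "\<alpha> * ln b \<ge> 1" "b > 0"
  shows "potential \<alpha> K h \<phi> T Y \<ge> 1"
proof -
  have nn: "\<alpha> * ln (1 + \<phi>) \<ge> 0" "\<alpha> * (K * T) \<ge> 0" "(max 0 Y)\<^sup>2 / h\<^sup>2 \<ge> 0"
    using assms by auto
  from assms(6) show ?thesis
  proof
    assume "Y > h"
    then have "(max 0 Y)\<^sup>2 \<ge> h\<^sup>2" using assms by (intro power_mono) auto
    then have "(max 0 Y)\<^sup>2 / h\<^sup>2 \<ge> 1" using assms by simp
    then show ?thesis using nn by (simp add: potential_def distrib_left)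
  next
    assume "\<phi> > b"
    then have "\<alpha> * ln (1 + \<phi>) \<ge> \<alpha> * ln b" using assms by (intro mult_left_mono) auto
    then show ?thesis unfolding potential_def distrib_left using nn assms(7) by linarith
  qed
qed

text \<open>The drift of ln (1 + \<phi>) is at most (1 + C1) * (1 + \<phi>') / N, because (1 +
  \<phi>')^2 \<le> (1 + \<phi>') * (1 + \<phi>). The drift of T contains - h * \<phi>' / N, and K =
  (1 + C1) / h is the weight for which K * T cancels the part of the former proportional to \<phi>'.
  The mean increment of Y is - h * \<phi>' / N, so in the squared positive part only second-order
  terms remain.\<close>

lemma (in prob_space) expectation_potential_bound:
  fixes N :: real
  assumes N: "N > 0" and h: "h > 0" and \<alpha>: "\<alpha> \<ge> 0" and C: "C1 \<ge> 0" "C2 \<ge> 0" "C3 \<ge> 0"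
    and am: "all_moments M \<xi>1" "all_moments M \<xi>2" "all_moments M \<xi>3" "all_moments M d"
    and m2: "expectation \<xi>2 = \<phi>'" and m3: "expectation \<xi>3 = \<tau>'"
    and v2: "expectation (\<lambda>\<omega>. (\<xi>2 \<omega> - \<phi>') ^ 2) \<le> C1 * (1 + \<phi>')\<^sup>2"
    and v1: "expectation (\<lambda>\<omega>. (\<xi>1 \<omega> - T') ^ 4) \<le> C2 * (1 + \<phi>')\<^sup>2 / N\<^sup>2"
    and vd: "expectation (\<lambda>\<omega>. d \<omega> ^ 4) \<le> C3 / N\<^sup>2"
    and \<phi>: "0 \<le> \<phi>'" "\<phi>' \<le> \<phi>" "\<phi> \<le> b" and \<tau>: "\<tau>' \<ge> 0"
  defines "K \<equiv> (1 + C1) / h"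
  shows "integrable M (\<lambda>\<omega>. potential_bound \<alpha> K h N \<phi> T Y \<phi>' \<tau>' (\<xi>2 \<omega>) (\<xi>3 \<omega>)
      + 16 / h ^ 4 * d \<omega> ^ 4 + 16 / h ^ 4 * (\<xi>1 \<omega> - T') ^ 4)" (is "integrable M ?f")
    and "expectation (\<lambda>\<omega>. potential_bound \<alpha> K h N \<phi> T Y \<phi>' \<tau>' (\<xi>2 \<omega>) (\<xi>3 \<omega>)
      + 16 / h ^ 4 * d \<omega> ^ 4 + 16 / h ^ 4 * (\<xi>1 \<omega> - T') ^ 4)
      \<le> potential \<alpha> K h \<phi> T Y + \<alpha> * ((1 + C1) * (1 + 1 / h)) / N
        + ((C1 + h\<^sup>2) / h\<^sup>2 + 16 / h ^ 4 * C2 + 16 / h ^ 4 * C3) * (1 + b)\<^sup>2 / N\<^sup>2"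
proof -
  define q where "q = 1 / (N * (1 + \<phi>))"
  define p where "p = 1 / N"
  define g where "g = 1 / h\<^sup>2"
  define m where "m = max 0 Y"
  \<comment> \<open>Expansion around the means \<phi>' and \<tau>': the terms with \<open>c1\<close>
    and \<open>c2\<close> have expectation zero, and \<open>c3\<close> multiplies the
    variance.\<close>
  define c0 where "c0 = \<alpha> * (ln (1 + \<phi>) + ((1 + \<phi>')\<^sup>2 - 2 * h * \<tau>') * q + K * (T + (1 - h * \<phi>') * p))
     + (m\<^sup>2 - 2 * m * h * \<phi>' * p + h\<^sup>2 * \<phi>'\<^sup>2 * p\<^sup>2) * g"
  define c1 where "c1 = \<alpha> * (2 * (1 + \<phi>') * q + K * p) + (2 * m * p - 2 * h * \<phi>' * p\<^sup>2) * g"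
  define c2 where "c2 = \<alpha> * (2 * q)"
  define c3 where "c3 = \<alpha> * q + p\<^sup>2 * g"
  define e where "e = 16 / h ^ 4"
  have dv: "x / (N * (1 + \<phi>)) = x * q" "x / N = x * p" "x / h\<^sup>2 = x * g" for x
    by (auto simp: q_def p_def g_def)
  have eq: "potential_bound \<alpha> K h N \<phi> T Y \<phi>' \<tau>' x y =
      c0 + c1 * (x - \<phi>') + c2 * (y - \<tau>') + c3 * (x - \<phi>')\<^sup>2" for x y
    unfolding potential_bound_def dv m_def[symmetric] c0_def c1_def c2_def c3_def
    by (simp add: power2_eq_square algebra_simps)
  have feq: "?f = (\<lambda>\<omega>. c0 + c1 * (\<xi>2 \<omega> - \<phi>') + c2 * (\<xi>3 \<omega> - \<tau>') + c3 * (\<xi>2 \<omega> - \<phi>')\<^sup>2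
      + e * d \<omega> ^ 4 + e * (\<xi>1 \<omega> - T') ^ 4)"
    by (simp only: eq e_def)
  show int: "integrable M ?f"
    unfolding feq by (intro all_moments_integrable all_moments_intros am)
  have ints: "integrable M \<xi>2" "integrable M \<xi>3" "integrable M (\<lambda>\<omega>. (\<xi>2 \<omega> - \<phi>')\<^sup>2)"
    "integrable M (\<lambda>\<omega>. d \<omega> ^ 4)" "integrable M (\<lambda>\<omega>. (\<xi>1 \<omega> - T') ^ 4)"
    by (intro all_moments_integrable all_moments_intros am)+
  have "expectation ?f = c0 + c3 * expectation (\<lambda>\<omega>. (\<xi>2 \<omega> - \<phi>')\<^sup>2) + e * expectation (\<lambda>\<omega>. d \<omega> ^ 4)
      + e * expectation (\<lambda>\<omega>. (\<xi>1 \<omega> - T') ^ 4)"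
    unfolding feq using ints by (simp add: m2 m3 prob_space)
  also have "\<dots> \<le> c0 + c3 * (C1 * (1 + \<phi>')\<^sup>2) + e * (C3 / N\<^sup>2) + e * (C2 * (1 + \<phi>')\<^sup>2 / N\<^sup>2)"
  proof (intro add_mono mult_left_mono v2 vd v1)
    show "c3 \<ge> 0" using \<alpha> \<phi> N by (simp add: c3_def q_def g_def)
  qed (simp_all add: e_def)
  also have "\<dots> \<le> potential \<alpha> K h \<phi> T Y + \<alpha> * ((1 + C1) * (1 + 1 / h)) / N
        + ((C1 + h\<^sup>2) / h\<^sup>2 + e * C2 + e * C3) * (1 + b)\<^sup>2 / N\<^sup>2"
  proof -
    define B where "B = (1 + b)\<^sup>2"
    have q0: "q \<ge> 0" and p0: "p \<ge> 0" and g0: "g \<ge> 0" and m0: "m \<ge> 0" and e0: "e \<ge> 0"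
      using N \<phi> by (auto simp: q_def p_def g_def m_def e_def)
    have "(1 + \<phi>')\<^sup>2 * q \<le> (1 + \<phi>') * p"
    proof -
      have "(1 + \<phi>') * q \<le> (1 + \<phi>) * q" using q0 \<phi> by (intro mult_right_mono) auto
      also have "\<dots> = p" using \<phi> N by (simp add: q_def p_def)
      finally have "(1 + \<phi>') * ((1 + \<phi>') * q) \<le> (1 + \<phi>') * p" using \<phi> by (intro mult_left_mono) auto
      then show ?thesis by (simp add: power2_eq_square mult.assoc)
    qed
    then have C1p: "(1 + C1) * ((1 + \<phi>')\<^sup>2 * q) \<le> (1 + C1) * ((1 + \<phi>') * p)"
      using C by (intro mult_left_mono) auto
    moreover have h\<tau>: "0 \<le> 2 * h * \<tau>' * q" using h \<tau> q0 by simp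
    moreover have "K * (h * \<phi>') = (1 + C1) * \<phi>'" using h by (simp add: K_def)
    moreover have "K * ((1 - h * \<phi>') * p) = K * p - (K * (h * \<phi>')) * p"
      by (simp add: algebra_simps)
    ultimately have Kp: "K * ((1 - h * \<phi>') * p) = K * p - (1 + C1) * \<phi>' * p"
      by simp
    have "((1 + \<phi>')\<^sup>2 - 2 * h * \<tau>') * q + C1 * ((1 + \<phi>')\<^sup>2 * q) =
        (1 + C1) * ((1 + \<phi>')\<^sup>2 * q) - 2 * h * \<tau>' * q"
      by (simp add: algebra_simps)
    moreover have "(1 + C1) * ((1 + \<phi>') * p) = (1 + C1) * p + (1 + C1) * \<phi>' * p"
      by (simp add: algebra_simps)
    ultimately have "((1 + \<phi>')\<^sup>2 - 2 * h * \<tau>') * q + C1 * ((1 + \<phi>')\<^sup>2 * q) + K * ((1 - h * \<phi>') * p) \<le> (1 + C1) * p + K * p"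
      using Kp C1p h\<tau> by linarith
    then have A: "\<alpha> * (((1 + \<phi>')\<^sup>2 - 2 * h * \<tau>') * q + C1 * ((1 + \<phi>')\<^sup>2 * q) + K * ((1 - h * \<phi>') * p)) \<le> \<alpha> * ((1 + C1) * p + K * p)"
      using \<alpha> by (rule mult_left_mono)
    have sq: "\<phi>'\<^sup>2 \<le> B" "(1 + \<phi>')\<^sup>2 \<le> B" "1 \<le> B"
      unfolding B_def using \<phi> by (auto intro!: power_mono simp: one_le_power)
    have Bp: "(h\<^sup>2 * \<phi>'\<^sup>2 * p\<^sup>2) * g \<le> (h\<^sup>2 * B * p\<^sup>2) * g" "p\<^sup>2 * g * (C1 * (1 + \<phi>')\<^sup>2) \<le> p\<^sup>2 * g * (C1 * B)"
      "e * (C3 / N\<^sup>2) \<le> e * (C3 * B / N\<^sup>2)" "e * (C2 * (1 + \<phi>')\<^sup>2 / N\<^sup>2) \<le> e * (C2 * B / N\<^sup>2)"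
      using sq g0 C e0 by (auto intro!: mult_right_mono mult_left_mono divide_right_mono simp: mult_le_cancel_left1)
    have mh: "0 \<le> (2 * m * h * \<phi>' * p) * g" using m0 h \<phi> p0 g0 by simp
    have "c0 + c3 * (C1 * (1 + \<phi>')\<^sup>2) = \<alpha> * (ln (1 + \<phi>) + K * T) + m\<^sup>2 * g
        + \<alpha> * (((1 + \<phi>')\<^sup>2 - 2 * h * \<tau>') * q + C1 * ((1 + \<phi>')\<^sup>2 * q) + K * ((1 - h * \<phi>') * p))
        - (2 * m * h * \<phi>' * p) * g + (h\<^sup>2 * \<phi>'\<^sup>2 * p\<^sup>2) * g + p\<^sup>2 * g * (C1 * (1 + \<phi>')\<^sup>2)"
      unfolding c0_def c3_def by (simp add: algebra_simps)
    moreover have "potential \<alpha> K h \<phi> T Y = \<alpha> * (ln (1 + \<phi>) + K * T) + m\<^sup>2 * g"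
      by (simp add: potential_def m_def g_def)
    moreover have "\<alpha> * ((1 + C1) * (1 + 1 / h)) / N = \<alpha> * ((1 + C1) * p + K * p)"
      by (simp add: K_def p_def algebra_simps add_divide_distrib)
    moreover have "((C1 + h\<^sup>2) / h\<^sup>2 + e * C2 + e * C3) * (1 + b)\<^sup>2 / N\<^sup>2 =
        (h\<^sup>2 * B * p\<^sup>2) * g + p\<^sup>2 * g * (C1 * B) + e * (C2 * B / N\<^sup>2) + e * (C3 * B / N\<^sup>2)"
      by (simp add: B_def p_def g_def power_divide algebra_simps add_divide_distrib)
    ultimately show ?thesis using A Bp mh by linarith
  qed
  finally show "expectation ?f \<le> potential \<alpha> K h \<phi> T Y + \<alpha> * ((1 + C1) * (1 + 1 / h)) / N
        + ((C1 + h\<^sup>2) / h\<^sup>2 + 16 / h ^ 4 * C2 + 16 / h ^ 4 * C3) * (1 + b)\<^sup>2 / N\<^sup>2"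
    by (simp only: e_def)
qed

lemma symm_mat_mm_self: "symm_mat G \<Longrightarrow> symm_mat (mm n G G)"
  unfolding symm_mat_def mm_def by (intro allI sum.cong refl) (metis mult.commute)

lemma symm_mat_mm_cube:
  assumes "symm_mat G"
  shows "symm_mat (mm n G (mm n G G))"
  unfolding symm_mat_def
proof (intro allI)
  fix i j
  have "mm n G (mm n G G) i j = mm n (mm n G G) G i j" by (simp add: mm_assoc)
  also have "\<dots> = (\<Sum>k<n. G j k * mm n G G k i)"
    unfolding mm_def[of n "mm n G G"] using assms symm_mat_mm_self[OF assms, of n]
    by (intro sum.cong refl) (metis mult.commute symm_mat_def)
  finally show "mm n G (mm n G G) i j = mm n G (mm n G G) j i" by (simp add: mm_def[of n G "mm n G G"])
qed

text \<open>Submultiplicativity of the Hilbert-Schmidt norm. It reduces the variance of the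
  quadratic form of G^2, which is governed by tr G^4, to the quantity already under control.\<close>

lemma tr_fourth_power_le:
  assumes "symm_mat G"
  shows "tr n (mm n (mm n G G) (mm n G G)) \<le> (tr n (mm n G G))\<^sup>2"
proof -
  have s: "(G k j)\<^sup>2 = (G j k)\<^sup>2" for k j using assms by (simp add: symm_mat_def)
  have "tr n (mm n (mm n G G) (mm n G G)) = (\<Sum>i<n. \<Sum>j<n. (\<Sum>k<n. G i k * G k j)\<^sup>2)"
    by (simp add: tr_mm_self symm_mat_mm_self assms) (simp add: mm_def)
  also have "\<dots> \<le> (\<Sum>i<n. \<Sum>j<n. (\<Sum>k<n. (G i k)\<^sup>2) * (\<Sum>k<n. (G k j)\<^sup>2))"
    by (intro sum_mono Cauchy_Schwarz_ineq_sum)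
  also have "\<dots> = (\<Sum>i<n. \<Sum>k<n. (G i k)\<^sup>2) * (\<Sum>j<n. \<Sum>k<n. (G k j)\<^sup>2)"
    by (simp add: sum_product)
  also have "(\<Sum>j<n. \<Sum>k<n. (G k j)\<^sup>2) = (\<Sum>j<n. \<Sum>k<n. (G j k)\<^sup>2)"
    by (intro sum.cong refl s)
  also have "(\<Sum>i<n. \<Sum>k<n. (G i k)\<^sup>2) * (\<Sum>j<n. \<Sum>k<n. (G j k)\<^sup>2) = (tr n (mm n G G))\<^sup>2"
    by (simp add: tr_mm_self[OF assms] power2_eq_square)
  finally show ?thesis .
qed

section \<open>The walk through the leading blocks\<close>

context
  fixes n :: nat and h :: real
begin

text \<open>Of the slope 1 + h in k / n, the 1 offsets the mean of the form of G^2 that a new row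
  adds to the trace, and h is the slack behind the negative drift. The start 1 + 2 * h leaves a gap
  of at least 1 + h above the allowed trace h + k / n.\<close>

definition level :: "nat \<Rightarrow> real" where
  "level k = 1 + 2 * h + (1 + h) / real n * real k"

definition block :: "nat \<Rightarrow> (nat \<times> nat \<Rightarrow> real) \<Rightarrow> nat \<Rightarrow> nat \<Rightarrow> real" where
  "block k f = res n (Bmat n (level k) f) (rev [0..<k])"

text \<open>The half step: parameter already raised, row k not yet added. It depends on the leading
  block only, so row k is independent of it.\<close>

definition block_raised :: "nat \<Rightarrow> (nat \<times> nat \<Rightarrow> real) \<Rightarrow> nat \<Rightarrow> nat \<Rightarrow> real" where
  "block_raised k f = res n (Bmat n (level (Suc k)) f) (rev [0..<k])"

definition block_tr :: "nat \<Rightarrow> (nat \<times> nat \<Rightarrow> real) \<Rightarrow> real" where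
  "block_tr k f = tr n (block k f) / real n"

definition block_tr2 :: "nat \<Rightarrow> (nat \<times> nat \<Rightarrow> real) \<Rightarrow> real" where
  "block_tr2 k f = tr n (mm n (block k f) (block k f)) / real n"

text \<open>The bound n powr (1/4) is loose on purpose: its logarithm must be of order ln n for the
  potential to detect a violation, while n steps of variance (1 + n powr (1/4))^2 / n^2 must still
  sum to o(1).\<close>

definition in_range :: "nat \<Rightarrow> (nat \<times> nat \<Rightarrow> real) \<Rightarrow> bool" where
  "in_range k f \<longleftrightarrow> block_tr k f - real k / real n \<le> h \<and> block_tr2 k f \<le> real n powr (1/4)"

primrec stay :: "nat \<Rightarrow> (nat \<times> nat \<Rightarrow> real) \<Rightarrow> bool" where
  "stay 0 f = True"
| "stay (Suc k) f = (stay k f \<and> pivot n (Bmat n (level (Suc k)) f) k (block_raised k f) \<ge> 1 \<and> in_range (Suc k) f)"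

definition walk_potential :: "real \<Rightarrow> real \<Rightarrow> nat \<Rightarrow> (nat \<times> nat \<Rightarrow> real) \<Rightarrow> real" where
  "walk_potential \<alpha> K k f = potential \<alpha> K h (block_tr2 k f) (block_tr k f) (block_tr k f - real k / real n)"

text \<open>Frozen at 1 once the walk has failed. On leaving the range the potential is at least 1,
  so freezing does not raise the value there; a failing pivot is paid for separately in
  \<open>step_bound\<close>.\<close>

definition stopped :: "real \<Rightarrow> real \<Rightarrow> nat \<Rightarrow> (nat \<times> nat \<Rightarrow> real) \<Rightarrow> real" where
  "stopped \<alpha> K k f = (if stay k f then walk_potential \<alpha> K k f else 1)"

definition row_form :: "nat \<Rightarrow> (nat \<times> nat \<Rightarrow> real) \<Rightarrow> (nat \<Rightarrow> nat \<Rightarrow> real) \<Rightarrow> real" where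
  "row_form k f A = form n A (\<lambda>j. - Bmat n (level (Suc k)) f j k)"

text \<open>The two fourth powers are at least 1 as soon as the diagonal entry or the deviation of
  the quadratic form exceeds h / 2; for a walk still in range, one of these must happen if the next
  pivot is below 1.\<close>

definition step_bound :: "real \<Rightarrow> real \<Rightarrow> nat \<Rightarrow> (nat \<times> nat \<Rightarrow> real) \<Rightarrow> real" where
  "step_bound \<alpha> K k f = (let G = block_raised k f in
     potential_bound \<alpha> K h (real n) (block_tr2 k f) (block_tr k f) (block_tr k f - real k / real n)
       (tr n (mm n G G) / real n) (tr n (mm n G (mm n G G)) / real n)
       (row_form k f (mm n G G)) (row_form k f (mm n G (mm n G G)))
     + 16 / h ^ 4 * entry n f k k ^ 4 + 16 / h ^ 4 * (row_form k f G - tr n G / real n) ^ 4)"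

lemma level_Suc: "level (Suc k) = level k + (1 + h) / real n"
  by (simp add: level_def algebra_simps add_divide_distrib)

lemma set_rev_upt: "set (rev [0..<k]) = {..<k}"
  by auto

lemma Bmat_level_Suc: "Bmat n (level (Suc k)) f = shift ((1 + h) / real n) (Bmat n (level k) f)"
  unfolding level_Suc by (rule Bmat_shift)

lemma block_Suc: "block (Suc k) f = border n (Bmat n (level (Suc k)) f) k (block_raised k f)"
  by (simp add: block_def block_raised_def)

context
  fixes k :: nat and f :: "nat \<times> nat \<Rightarrow> real"
  assumes n: "n > 0" and h: "h > 0" and k: "k \<le> n"
begin

lemma block_inverse_on:
  assumes "pd n (Bmat n (level k) f) {..<k}"
  shows "inverse_on n (Bmat n (level k) f) {..<k} (block k f)"
  unfolding block_def using res_correct(2)[OF symm_mat_Bmat, of "rev [0..<k]" n] assms k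
  by (simp only: set_rev_upt) simp

lemma block_raised_inverse_on:
  assumes "pd n (Bmat n (level k) f) {..<k}"
  shows "inverse_on n (Bmat n (level (Suc k)) f) {..<k} (block_raised k f)"
    and "pd n (Bmat n (level (Suc k)) f) {..<k}"
proof -
  show pd: "pd n (Bmat n (level (Suc k)) f) {..<k}"
    unfolding Bmat_level_Suc using assms n h by (intro pd_shift) auto
  show "inverse_on n (Bmat n (level (Suc k)) f) {..<k} (block_raised k f)"
    unfolding block_raised_def using res_correct(2)[OF symm_mat_Bmat, of "rev [0..<k]" n] pd k
    by (simp only: set_rev_upt) simp
qed

end

lemma stay_pd:
  assumes "n > 0" "h > 0" "k \<le> n" "stay k f"
  shows "pd n (Bmat n (level k) f) {..<k}"
  using assms
proof (induction k)
  case 0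
  then show ?case by (simp add: pd_empty)
next
  case (Suc k)
  then have pd: "pd n (Bmat n (level k) f) {..<k}" by simp
  have "pd n (Bmat n (level (Suc k)) f) (insert k {..<k})"
  proof (subst pd_insert_iff[OF block_raised_inverse_on(1) symm_mat_Bmat])
    show "pd n (Bmat n (level (Suc k)) f) {..<k} \<and> 0 < pivot n (Bmat n (level (Suc k)) f) k (block_raised k f)"
      using block_raised_inverse_on(2)[OF Suc.prems(1,2) _ pd] Suc.prems by auto
  qed (use Suc pd in auto)
  then show ?case by (simp add: lessThan_Suc)
qed

lemma tr_inverse_on_nonneg:
  assumes "inverse_on m B S G" "pd m B S"
  shows "tr m G \<ge> 0" "tr m (mm m G G) \<ge> 0" "tr m (mm m G (mm m G G)) \<ge> 0"
proof -
  have sG: "symm_mat G" using assms inverse_onD(2) by auto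
  show "tr m G \<ge> 0" unfolding tr_eq_sum_form by (intro sum_nonneg inverse_on_form_nonneg[OF assms])
  show "tr m (mm m G G) \<ge> 0" unfolding tr_mm_self[OF sG] by (intro sum_nonneg) simp
  show "tr m (mm m G (mm m G G)) \<ge> 0"
    unfolding tr_eq_sum_form form_mm_cube[OF sG] by (intro sum_nonneg inverse_on_form_nonneg[OF assms])
qed

lemma stay_in_range:
  assumes "h > 0" "stay k f"
  shows "in_range k f"
proof (cases k)
  case 0
  then show ?thesis using assms
    by (simp add: in_range_def block_tr_def block_tr2_def block_def tr_def mm_def)
qed (use assms in auto)

lemma block_raised_traces:
  assumes n: "n > 0" and h: "h > 0" and k: "k < n" and stay: "stay k f"
  defines "G \<equiv> block_raised k f"
  shows "inverse_on n (Bmat n (level (Suc k)) f) {..<k} G" "pd n (Bmat n (level (Suc k)) f) {..<k}"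
    and "block_tr k f \<ge> tr n G / n + (1 + h) / n * (tr n (mm n G G) / n)"
    and "block_tr2 k f \<ge> tr n (mm n G G) / n + 2 * (1 + h) / n * (tr n (mm n G (mm n G G)) / n)"
    and "tr n G \<ge> 0" "tr n (mm n G G) \<ge> 0" "tr n (mm n G (mm n G G)) \<ge> 0"
proof -
  have k': "k \<le> n" using k by simp
  have pd: "pd n (Bmat n (level k) f) {..<k}" by (rule stay_pd[OF n h k' stay])
  note I = block_inverse_on[OF n h k' pd] block_raised_inverse_on[OF n h k' pd]
  show 1: "inverse_on n (Bmat n (level (Suc k)) f) {..<k} G" "pd n (Bmat n (level (Suc k)) f) {..<k}"
    using I by (auto simp: G_def)
  have \<eta>: "(1 + h) / real n \<ge> 0" using h by simp
  have I2: "inverse_on n (shift ((1 + h) / real n) (Bmat n (level k) f)) {..<k} G"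
    using 1 by (simp only: Bmat_level_Suc)
  have "tr n G + (1 + h) / n * tr n (mm n G G) \<le> tr n (block k f)"
    by (rule tr_shift_le[OF symm_mat_Bmat I(1) I2 pd \<eta>])
  then have "(tr n G + (1 + h) / n * tr n (mm n G G)) / n \<le> tr n (block k f) / n"
    by (intro divide_right_mono) auto
  then show "block_tr k f \<ge> tr n G / n + (1 + h) / n * (tr n (mm n G G) / n)"
    by (simp add: block_tr_def add_divide_distrib)
  have "tr n (mm n G G) + 2 * ((1 + h) / n) * tr n (mm n G (mm n G G)) \<le> tr n (mm n (block k f) (block k f))"
    by (rule tr_square_shift_le[OF symm_mat_Bmat I(1) I2 pd \<eta>])
  then have "(tr n (mm n G G) + 2 * ((1 + h) / n) * tr n (mm n G (mm n G G))) / n \<le> tr n (mm n (block k f) (block k f)) / n"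
    by (intro divide_right_mono) auto
  then show "block_tr2 k f \<ge> tr n (mm n G G) / n + 2 * (1 + h) / n * (tr n (mm n G (mm n G G)) / n)"
    by (simp add: block_tr2_def add_divide_distrib)
  show "tr n G \<ge> 0" "tr n (mm n G G) \<ge> 0" "tr n (mm n G (mm n G G)) \<ge> 0"
    using tr_inverse_on_nonneg[OF 1] by auto
qed

lemma stopped_Suc_le:
  assumes n: "n > 0" and h: "h > 0" and k: "k < n" and stay: "stay k f"
    and \<alpha>: "\<alpha> \<ge> 0" and K: "K \<ge> 0" and \<alpha>n: "\<alpha> * ln (real n powr (1/4)) \<ge> 1"
  shows "stopped \<alpha> K (Suc k) f \<le> step_bound \<alpha> K k f" "step_bound \<alpha> K k f \<ge> 0"
proof -
  define G where "G = block_raised k f"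
  define \<xi>2 where "\<xi>2 = row_form k f (mm n G G)"
  define \<xi>3 where "\<xi>3 = row_form k f (mm n G (mm n G G))"
  define \<phi>' where "\<phi>' = tr n (mm n G G) / real n"
  define \<tau>' where "\<tau>' = tr n (mm n G (mm n G G)) / real n"
  define \<phi> where "\<phi> = block_tr2 k f"
  define T where "T = block_tr k f"
  define Y where "Y = T - real k / real n"
  let ?B = "Bmat n (level (Suc k)) f"
  let ?bound = "potential_bound \<alpha> K h (real n) \<phi> T Y \<phi>' \<tau>' \<xi>2 \<xi>3"
  note R = block_raised_traces[OF n h k stay, folded G_def]
  have N: "real n > 0" using n by simp
  have kS: "k \<notin> {..<k}" by simp
  have \<phi>'0: "\<phi>' \<ge> 0" "\<tau>' \<ge> 0" "tr n G / n \<ge> 0" using R by (auto simp: \<phi>'_def \<tau>'_def)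
  have \<phi>le: "\<phi>' + 2 * (1 + h) * \<tau>' / n \<le> \<phi>" using R(4) by (simp add: \<phi>_def \<phi>'_def \<tau>'_def)
  have Tle: "tr n G / n + (1 + h) * \<phi>' / n \<le> T" using R(3) by (simp add: T_def \<phi>'_def)
  have h0: "2 * (1 + h) * \<tau>' / n \<ge> 0" "(1 + h) * \<phi>' / n \<ge> 0" using h \<phi>'0 by simp_all
  have \<phi>0: "\<phi> \<ge> 0" using \<phi>le h0 \<phi>'0 by linarith
  have sG: "symm_mat G" using R(1) inverse_onD(2) by auto
  have \<xi>0: "\<xi>2 \<ge> 0" "\<xi>3 \<ge> 0"
    unfolding \<xi>2_def \<xi>3_def row_form_def form_mm_self[OF sG] form_mm_cube[OF sG]
    by (auto intro: dot_self_nonneg inverse_on_form_nonneg[OF R(1,2)])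
  have sb: "step_bound \<alpha> K k f = ?bound + 16 / h ^ 4 * entry n f k k ^ 4 + 16 / h ^ 4 * (row_form k f G - tr n G / real n) ^ 4"
    by (simp add: step_bound_def Let_def G_def[symmetric] \<xi>2_def \<xi>3_def \<phi>'_def \<tau>'_def \<phi>_def T_def Y_def)
  have e4: "16 / h ^ 4 * x ^ 4 \<ge> 0" for x using h by simp
  \<comment> \<open>This must also hold when the pivot fails and no bordered matrix is at hand, so
    the potential is evaluated at the upper bounds for the new traces themselves.\<close>
  have b0: "?bound \<ge> 0"
  proof -
    let ?\<phi>1 = "\<phi> + (2 * \<xi>3 - 2 * (1 + h) * \<tau>' + (1 + \<xi>2)\<^sup>2) / n" and ?T1 = "T + (1 + \<xi>2 - (1 + h) * \<phi>') / n"
    have "(2 * \<xi>3 + (1 + \<xi>2)\<^sup>2) / n \<ge> 0" "(1 + \<xi>2) / n \<ge> 0" using \<xi>0 N by auto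
    then have 0: "?\<phi>1 \<ge> 0" "?T1 \<ge> 0"
      using \<phi>le Tle \<phi>'0 by (auto simp: add_divide_distrib diff_divide_distrib)
    have "potential \<alpha> K h ?\<phi>1 ?T1 (Y + (\<xi>2 - (1 + h) * \<phi>') / n) \<le> ?bound"
      using N \<alpha> K \<phi>0 0 by (intro potential_le_bound) auto
    moreover have "0 \<le> potential \<alpha> K h ?\<phi>1 ?T1 (Y + (\<xi>2 - (1 + h) * \<phi>') / n)"
      using \<alpha> K 0 by (intro potential_nonneg)
    ultimately show ?thesis by linarith
  qed
  then show "step_bound \<alpha> K k f \<ge> 0" using sb e4[of "entry n f k k"] e4[of "row_form k f G - tr n G / real n"] by linarith
  show "stopped \<alpha> K (Suc k) f \<le> step_bound \<alpha> K k f"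
  proof (cases "pivot n ?B k G \<ge> 1")
    case True
    note bt = border_traces[OF R(1,2) k kS True, folded row_form_def, folded \<xi>2_def \<xi>3_def]
    define \<phi>1 where "\<phi>1 = block_tr2 (Suc k) f"
    define T1 where "T1 = block_tr (Suc k) f"
    have G1: "block (Suc k) f = border n ?B k G" by (simp add: block_Suc G_def)
    have "pivot n ?B k G \<noteq> 0" "pivot n ?B k G > 0" using True by auto
    then have inv1: "inverse_on n ?B (insert k {..<k}) (block (Suc k) f)" and pd1: "pd n ?B (insert k {..<k})"
      using inverse_on_border[OF R(1) symm_mat_Bmat k kS] pd_insert_iff[OF R(1) symm_mat_Bmat k kS] R(2) G1 by auto
    have \<phi>10: "\<phi>1 \<ge> 0" "T1 \<ge> 0"
      using tr_inverse_on_nonneg[OF inv1 pd1] by (auto simp: \<phi>1_def T1_def block_tr2_def block_tr_def)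
    have "T1 \<le> (tr n G + 1 + \<xi>2) / n"
      using bt(3) by (simp add: T1_def block_tr_def G1 divide_right_mono)
    then have T1: "T1 \<le> T + (1 + \<xi>2 - (1 + h) * \<phi>') / n"
      using Tle by (simp add: add_divide_distrib diff_divide_distrib)
    have "\<phi>1 \<le> (tr n (mm n G G) + 2 * \<xi>3 + (1 + \<xi>2)\<^sup>2) / n"
      using bt(4) by (simp add: \<phi>1_def block_tr2_def G1 divide_right_mono)
    then have \<phi>1: "\<phi>1 \<le> \<phi> + (2 * \<xi>3 - 2 * (1 + h) * \<tau>' + (1 + \<xi>2)\<^sup>2) / n"
      using \<phi>le by (simp add: add_divide_distrib diff_divide_distrib \<phi>'_def)
    have Y1: "T1 - real (Suc k) / n \<le> Y + (\<xi>2 - (1 + h) * \<phi>') / n"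
      using T1 by (simp add: Y_def add_divide_distrib diff_divide_distrib)
    have pot: "walk_potential \<alpha> K (Suc k) f \<le> ?bound"
      unfolding walk_potential_def \<phi>1_def[symmetric] T1_def[symmetric]
      by (rule potential_le_bound[OF N \<alpha> K \<phi>0 \<phi>10(1) \<phi>1 T1 Y1])
    have "stopped \<alpha> K (Suc k) f \<le> walk_potential \<alpha> K (Suc k) f"
    proof (cases "stay (Suc k) f")
      case False
      then have "\<not> in_range (Suc k) f" using stay True by (simp add: G_def)
      then have out: "T1 - real (Suc k) / n > h \<or> \<phi>1 > real n powr (1/4)"
        by (auto simp: in_range_def T1_def \<phi>1_def)
      have "walk_potential \<alpha> K (Suc k) f \<ge> 1"
        unfolding walk_potential_def \<phi>1_def[symmetric] T1_def[symmetric]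
        by (rule potential_ge_1[OF h \<alpha> K \<phi>10(1) \<phi>10(2) out \<alpha>n]) (use N in simp)
      then show ?thesis using False by (simp add: stopped_def)
    qed (simp add: stopped_def)
    then show ?thesis using pot sb e4[of "entry n f k k"] e4[of "row_form k f G - tr n G / real n"] by linarith
  next
    case False
    have big: "16 / h ^ 4 * x ^ 4 \<ge> 1" if "\<bar>x\<bar> > h / 2" for x
    proof -
      have "(h / 2) ^ 4 \<le> \<bar>x\<bar> ^ 4" using that h by (intro power_mono) auto
      then have "h ^ 4 \<le> 16 * x ^ 4" by (simp add: power_divide power_even_abs)
      then show ?thesis using h by (simp add: pos_le_divide_eq)
    qed
    \<comment> \<open>The trace is at most h + k / n and the level at least 1 + 2 * h + k / n, so a
      pivot below 1 needs deviations of total size above h.\<close>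
    have piv: "pivot n ?B k G = level (Suc k) - entry n f k k - row_form k f G"
      by (simp add: pivot_def Bmat_def row_form_def)
    have "T - real k / n \<le> h" using stay_in_range[OF h stay] by (simp add: in_range_def T_def)
    then have "tr n G / n \<le> h + real k / n" using Tle h0 by linarith
    moreover have "level (Suc k) \<ge> 1 + 2 * h + real k / n"
    proof -
      have "real k / n \<le> (1 + h) * real (Suc k) / n"
        using h by (intro divide_right_mono) (auto simp: algebra_simps)
      then show ?thesis by (simp add: level_def)
    qed
    ultimately have "\<not> (\<bar>entry n f k k\<bar> \<le> h / 2 \<and> \<bar>row_form k f G - tr n G / n\<bar> \<le> h / 2)"
      using False piv by (auto simp: abs_le_iff)
    then have "\<bar>entry n f k k\<bar> > h / 2 \<or> \<bar>row_form k f G - tr n G / n\<bar> > h / 2" by auto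
    then have "16 / h ^ 4 * entry n f k k ^ 4 \<ge> 1 \<or> 16 / h ^ 4 * (row_form k f G - tr n G / n) ^ 4 \<ge> 1"
      using big by blast
    then have "1 \<le> step_bound \<alpha> K k f"
      using sb b0 e4[of "entry n f k k"] e4[of "row_form k f G - tr n G / real n"] by linarith
    moreover have "\<not> stay (Suc k) f" using False by (simp add: G_def)
    ultimately show ?thesis unfolding stopped_def by (simp del: stay.simps)
  qed
qed

lemma Bmat_cong: "entry n f i j = entry n g i j \<Longrightarrow> Bmat n z f i j = Bmat n z g i j"
  by (simp add: Bmat_def)

lemma block_cong:
  assumes "\<And>i j. i < k \<Longrightarrow> j < k \<Longrightarrow> entry n f i j = entry n g i j"
  shows "block k f = block k g" "block_raised k f = block_raised k g" "block_tr k f = block_tr k g"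
    "block_tr2 k f = block_tr2 k g" "in_range k f = in_range k g"
proof -
  have "Bmat n z f i j = Bmat n z g i j" if "i \<in> set (rev [0..<k])" "j \<in> set (rev [0..<k])" for z i j
    using that assms by (intro Bmat_cong) auto
  then show 1: "block k f = block k g" and 2: "block_raised k f = block_raised k g"
    unfolding block_def block_raised_def by (intro res_cong; blast)+
  then show "block_tr k f = block_tr k g" "block_tr2 k f = block_tr2 k g"
    by (simp_all add: block_tr_def block_tr2_def)
  then show "in_range k f = in_range k g" by (simp add: in_range_def)
qed

text \<open>The stopping-time property: survival up to k is decided by the leading k by k
  block.\<close>

lemma stay_cong:
  assumes "\<And>i j. i < k \<Longrightarrow> j < k \<Longrightarrow> entry n f i j = entry n g i j"
  shows "stay k f = stay k g"
  using assms
proof (induction k)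
  case (Suc k)
  have "pivot n (Bmat n (level (Suc k)) f) k (block_raised k g) = pivot n (Bmat n (level (Suc k)) g) k (block_raised k g)"
    unfolding block_raised_def
    by (rule pivot_border_vec_cong(1)) (use Suc.prems in \<open>auto intro!: Bmat_cong\<close>)
  moreover have "block_raised k f = block_raised k g" using Suc.prems by (intro block_cong(2)) auto
  moreover have "in_range (Suc k) f = in_range (Suc k) g" by (rule block_cong(5)) (rule Suc.prems)
  ultimately show ?case using Suc by simp
qed simp

lemma measurable_block:
  assumes "k \<le> n"
  shows "(\<lambda>f. block k f i j) \<in> borel_measurable (fam_space n)"
    and "(\<lambda>f. block_raised k f i j) \<in> borel_measurable (fam_space n)"
    and "(\<lambda>f. block_tr k f) \<in> borel_measurable (fam_space n)"
    and "(\<lambda>f. block_tr2 k f) \<in> borel_measurable (fam_space n)"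
    and "Measurable.pred (fam_space n) (in_range k)"
    and "(\<lambda>f. walk_potential \<alpha> K k f) \<in> borel_measurable (fam_space n)"
proof -
  show 1: "(\<lambda>f. block k f i j) \<in> borel_measurable (fam_space n)"
    "(\<lambda>f. block_raised k f i j) \<in> borel_measurable (fam_space n)" for i j
    unfolding block_def block_raised_def using assms by (auto intro!: measurable_res)
  show [measurable]: "(\<lambda>f. block_tr k f) \<in> borel_measurable (fam_space n)"
    "(\<lambda>f. block_tr2 k f) \<in> borel_measurable (fam_space n)"
    unfolding block_tr_def block_tr2_def
    by (intro borel_measurable_divide measurable_tr measurable_mm 1 borel_measurable_const)+
  show "Measurable.pred (fam_space n) (in_range k)"
    unfolding in_range_def[abs_def] by measurable
  show "(\<lambda>f. walk_potential \<alpha> K k f) \<in> borel_measurable (fam_space n)"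
    unfolding walk_potential_def[abs_def] potential_def by measurable
qed

lemma measurable_stay:
  assumes "k \<le> n"
  shows "Measurable.pred (fam_space n) (stay k)"
  using assms
proof (induction k)
  case (Suc k)
  have [measurable]: "(\<lambda>f. pivot n (Bmat n (level (Suc k)) f) k (block_raised k f)) \<in> borel_measurable (fam_space n)"
    using Suc.prems by (intro measurable_pivot measurable_block) auto
  have [measurable]: "Measurable.pred (fam_space n) (in_range (Suc k))" by (rule measurable_block(5)[OF Suc.prems])
  have [measurable]: "Measurable.pred (fam_space n) (stay k)" using Suc by simp
  show ?case unfolding stay.simps[abs_def] by measurable
next
  case 0
  have "stay 0 = (\<lambda>_. True)" by (simp add: fun_eq_iff)
  then show ?case by simp
qed

lemma measurable_stopped:
  assumes "k \<le> n"
  shows "stopped \<alpha> K k \<in> borel_measurable (fam_space n)"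
proof -
  note [measurable] = measurable_stay[OF assms] measurable_block(6)[OF assms]
  show ?thesis unfolding stopped_def[abs_def] by measurable
qed

lemma measurable_row_form:
  assumes "\<And>i j. (\<lambda>f. A f i j) \<in> borel_measurable (fam_space n)" "k < n"
  shows "(\<lambda>f. row_form k f (A f)) \<in> borel_measurable (fam_space n)"
  unfolding row_form_def using assms by (intro measurable_form borel_measurable_uminus measurable_Bmat)

lemma measurable_step_bound:
  assumes k: "k < n"
  shows "step_bound \<alpha> K k \<in> borel_measurable (fam_space n)"
proof -
  have G: "(\<lambda>f. block_raised k f i j) \<in> borel_measurable (fam_space n)" for i j
    using k by (intro measurable_block) simp
  have [measurable]: "(\<lambda>f. entry n f k k) \<in> borel_measurable (fam_space n)"
    "(\<lambda>f. block_tr k f) \<in> borel_measurable (fam_space n)" "(\<lambda>f. block_tr2 k f) \<in> borel_measurable (fam_space n)"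
    "(\<lambda>f. tr n (block_raised k f)) \<in> borel_measurable (fam_space n)"
    "(\<lambda>f. tr n (mm n (block_raised k f) (block_raised k f))) \<in> borel_measurable (fam_space n)"
    "(\<lambda>f. tr n (mm n (block_raised k f) (mm n (block_raised k f) (block_raised k f)))) \<in> borel_measurable (fam_space n)"
    "(\<lambda>f. row_form k f (block_raised k f)) \<in> borel_measurable (fam_space n)"
    "(\<lambda>f. row_form k f (mm n (block_raised k f) (block_raised k f))) \<in> borel_measurable (fam_space n)"
    "(\<lambda>f. row_form k f (mm n (block_raised k f) (mm n (block_raised k f) (block_raised k f)))) \<in> borel_measurable (fam_space n)"
    using k by (auto intro!: measurable_entry measurable_block measurable_tr measurable_mm measurable_row_form G)
  show ?thesis
    unfolding step_bound_def[abs_def] Let_def potential_bound_def by measurable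
qed

end

section \<open>The supermartingale estimate and its summation\<close>

context wigner
begin

definition step_error :: "real \<Rightarrow> real \<Rightarrow> real" where
  "step_error h \<alpha> = \<alpha> * ((1 + quadratic_const \<kappa> 0) * (1 + 1 / h)) / real n +
     ((quadratic_const \<kappa> 0 + h\<^sup>2) / h\<^sup>2 + 16 / h ^ 4 * quadratic_const \<kappa> 1 + 16 / h ^ 4 * \<kappa> 4)
       * (1 + real n powr (1/4))\<^sup>2 / (real n)\<^sup>2"

lemma step_error_nonneg: "h > 0 \<Longrightarrow> \<alpha> \<ge> 0 \<Longrightarrow> step_error h \<alpha> \<ge> 0"
  using quadratic_const_nonneg[OF \<kappa>_nonneg] \<kappa>_nonneg by (simp add: step_error_def)

text \<open>One step in conditional expectation: \<omega> fixes the block, hence all traces, and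
  \<omega>' supplies the new row.\<close>

lemma nn_integral_step_bound_le:
  assumes h: "h > 0" and k: "k < n" and \<alpha>: "\<alpha> \<ge> 0" "\<alpha> * ln (real n powr (1/4)) \<ge> 1"
    and stay: "stay n h k (fam \<omega>)"
  defines "K \<equiv> (1 + quadratic_const \<kappa> 0) / h"
  shows "(\<integral>\<^sup>+\<omega>'. ennreal (step_bound n h \<alpha> K k (mix k \<omega>' \<omega>)) \<partial>M) \<le>
     ennreal (walk_potential n h \<alpha> K k (fam \<omega>) + step_error h \<alpha>)"
proof -
  let ?f = "fam \<omega>"
  define G where "G = block_raised n h k ?f"
  define z where "z = level n h (Suc k)"
  define \<xi> where "\<xi> A \<omega>' = form n A (\<lambda>j. - Bmat n z (mix k \<omega>' \<omega>) j k)" for A \<omega>'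
  define \<phi>' where "\<phi>' = tr n (mm n G G) / real n"
  define \<tau>' where "\<tau>' = tr n (mm n G (mm n G G)) / real n"
  define \<phi> where "\<phi> = block_tr2 n h k ?f"
  define T where "T = block_tr n h k ?f"
  let ?C1 = "quadratic_const \<kappa> 0" and ?C2 = "quadratic_const \<kappa> 1"
  let ?d = "\<lambda>\<omega>'. row k k \<omega>' / sqrt (real n)"
  note qc = quadratic_const_nonneg[OF \<kappa>_nonneg]
  have N: "real n > 0" using n_pos by simp
  have N1: "real n \<ge> 1" using n_pos by simp
  have K0: "K \<ge> 0" using h qc by (simp add: K_def)
  note R = block_raised_traces[OF n_pos h k stay, folded G_def]
  have e: "entry n (mix k \<omega>' \<omega>) i j = entry n ?f i j" if "i < k" "j < k" for i j \<omega>'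
    using that k by (intro entry_mix_block) auto
  have stay': "stay n h k (mix k \<omega>' \<omega>)" for \<omega>'
    using stay stay_cong[OF e] by blast
  have sb: "step_bound n h \<alpha> K k (mix k \<omega>' \<omega>) =
      potential_bound \<alpha> K h (real n) \<phi> T (T - real k / real n) \<phi>' \<tau>' (\<xi> (mm n G G) \<omega>') (\<xi> (mm n G (mm n G G)) \<omega>')
      + 16 / h ^ 4 * ?d \<omega>' ^ 4 + 16 / h ^ 4 * (\<xi> G \<omega>' - tr n G / real n) ^ 4" for \<omega>'
  proof -
    have "block_raised n h k (mix k \<omega>' \<omega>) = G" "block_tr2 n h k (mix k \<omega>' \<omega>) = \<phi>" "block_tr n h k (mix k \<omega>' \<omega>) = T"
      using block_cong(2-4)[OF e] by (auto simp: G_def \<phi>_def T_def)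
    moreover have "entry n (mix k \<omega>' \<omega>) k k = ?d \<omega>'" using k by (intro entry_mix_row)
    ultimately show ?thesis
      by (simp add: step_bound_def Let_def row_form_def \<xi>_def z_def \<phi>'_def \<tau>'_def)
  qed
  have sG: "symm_mat G" using R(1) inverse_onD(2) by auto
  have Gk: "G k j = 0" for j using R(1) inverse_onD(3) by auto
  have GG: "symm_mat (mm n G G)" "mm n G G k j = 0" "symm_mat (mm n G (mm n G G))" "mm n G (mm n G G) k j = 0" for j
    by (auto intro: symm_mat_mm_self symm_mat_mm_cube sG) (simp_all add: mm_def Gk)
  note m1 = row_form_moment[OF k sG Gk, of z \<omega>, folded \<xi>_def]
  note m2 = row_form_moment[OF k GG(1,2), of z \<omega>, folded \<xi>_def]
  note m3 = row_form_moment[OF k GG(3,4), of z \<omega>, folded \<xi>_def]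
  have amd: "all_moments M ?d"
    using all_moments_scale[OF all_moments_row[OF k k], of "1 / sqrt (real n)"] by simp
  have \<phi>'0: "\<phi>' \<ge> 0" "\<tau>' \<ge> 0" using R by (auto simp: \<phi>'_def \<tau>'_def)
  have "2 * (1 + h) / real n * \<tau>' \<ge> 0" using h \<phi>'0 by simp
  then have \<phi>'\<phi>: "\<phi>' \<le> \<phi>" using R(4) by (simp add: \<phi>_def \<phi>'_def \<tau>'_def)
  have \<phi>b: "\<phi> \<le> real n powr (1/4)" using stay_in_range[OF h stay] by (simp add: in_range_def \<phi>_def)
  \<comment> \<open>The variance of the form of G^2 is bounded through tr G^4 / n^2, hence by a
    multiple of (1 + \<phi>')^2. This quadratic growth is the reason for the logarithm in the
    potential.\<close>
  have v2: "expectation (\<lambda>\<omega>'. (\<xi> (mm n G G) \<omega>' - \<phi>') ^ 2) \<le> ?C1 * (1 + \<phi>')\<^sup>2"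
  proof -
    have "expectation (\<lambda>\<omega>'. (\<xi> (mm n G G) \<omega>' - \<phi>') ^ 2) \<le> ?C1 * ((1 + tr n (mm n (mm n G G) (mm n G G))) / (real n)\<^sup>2)"
      using m2(3)[of 0] by (simp add: \<phi>'_def power2_eq_square)
    also have "(1 + tr n (mm n (mm n G G) (mm n G G))) / (real n)\<^sup>2 \<le> (1 + (tr n (mm n G G))\<^sup>2) / (real n)\<^sup>2"
      using tr_fourth_power_le[OF sG] by (intro divide_right_mono add_left_mono) auto
    also have "\<dots> = 1 / (real n)\<^sup>2 + \<phi>'\<^sup>2" by (simp add: \<phi>'_def add_divide_distrib power_divide)
    also have "\<dots> \<le> 1 + \<phi>'\<^sup>2" using N1 by (simp add: one_le_power)
    also have "\<dots> \<le> (1 + \<phi>')\<^sup>2" using \<phi>'0 by (simp add: power2_sum)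
    finally show ?thesis using qc by (simp add: mult_left_mono)
  qed
  have v1: "expectation (\<lambda>\<omega>'. (\<xi> G \<omega>' - tr n G / real n) ^ 4) \<le> ?C2 * (1 + \<phi>')\<^sup>2 / (real n)\<^sup>2"
  proof -
    have "expectation (\<lambda>\<omega>'. (\<xi> G \<omega>' - tr n G / real n) ^ 4) \<le> ?C2 * (1 + real n * \<phi>') ^ 2 / real n ^ 4"
      using m1(3)[of 1] N by (simp add: \<phi>'_def numeral_eq_Suc)
    also have "\<dots> \<le> ?C2 * (real n * (1 + \<phi>')) ^ 2 / real n ^ 4"
      using N1 \<phi>'0 qc by (intro divide_right_mono mult_left_mono power_mono) (auto simp: algebra_simps)
    also have "\<dots> = ?C2 * (1 + \<phi>')\<^sup>2 / (real n)\<^sup>2"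
      using N by (simp add: power_mult_distrib power2_eq_square power4_eq_xxxx)
    finally show ?thesis .
  qed
  have vd: "expectation (\<lambda>\<omega>'. ?d \<omega>' ^ 4) \<le> \<kappa> 4 / (real n)\<^sup>2"
  proof -
    have "?d \<omega>' ^ 4 = \<bar>row k k \<omega>'\<bar> ^ 4 / (real n)\<^sup>2" for \<omega>'
    proof -
      have "sqrt (real n) ^ 4 = (sqrt (real n) ^ 2) ^ 2" by (simp only: power_mult[symmetric]) simp
      then show ?thesis by (simp add: power_divide power_even_abs)
    qed
    moreover have "expectation (\<lambda>\<omega>'. \<bar>row k k \<omega>'\<bar> ^ 4) \<le> \<kappa> 4"
      unfolding row_def using k by (intro bound_X pair_of_in_pairs)
    ultimately show ?thesis by (simp add: divide_right_mono)
  qed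
  have bd: "expectation (\<lambda>\<omega>'. step_bound n h \<alpha> K k (mix k \<omega>' \<omega>)) \<le>
      walk_potential n h \<alpha> K k (fam \<omega>) + step_error h \<alpha>"
    and int: "integrable M (\<lambda>\<omega>'. step_bound n h \<alpha> K k (mix k \<omega>' \<omega>))"
  proof -
    note X = expectation_potential_bound[OF N h \<alpha>(1) qc qc \<kappa>_nonneg m1(1) m2(1) m3(1) amd
        m2(2)[folded \<phi>'_def] m3(2)[folded \<tau>'_def] v2 v1 vd \<phi>'0(1) \<phi>'\<phi> \<phi>b \<phi>'0(2),
        where T = T and Y = "T - real k / real n", folded K_def]
    show "integrable M (\<lambda>\<omega>'. step_bound n h \<alpha> K k (mix k \<omega>' \<omega>))"
      unfolding sb by (rule X(1))
    show "expectation (\<lambda>\<omega>'. step_bound n h \<alpha> K k (mix k \<omega>' \<omega>)) \<le>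
      walk_potential n h \<alpha> K k (fam \<omega>) + step_error h \<alpha>"
      unfolding sb walk_potential_def step_error_def \<phi>_def[symmetric] T_def[symmetric]
      using X(2) by (simp only: add.assoc)
  qed
  have "(\<integral>\<^sup>+\<omega>'. ennreal (step_bound n h \<alpha> K k (mix k \<omega>' \<omega>)) \<partial>M) =
      ennreal (expectation (\<lambda>\<omega>'. step_bound n h \<alpha> K k (mix k \<omega>' \<omega>)))"
    using int stopped_Suc_le(2)[OF n_pos h k stay' \<alpha>(1) K0 \<alpha>(2)] by (intro nn_integral_eq_integral) auto
  then show ?thesis using bd by (simp add: ennreal_leI)
qed

text \<open>After failure the integrand is the constant 1, so the conditional bound is needed only
  while the walk survives, a condition that resampling row k does not affect.\<close>

lemma nn_integral_stopped_Suc: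
  assumes h: "h > 0" and k: "k < n" and \<alpha>: "\<alpha> \<ge> 0" "\<alpha> * ln (real n powr (1/4)) \<ge> 1"
  defines "K \<equiv> (1 + quadratic_const \<kappa> 0) / h"
  shows "(\<integral>\<^sup>+\<omega>. ennreal (stopped n h \<alpha> K (Suc k) (fam \<omega>)) \<partial>M) \<le>
     (\<integral>\<^sup>+\<omega>. ennreal (stopped n h \<alpha> K k (fam \<omega>)) \<partial>M) + ennreal (step_error h \<alpha>)"
proof -
  define F where "F f = ennreal (if stay n h k f then step_bound n h \<alpha> K k f else 1)" for f
  have K0: "K \<ge> 0" using h quadratic_const_nonneg[OF \<kappa>_nonneg] by (simp add: K_def)
  have k': "k \<le> n" using k by simp
  note [measurable] = measurable_stay[OF k'] measurable_step_bound[OF k] measurable_stopped[OF k']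
    fam_measurable
  have F: "F \<in> borel_measurable (fam_space n)" unfolding F_def[abs_def] by measurable
  have er: "step_error h \<alpha> \<ge> 0" using step_error_nonneg h \<alpha> by simp
  have "(\<integral>\<^sup>+\<omega>. ennreal (stopped n h \<alpha> K (Suc k) (fam \<omega>)) \<partial>M) \<le> (\<integral>\<^sup>+\<omega>. F (fam \<omega>) \<partial>M)"
  proof (rule nn_integral_mono)
    fix \<omega>
    show "ennreal (stopped n h \<alpha> K (Suc k) (fam \<omega>)) \<le> F (fam \<omega>)"
    proof (cases "stay n h k (fam \<omega>)")
      case True
      have "stopped n h \<alpha> K (Suc k) (fam \<omega>) \<le> step_bound n h \<alpha> K k (fam \<omega>)"
        by (rule stopped_Suc_le(1)[OF n_pos h k True \<alpha>(1) K0 \<alpha>(2)])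
      then show ?thesis using True by (simp only: F_def if_True ennreal_leI)
    next
      case False
      then show ?thesis by (simp add: F_def stopped_def)
    qed
  qed
  also have "\<dots> = (\<integral>\<^sup>+\<omega>. (\<integral>\<^sup>+\<omega>'. F (mix k \<omega>' \<omega>) \<partial>M) \<partial>M)"
    by (rule nn_integral_decouple[OF F k])
  also have "\<dots> \<le> (\<integral>\<^sup>+\<omega>. ennreal (stopped n h \<alpha> K k (fam \<omega>)) + ennreal (step_error h \<alpha>) \<partial>M)"
  proof (rule nn_integral_mono)
    fix \<omega>
    have e: "entry n (mix k \<omega>' \<omega>) i j = entry n (fam \<omega>) i j" if "i < k" "j < k" for i j \<omega>'
      using that k by (intro entry_mix_block) auto
    have stay': "stay n h k (mix k \<omega>' \<omega>) = stay n h k (fam \<omega>)" for \<omega>'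
      by (rule stay_cong[OF e])
    show "(\<integral>\<^sup>+\<omega>'. F (mix k \<omega>' \<omega>) \<partial>M) \<le> ennreal (stopped n h \<alpha> K k (fam \<omega>)) + ennreal (step_error h \<alpha>)"
    proof (cases "stay n h k (fam \<omega>)")
      case True
      have "walk_potential n h \<alpha> K k (fam \<omega>) \<ge> 0"
      proof -
        have pd: "pd n (Bmat n (level n h k) (fam \<omega>)) {..<k}" by (rule stay_pd[OF n_pos h k' True])
        show ?thesis
          unfolding walk_potential_def
          using tr_inverse_on_nonneg[OF block_inverse_on[OF n_pos h k' pd] pd] \<alpha> K0
          by (intro potential_nonneg) (auto simp: block_tr_def block_tr2_def)
      qed
      then show ?thesis
        using nn_integral_step_bound_le[OF h k \<alpha> True, folded K_def] True er
        by (simp add: F_def stay' stopped_def ennreal_plus)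
    next
      case False
      then show ?thesis by (simp add: F_def stay' stopped_def emeasure_space_1)
    qed
  qed
  also have "\<dots> = (\<integral>\<^sup>+\<omega>. ennreal (stopped n h \<alpha> K k (fam \<omega>)) \<partial>M) + ennreal (step_error h \<alpha>)"
    by (subst nn_integral_add) (simp_all add: emeasure_space_1)
  finally show ?thesis .
qed

text \<open>Markov's inequality at the value 1. The choice \<alpha> = 4 / ln n gives \<alpha> * ln
  (n powr (1/4)) = 1, and the potential starts at 0 because the empty block has zero traces.\<close>

lemma prob_not_stay:
  assumes h: "h > 0" and n: "n \<ge> 2"
  shows "prob {\<omega> \<in> space M. \<not> stay n h n (fam \<omega>)} \<le> real n * step_error h (4 / ln (real n))"
proof -
  define \<alpha> where "\<alpha> = 4 / ln (real n)"
  define K where "K = (1 + quadratic_const \<kappa> 0) / h"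
  have ln: "ln (real n) > 0" using n by simp
  have \<alpha>: "\<alpha> \<ge> 0" "\<alpha> * ln (real n powr (1/4)) \<ge> 1" using ln n by (auto simp: \<alpha>_def ln_powr)
  have er: "step_error h \<alpha> \<ge> 0" using step_error_nonneg h \<alpha> by simp
  have "(\<integral>\<^sup>+\<omega>. ennreal (stopped n h \<alpha> K k (fam \<omega>)) \<partial>M) \<le> ennreal (real k * step_error h \<alpha>)" if "k \<le> n" for k
    using that
  proof (induction k)
    case 0
    have "stopped n h \<alpha> K 0 f = 0" for f
      by (simp add: stopped_def walk_potential_def potential_def block_tr_def block_tr2_def block_def tr_def mm_def)
    then show ?case by simp
  next
    case (Suc k)
    have "(\<integral>\<^sup>+\<omega>. ennreal (stopped n h \<alpha> K (Suc k) (fam \<omega>)) \<partial>M) \<le>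
        (\<integral>\<^sup>+\<omega>. ennreal (stopped n h \<alpha> K k (fam \<omega>)) \<partial>M) + ennreal (step_error h \<alpha>)"
      unfolding K_def using Suc.prems by (intro nn_integral_stopped_Suc h \<alpha>) simp
    also have "\<dots> \<le> ennreal (real k * step_error h \<alpha>) + ennreal (step_error h \<alpha>)"
      using Suc by (intro add_right_mono) auto
    also have "\<dots> = ennreal (real (Suc k) * step_error h \<alpha>)"
      using er by (simp add: ennreal_plus[symmetric] algebra_simps del: ennreal_plus)
    finally show ?case .
  qed
  then have I: "(\<integral>\<^sup>+\<omega>. ennreal (stopped n h \<alpha> K n (fam \<omega>)) \<partial>M) \<le> ennreal (real n * step_error h \<alpha>)" by simp
  note [measurable] = measurable_stay[OF order_refl, of n h] fam_measurable
  have "ennreal (prob {\<omega> \<in> space M. \<not> stay n h n (fam \<omega>)}) =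
      (\<integral>\<^sup>+\<omega>. indicator {\<omega> \<in> space M. \<not> stay n h n (fam \<omega>)} \<omega> \<partial>M)"
    by (simp add: emeasure_eq_measure)
  also have "\<dots> \<le> (\<integral>\<^sup>+\<omega>. ennreal (stopped n h \<alpha> K n (fam \<omega>)) \<partial>M)"
    by (intro nn_integral_mono) (auto simp: stopped_def indicator_def)
  finally have "ennreal (prob {\<omega> \<in> space M. \<not> stay n h n (fam \<omega>)}) \<le> ennreal (real n * step_error h \<alpha>)"
    using I by (rule order_trans)
  moreover have "0 \<le> real n * step_error h \<alpha>" using er by simp
  ultimately show ?thesis unfolding \<alpha>_def by (subst (asm) ennreal_le_iff)
qed

end

text \<open>The first term is of order 1 / ln n, the second of order 1 / sqrt n.\<close>

lemma step_error_tendsto: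
  fixes c d :: real
  shows "(\<lambda>n. real n * (4 / ln (real n) * c / real n + d * (1 + real n powr (1/4))\<^sup>2 / (real n)\<^sup>2)) \<longlonglongrightarrow> 0"
  by real_asymp

section \<open>The local law\<close>

definition minor :: "nat \<Rightarrow> real \<Rightarrow> nat \<Rightarrow> (nat \<times> nat \<Rightarrow> real) \<Rightarrow> nat \<Rightarrow> nat \<Rightarrow> real" where
  "minor n z i f = res n (Bmat n z f) (filter (\<lambda>j. j \<noteq> i) [0..<n])"

definition full_res :: "nat \<Rightarrow> real \<Rightarrow> (nat \<times> nat \<Rightarrow> real) \<Rightarrow> nat \<Rightarrow> nat \<Rightarrow> real" where
  "full_res n z f = res n (Bmat n z f) (rev [0..<n])"

definition column :: "nat \<Rightarrow> real \<Rightarrow> nat \<Rightarrow> (nat \<times> nat \<Rightarrow> real) \<Rightarrow> nat \<Rightarrow> real" where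
  "column n z i f = (\<lambda>j. - Bmat n z f j i)"

text \<open>What Schur's formula needs in row i: the first two conditions for the diagonal of G, the
  third for the diagonal of G^2, and the linear forms for the off-diagonal entries of G and of
  G^2.\<close>

definition small_deviations :: "nat \<Rightarrow> real \<Rightarrow> real \<Rightarrow> (nat \<times> nat \<Rightarrow> real) \<Rightarrow> bool" where
  "small_deviations n z e f \<longleftrightarrow> (\<forall>i<n. \<bar>entry n f i i\<bar> \<le> e
     \<and> \<bar>form n (minor n z i f) (column n z i f) - tr n (minor n z i f) / real n\<bar> \<le> e
     \<and> \<bar>form n (mm n (minor n z i f) (minor n z i f)) (column n z i f)
          - tr n (mm n (minor n z i f) (minor n z i f)) / real n\<bar> \<le> e
     \<and> (\<forall>j<n. \<bar>mv n (minor n z i f) (column n z i f) j\<bar> \<le> e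
          \<and> \<bar>mv n (mm n (minor n z i f) (minor n z i f)) (column n z i f) j\<bar> \<le> e))"

lemma full_res_inverse_on:
  "pd n (Bmat n z f) {..<n} \<Longrightarrow> inverse_on n (Bmat n z f) {..<n} (full_res n z f)"
  unfolding full_res_def using res_correct(2)[of "Bmat n z f" "rev [0..<n]" n] symm_mat_Bmat[of n z f]
  by (simp add: atLeast0LessThan)

lemma minor_inverse_on:
  assumes "pd n (Bmat n z f) ({..<n} - {i})"
  shows "inverse_on n (Bmat n z f) ({..<n} - {i}) (minor n z i f)"
proof -
  have s: "set (filter (\<lambda>j. j \<noteq> i) [0..<n]) = {..<n} - {i}" by auto
  show ?thesis
    unfolding minor_def using res_correct(2)[of "Bmat n z f" "filter (\<lambda>j. j \<noteq> i) [0..<n]" n] symm_mat_Bmat[of n z f] assms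
    unfolding s by auto
qed

lemma full_res_eq_border:
  assumes pd: "pd n (Bmat n z f) {..<n}" and i: "i < n"
  shows "full_res n z f = border n (Bmat n z f) i (minor n z i f)" "pivot n (Bmat n z f) i (minor n z i f) > 0"
proof -
  let ?S = "{..<n} - {i}"
  have ins: "insert i ?S = {..<n}" using i by auto
  have inv: "inverse_on n (Bmat n z f) ?S (minor n z i f)"
    using pd_mono[OF pd] by (intro minor_inverse_on) auto
  show piv: "pivot n (Bmat n z f) i (minor n z i f) > 0"
    using pd_insert_iff[OF inv symm_mat_Bmat i] pd ins by auto
  have "inverse_on n (Bmat n z f) {..<n} (border n (Bmat n z f) i (minor n z i f))"
    using inverse_on_border[OF inv symm_mat_Bmat i] piv ins by auto
  then show "full_res n z f = border n (Bmat n z f) i (minor n z i f)"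
    using inverse_on_unique[OF full_res_inverse_on[OF pd] _ symm_mat_Bmat] by blast
qed

lemma inverse_on_shift_entry_bounds:
  assumes G: "inverse_on n (shift h B) S G" and pd: "pd n B S" and h: "h > 0" and j: "j < n"
  shows "G j j \<ge> 0" "G j j \<le> 1 / h" "mm n G G j j \<ge> 0" "mm n G G j j \<le> 1 / h\<^sup>2"
    "(\<Sum>k<n. (G j k)\<^sup>2) = mm n G G j j"
proof -
  have sG: "symm_mat G" using G inverse_onD(2) by auto
  have pd': "pd n (shift h B) S" using pd h by (intro pd_shift) auto
  have e1: "dot n (unit_vec_at j) (unit_vec_at j) = 1"
    using j by (simp add: dot_unit_vec_at) (simp add: unit_vec_at_def)
  have eG: "form n A (unit_vec_at j) = A j j" for A
    using j by (simp add: form_def dot_commute[of n "unit_vec_at j"] dot_unit_vec_at mv_unit_vec_at)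
  show "G j j \<ge> 0" using inverse_on_form_nonneg[OF G pd', of "unit_vec_at j"] eG by simp
  show "G j j \<le> 1 / h" using inverse_on_shift_bound(2)[OF G pd h, of "unit_vec_at j"] eG e1 by simp
  have GG: "mm n G G j j = dot n (mv n G (unit_vec_at j)) (mv n G (unit_vec_at j))"
    using eG[of "mm n G G"] form_mm_self[OF sG] by simp
  then show "mm n G G j j \<ge> 0" by (simp add: dot_self_nonneg)
  show "mm n G G j j \<le> 1 / h\<^sup>2" using inverse_on_shift_bound(1)[OF G pd h, of "unit_vec_at j"] GG e1 by simp
  show "(\<Sum>k<n. (G j k)\<^sup>2) = mm n G G j j"
    using sG unfolding mm_def symm_mat_def power2_eq_square by (intro sum.cong refl) simp
qed

lemma tr_divide_le:
  assumes "n > 0" "\<And>j. j < n \<Longrightarrow> A j j \<le> c"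
  shows "tr n A / real n \<le> c"
proof -
  have "tr n A \<le> (\<Sum>j<n. c)" unfolding tr_def using assms by (intro sum_mono) auto
  then show ?thesis using assms by (simp add: pos_divide_le_eq mult.commute)
qed

lemma tr_divide_abs_le:
  assumes "n > 0" "\<And>j. j < n \<Longrightarrow> \<bar>A j j - a\<bar> \<le> c"
  shows "\<bar>tr n A / real n - a\<bar> \<le> c"
proof -
  have "\<bar>tr n A - real n * a\<bar> = \<bar>\<Sum>j<n. (A j j - a)\<bar>" by (simp add: tr_def sum_subtractf)
  also have "\<dots> \<le> (\<Sum>j<n. \<bar>A j j - a\<bar>)" by (rule sum_abs)
  also have "\<dots> \<le> (\<Sum>j<n. c)" using assms by (intro sum_mono) auto
  finally have "\<bar>tr n A - real n * a\<bar> \<le> real n * c" by simp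
  moreover have "tr n A / real n - a = (tr n A - real n * a) / real n" using assms by (simp add: field_simps)
  ultimately show ?thesis using assms by (simp add: pos_divide_le_eq mult.commute)
qed

text \<open>Deterministic: one sample f on the good event. Definiteness at lam - h bounds every
  resolvent at lam by 1 / h. The number m stands for the Cauchy transform at lam, and \<delta>
  dominates both the deviations e and the cost 1 / n of passing to a minor.\<close>

locale local_law =
  fixes n :: nat and h lam m e \<delta> :: real and f :: "nat \<times> nat \<Rightarrow> real"
  assumes n: "n > 0" and h: "h > 0" and lam: "lam = 2 + 4 * h"
    and m: "0 < m" "m < 1" "m * (lam - m) = 1"
    and pd: "pd n (Bmat n (lam - h) f) {..<n}"
    and tr_le: "tr n (full_res n lam f) / real n \<le> 1 + h"
    and dev: "small_deviations n lam e f"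
    and e: "0 \<le> e" "e \<le> 1" "e \<le> \<delta>" and n\<delta>: "1 / real n \<le> \<delta>"
begin

abbreviation "B \<equiv> Bmat n lam f"
abbreviation "G \<equiv> full_res n lam f"
abbreviation "mnr i \<equiv> minor n lam i f"
abbreviation "cvec i \<equiv> column n lam i f"

definition "T = tr n G / real n"
definition "Q = tr n (mm n G G) / real n"
text \<open>\<open>c1\<close> bounds tr G minus the trace of a minor: lam + 1 bounds the pivot and 1
  / h^2 the diagonal of G^2. \<open>c2\<close> bounds the same difference for the traces of the
  squares.\<close>

definition "c1 = (lam + 1) / h\<^sup>2"
definition "c2 = 2 * c1 / h + c1\<^sup>2"

lemma \<delta>0: "\<delta> \<ge> 0" using e by linarith

lemma B_eq: "B = shift h (Bmat n (lam - h) f)"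
  using Bmat_shift[of n "lam - h" h f] by simp

lemma pdB: "pd n B {..<n}"
  unfolding B_eq using pd h by (intro pd_shift) auto

lemma inv_G: "inverse_on n B {..<n} G"
  by (rule full_res_inverse_on[OF pdB])

lemma inv_minor: "inverse_on n B ({..<n} - {i}) (mnr i)" "pd n (Bmat n (lam - h) f) ({..<n} - {i})"
  "pd n B ({..<n} - {i})"
  using pd_mono[OF pdB, of "{..<n} - {i}"] pd_mono[OF pd, of "{..<n} - {i}"] by (auto intro!: minor_inverse_on)

lemma T_bounds: "0 \<le> T" "T \<le> 1 + h" "T \<le> 1 / h"
proof -
  note G = inverse_on_shift_entry_bounds[OF _ pd h, of G]
  have I: "inverse_on n (shift h (Bmat n (lam - h) f)) {..<n} G" using inv_G B_eq by simp
  show "0 \<le> T" unfolding T_def tr_def using G(1)[OF I] by (intro divide_nonneg_nonneg sum_nonneg) auto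
  show "T \<le> 1 + h" using tr_le by (simp add: T_def)
  show "T \<le> 1 / h" unfolding T_def using G(2)[OF I] n by (intro tr_divide_le) auto
qed

lemma G_bounds:
  assumes "j < n"
  shows "0 \<le> G j j" "G j j \<le> 1 / h" "0 \<le> mm n G G j j" "mm n G G j j \<le> 1 / h\<^sup>2"
proof -
  have I: "inverse_on n (shift h (Bmat n (lam - h) f)) {..<n} G" using inv_G B_eq by simp
  show "0 \<le> G j j" "G j j \<le> 1 / h" "0 \<le> mm n G G j j" "mm n G G j j \<le> 1 / h\<^sup>2"
    using inverse_on_shift_entry_bounds[OF I pd h assms] by auto
qed

lemma Q_bounds: "0 \<le> Q" "Q \<le> 1 / h\<^sup>2"
proof -
  show "0 \<le> Q" unfolding Q_def tr_def using G_bounds by (intro divide_nonneg_nonneg sum_nonneg) auto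
  show "Q \<le> 1 / h\<^sup>2" unfolding Q_def using G_bounds n by (intro tr_divide_le) auto
qed

lemma lam_T: "lam - T \<ge> 1" using T_bounds(2) lam h by simp

context
  fixes i assumes i: "i < n"
begin

definition "u = border_vec n B i (mnr i)"
definition "s = pivot n B i (mnr i)"
definition "w = dot n u u / s"

lemma iS: "i \<notin> {..<n} - {i}" by simp

lemma s_pos: "s > 0" using full_res_eq_border(2)[OF pdB i] by (simp add: s_def)

lemma G_eq: "G a b = mnr i a b + u a * u b / s"
  unfolding full_res_eq_border(1)[OF pdB i] by (simp add: border_def u_def s_def)

lemma u_i: "u i = 1" by (simp add: u_def border_vec_def)

lemma u_other: "j \<noteq> i \<Longrightarrow> u j = mv n (mnr i) (cvec i) j"
  by (simp add: u_def border_vec_def column_def)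

lemma minor_i: "mnr i i j = 0" "mnr i j i = 0"
  using inverse_onD(3,4)[OF inv_minor(1)] by auto

lemma G_row: "G i j = u j / s"
  using G_eq[of i j] by (simp add: u_i minor_i)

lemma G_ii: "G i i = 1 / s" by (simp add: G_row u_i)

lemma symm_minor: "symm_mat (mnr i)" using inverse_onD(2)[OF inv_minor(1)] .

lemma mv_minor_u: "mv n (mnr i) u j = mv n (mm n (mnr i) (mnr i)) (cvec i) j"
proof -
  have "mv n (mnr i) u j = mv n (mnr i) (mv n (mnr i) (cvec i)) j"
    unfolding mv_def[of n "mnr i" u] mv_def[of n "mnr i" "mv n (mnr i) (cvec i)"]
  proof (intro sum.cong refl)
    fix k show "mnr i j k * u k = mnr i j k * mv n (mnr i) (cvec i) k"
      using u_other[of k] by (cases "k = i") (auto simp: minor_i)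
  qed
  then show ?thesis by (simp add: mv_mm)
qed

text \<open>Row i of G is u / s and G is the minor plus a rank-one term; the minor applied to u is a
  linear form of the squared minor, and the rank-one term contributes w times u.\<close>

lemma GG_row: "mm n G G i j = (mv n (mm n (mnr i) (mnr i)) (cvec i) j + w * u j) / s"
proof -
  have "mm n G G i j = (\<Sum>k<n. (mnr i j k * u k + (u k * u k) * (u j / s)) / s)"
    unfolding mm_def using symm_minor unfolding symm_mat_def
    by (intro sum.cong refl) (simp add: G_row G_eq[of _ j] algebra_simps add_divide_distrib)
  also have "\<dots> = (mv n (mnr i) u j + dot n u u * (u j / s)) / s"
    by (simp add: mv_def dot_def sum.distrib sum_distrib_right sum_divide_distrib[symmetric])
  finally show ?thesis by (simp add: mv_minor_u w_def)
qed

lemma dev_i: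
  "\<bar>entry n f i i\<bar> \<le> e" "\<bar>form n (mnr i) (cvec i) - tr n (mnr i) / real n\<bar> \<le> e"
  "\<bar>form n (mm n (mnr i) (mnr i)) (cvec i) - tr n (mm n (mnr i) (mnr i)) / real n\<bar> \<le> e"
  "\<And>j. j < n \<Longrightarrow> \<bar>mv n (mnr i) (cvec i) j\<bar> \<le> e"
  "\<And>j. j < n \<Longrightarrow> \<bar>mv n (mm n (mnr i) (mnr i)) (cvec i) j\<bar> \<le> e"
  using dev i unfolding small_deviations_def by blast+

lemma uu: "dot n u u = 1 + form n (mm n (mnr i) (mnr i)) (cvec i)"
  "form n (mnr i) u = form n (mm n (mnr i) (mm n (mnr i) (mnr i))) (cvec i)"
  unfolding u_def column_def by (rule border_vec_dot[OF inv_minor(1) i iS])+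

lemma s_eq: "s = lam - entry n f i i - form n (mnr i) (cvec i)"
  by (simp add: s_def pivot_def Bmat_def column_def)

lemma form_minor_nonneg: "form n (mnr i) x \<ge> 0"
  by (rule inverse_on_form_nonneg[OF inv_minor(1,3)])

lemma GG_ii: "mm n G G i i = dot n u u / s\<^sup>2"
proof -
  have "mv n (mm n (mnr i) (mnr i)) (cvec i) i = 0"
    by (simp add: mv_mm) (simp add: mv_def minor_i)
  then show ?thesis by (simp add: GG_row w_def u_i power2_eq_square)
qed

text \<open>Writing \<open>w = s * mm n G G i i\<close> replaces the division by the pivot by upper
  bounds on both factors.\<close>

lemma w_bounds: "0 \<le> w" "w \<le> c1"
proof -
  show "0 \<le> w" using s_pos dot_self_nonneg by (simp add: w_def)
  have "w = s * mm n G G i i" using s_pos by (simp add: GG_ii w_def power2_eq_square)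
  also have "\<dots> \<le> (lam + 1) * (1 / h\<^sup>2)"
    using dev_i(1) e form_minor_nonneg[of "cvec i"] s_eq s_pos G_bounds(3,4)[OF i] lam h
    by (intro mult_mono) auto
  finally show "w \<le> c1" by (simp add: c1_def)
qed

lemma tr_diff: "0 \<le> T - tr n (mnr i) / n" "T - tr n (mnr i) / n \<le> c1 * \<delta>"
proof -
  have "tr n G = tr n (mnr i) + w"
    using tr_rank_one[of n "mnr i" u s] G_eq by (simp add: w_def tr_def)
  then have eq: "T - tr n (mnr i) / n = w * (1 / n)" by (simp add: T_def diff_divide_distrib[symmetric])
  show "0 \<le> T - tr n (mnr i) / n" using w_bounds by (simp add: eq)
  show "T - tr n (mnr i) / n \<le> c1 * \<delta>"
    unfolding eq using w_bounds n\<delta> by (intro mult_mono) auto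
qed

lemma form_minor_u_le: "form n (mnr i) u \<le> dot n u u / h"
proof -
  have I: "inverse_on n (shift h (Bmat n (lam - h) f)) ({..<n} - {i}) (mnr i)" using inv_minor(1) B_eq by simp
  show ?thesis by (rule inverse_on_shift_bound(2)[OF I inv_minor(2) h])
qed

text \<open>Besides w^2 the rank-one update adds a cross term, which the bound 1 / h on the minor
  turns into a multiple of w.\<close>

lemma tr2_diff: "0 \<le> Q - tr n (mm n (mnr i) (mnr i)) / n" "Q - tr n (mm n (mnr i) (mnr i)) / n \<le> c2 * \<delta>"
proof -
  let ?x = "2 / s * form n (mnr i) u + w\<^sup>2"
  have "G = (\<lambda>a b. mnr i a b + u a * u b / s)" by (intro ext G_eq)
  then have "tr n (mm n G G) = tr n (mm n (mnr i) (mnr i)) + ?x"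
    using tr_square_rank_one[OF symm_minor, of n u s] by (simp add: w_def)
  then have eq: "Q - tr n (mm n (mnr i) (mnr i)) / n = ?x * (1 / n)"
    by (simp add: Q_def diff_divide_distrib[symmetric])
  have x0: "0 \<le> ?x" using s_pos form_minor_nonneg by simp
  then show "0 \<le> Q - tr n (mm n (mnr i) (mnr i)) / n" by (simp add: eq)
  have "2 / s * form n (mnr i) u \<le> 2 / s * (dot n u u / h)"
    using form_minor_u_le s_pos by (intro mult_left_mono) auto
  also have "\<dots> = 2 * w / h" by (simp add: w_def)
  also have "\<dots> \<le> 2 * c1 / h" using w_bounds h by (intro divide_right_mono) auto
  finally have "2 / s * form n (mnr i) u \<le> 2 * c1 / h" .
  moreover have "w\<^sup>2 \<le> c1\<^sup>2" using w_bounds by (intro power_mono)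
  ultimately have "?x \<le> c2" by (simp add: c2_def)
  then show "Q - tr n (mm n (mnr i) (mnr i)) / n \<le> c2 * \<delta>"
    unfolding eq using x0 n\<delta> by (intro mult_mono) auto
qed

text \<open>The self-consistent equation: 1 / G i i is the pivot, which is lam minus the normalised
  trace of the minor up to two deviations, and that trace is within c1 * \<delta> of T.\<close>

lemma G_ii_approx: "\<bar>G i i * (lam - T) - 1\<bar> \<le> (2 + c1) / h * \<delta>"
proof -
  have "\<bar>lam - T - s\<bar> \<le> (2 + c1) * \<delta>"
    using dev_i(1,2) tr_diff s_eq e by (simp add: algebra_simps)
  moreover have "G i i * (lam - T) - 1 = G i i * (lam - T - s)" using s_pos by (simp add: G_ii field_simps)
  ultimately have "\<bar>G i i * (lam - T) - 1\<bar> \<le> G i i * ((2 + c1) * \<delta>)"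
    using G_bounds(1)[OF i] by (simp add: abs_mult mult_left_mono)
  also have "\<dots> \<le> 1 / h * ((2 + c1) * \<delta>)"
    using G_bounds(2)[OF i] w_bounds \<delta>0 by (intro mult_right_mono) auto
  finally show ?thesis by simp
qed

lemma G_off_diagonal:
  assumes "j < n" "j \<noteq> i"
  shows "\<bar>G i j\<bar> \<le> 1 / h * \<delta>"
proof -
  have "G i j = G i i * u j" unfolding G_ii by (simp add: G_row)
  then have "\<bar>G i j\<bar> = G i i * \<bar>u j\<bar>" using G_bounds(1)[OF i] by (simp add: abs_mult)
  also have "\<dots> \<le> 1 / h * \<delta>"
    using G_bounds[OF i] dev_i(4)[OF assms(1)] e h by (intro mult_mono) (auto simp: u_other[OF assms(2)])
  finally show ?thesis .
qed

lemma GG_off_diagonal: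
  assumes "j < n" "j \<noteq> i"
  shows "\<bar>mm n G G i j\<bar> \<le> (1 + c1) / h * \<delta>"
proof -
  let ?v = "mv n (mm n (mnr i) (mnr i)) (cvec i) j"
  have "mm n G G i j = G i i * (?v + w * u j)" unfolding G_ii by (simp add: GG_row)
  then have "\<bar>mm n G G i j\<bar> = G i i * \<bar>?v + w * u j\<bar>" using G_bounds(1)[OF i] by (simp add: abs_mult)
  also have "\<bar>?v + w * u j\<bar> \<le> \<delta> + c1 * \<delta>"
  proof (rule order_trans[OF abs_triangle_ineq], rule add_mono)
    show "\<bar>?v\<bar> \<le> \<delta>" using dev_i(5)[OF assms(1)] e by linarith
    have "\<bar>u j\<bar> \<le> \<delta>" using dev_i(4)[OF assms(1)] e u_other[OF assms(2)] by simp
    then show "\<bar>w * u j\<bar> \<le> c1 * \<delta>" unfolding abs_mult using w_bounds by (intro mult_mono) auto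
  qed
  then have "G i i * \<bar>?v + w * u j\<bar> \<le> 1 / h * (\<delta> + c1 * \<delta>)"
    using G_bounds[OF i] h by (intro mult_mono) auto
  finally show ?thesis by (simp add: algebra_simps add_divide_distrib)
qed

lemma GG_ii_eq: "mm n G G i i = (G i i)\<^sup>2 * (1 + form n (mm n (mnr i) (mnr i)) (cvec i))"
  by (simp add: GG_ii G_ii uu power_divide)

lemma form2_approx: "\<bar>form n (mm n (mnr i) (mnr i)) (cvec i) - Q\<bar> \<le> (1 + c2) * \<delta>"
  using dev_i(3) tr2_diff e by (simp add: algebra_simps)

end

lemma c_nonneg: "c1 \<ge> 0" "c2 \<ge> 0"
proof -
  show "c1 \<ge> 0" using lam h unfolding c1_def by (intro divide_nonneg_nonneg) auto
  then show "c2 \<ge> 0" using h unfolding c2_def by simp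
qed

text \<open>Error constants along the chain: \<open>k1\<close> for the self-consistent equation,
  \<open>k2\<close> for T - m, \<open>k3\<close> for G i i - m, \<open>k4\<close> for the diagonal
  of G^2 against m^2 (1 + Q), \<open>k5\<close> for the centred square.\<close>

definition "k1 = (2 + c1) / h"
definition "k2 = k1 / (3 * h)"
definition "k3 = 2 * k1 + k2"
definition "k4 = k3 * (1 / h + 1) * (1 + 1 / h\<^sup>2) + (1 + c2) / h\<^sup>2"
definition "k5 = 2 * k4 + k4 / (1 - m\<^sup>2) + 2 * (1 + h) * (2 * k1) + (2 + h) * k2"

lemma k_nonneg: "k1 \<ge> 0" "k2 \<ge> 0" "k3 \<ge> 0" "k4 \<ge> 0"
  using c_nonneg h by (auto simp: k1_def k2_def k3_def k4_def intro!: add_nonneg_nonneg mult_nonneg_nonneg)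

lemma T_quadratic: "\<bar>T * (lam - T) - 1\<bar> \<le> k1 * \<delta>"
proof -
  have "\<bar>tr n (\<lambda>a b. G a b * (lam - T)) / real n - 1\<bar> \<le> k1 * \<delta>"
    using G_ii_approx n by (intro tr_divide_abs_le) (auto simp: k1_def)
  moreover have "tr n (\<lambda>a b. G a b * (lam - T)) / real n = T * (lam - T)"
    by (simp add: T_def tr_def sum_distrib_right)
  ultimately show ?thesis by simp
qed

text \<open>Stability: the difference of the two quadratic expressions factors as (T - m) * (lam - T
  - m). The a priori bound T \<le> 1 + h rules out the larger root, keeping the second factor at
  least 3 * h.\<close>

lemma T_approx: "\<bar>T - m\<bar> \<le> k2 * \<delta>"
proof -
  have "(T - m) * (lam - T - m) = T * (lam - T) - m * (lam - m)" by (simp add: algebra_simps)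
  then have "\<bar>T - m\<bar> * \<bar>lam - T - m\<bar> = \<bar>T * (lam - T) - 1\<bar>" using m by (simp add: abs_mult[symmetric])
  moreover have "3 * h \<le> \<bar>lam - T - m\<bar>" using T_bounds(2) m lam by simp
  then have "\<bar>T - m\<bar> * (3 * h) \<le> \<bar>T - m\<bar> * \<bar>lam - T - m\<bar>" by (intro mult_left_mono) auto
  ultimately have "\<bar>T - m\<bar> * (3 * h) \<le> k1 * \<delta>" using T_quadratic by linarith
  then show ?thesis using h by (simp add: k2_def pos_le_divide_eq)
qed

lemma G_diagonal: "i < n \<Longrightarrow> \<bar>G i i - T\<bar> \<le> 2 * k1 * \<delta>"
proof -
  assume i: "i < n"
  have "(G i i - T) * (lam - T) = (G i i * (lam - T) - 1) - (T * (lam - T) - 1)" by (simp add: algebra_simps)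
  then have "\<bar>G i i - T\<bar> * \<bar>lam - T\<bar> = \<bar>(G i i * (lam - T) - 1) - (T * (lam - T) - 1)\<bar>"
    by (simp only: abs_mult[symmetric])
  also have "\<dots> \<le> 2 * k1 * \<delta>" using G_ii_approx[OF i, folded k1_def] T_quadratic by linarith
  finally have 1: "\<bar>G i i - T\<bar> * \<bar>lam - T\<bar> \<le> 2 * k1 * \<delta>" .
  have "\<bar>G i i - T\<bar> * 1 \<le> \<bar>G i i - T\<bar> * \<bar>lam - T\<bar>" using lam_T by (intro mult_left_mono) auto
  from order_trans[OF this 1] show ?thesis by simp
qed

lemma GG_diagonal: "i < n \<Longrightarrow> \<bar>mm n G G i i - m\<^sup>2 * (1 + Q)\<bar> \<le> k4 * \<delta>"
proof -
  assume i: "i < n"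
  let ?\<xi> = "form n (mm n (mnr i) (mnr i)) (cvec i)"
  have 3: "\<bar>G i i - m\<bar> \<le> k3 * \<delta>" using G_diagonal[OF i] T_approx by (simp add: k3_def algebra_simps)
  have "mm n G G i i - m\<^sup>2 * (1 + Q) = (G i i - m) * (G i i + m) * (1 + Q) + (G i i)\<^sup>2 * (?\<xi> - Q)"
    unfolding GG_ii_eq[OF i] by (simp add: power2_eq_square algebra_simps)
  also have "\<bar>\<dots>\<bar> \<le> k3 * \<delta> * (1 / h + 1) * (1 + 1 / h\<^sup>2) + (1 / h)\<^sup>2 * ((1 + c2) * \<delta>)"
  proof (rule order_trans[OF abs_triangle_ineq], rule add_mono)
    show "\<bar>(G i i - m) * (G i i + m) * (1 + Q)\<bar> \<le> k3 * \<delta> * (1 / h + 1) * (1 + 1 / h\<^sup>2)"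
      unfolding abs_mult using 3 G_bounds[OF i] m Q_bounds k_nonneg \<delta>0 h by (intro mult_mono) auto
    show "\<bar>(G i i)\<^sup>2 * (?\<xi> - Q)\<bar> \<le> (1 / h)\<^sup>2 * ((1 + c2) * \<delta>)"
      unfolding abs_mult using form2_approx[OF i] G_bounds[OF i] c_nonneg h
      by (intro mult_mono) (auto intro!: power_mono)
  qed
  also have "\<dots> = k4 * \<delta>" by (simp add: k4_def algebra_simps power_divide add_divide_distrib)
  finally show ?thesis .
qed

text \<open>Averaging the diagonal approximation gives Q = m^2 (1 + Q) up to error, a linear
  equation that is solvable because m < 1.\<close>

lemma Q_approx: "\<bar>Q - m\<^sup>2 / (1 - m\<^sup>2)\<bar> \<le> k4 / (1 - m\<^sup>2) * \<delta>"
proof -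
  have m2: "1 - m\<^sup>2 > 0" using m by (simp add: power_less_one_iff)
  have "\<bar>Q - m\<^sup>2 * (1 + Q)\<bar> \<le> k4 * \<delta>"
    unfolding Q_def[of] using GG_diagonal n unfolding Q_def by (intro tr_divide_abs_le) auto
  moreover have "Q - m\<^sup>2 / (1 - m\<^sup>2) = (Q - m\<^sup>2 * (1 + Q)) / (1 - m\<^sup>2)" using m2 by (simp add: field_simps)
  ultimately show ?thesis using m2 by (simp add: divide_right_mono)
qed

text \<open>The diagonal of (G - T)^2. Since G i i is close to T, centring subtracts about T^2,
  hence m^2, from Q.\<close>

lemma centred_square_diagonal:
  assumes i: "i < n"
  shows "\<bar>(mm n G G i i - 2 * T * G i i + T\<^sup>2) - (m\<^sup>2 / (1 - m\<^sup>2) - m\<^sup>2)\<bar> \<le> k5 * \<delta>"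
proof -
  have "\<bar>Q - m\<^sup>2 * (1 + Q)\<bar> \<le> k4 * \<delta>"
    using GG_diagonal n unfolding Q_def by (intro tr_divide_abs_le) auto
  then have 1: "\<bar>mm n G G i i - Q\<bar> \<le> 2 * k4 * \<delta>" using GG_diagonal[OF i] by linarith
  have 2: "\<bar>2 * T * (G i i - T)\<bar> \<le> 2 * (1 + h) * (2 * k1 * \<delta>)"
    unfolding abs_mult using T_bounds G_diagonal[OF i] by (intro mult_mono) auto
  have 3: "\<bar>(T + m) * (T - m)\<bar> \<le> (2 + h) * (k2 * \<delta>)"
    unfolding abs_mult using T_bounds T_approx m by (intro mult_mono) auto
  have "(mm n G G i i - 2 * T * G i i + T\<^sup>2) - (m\<^sup>2 / (1 - m\<^sup>2) - m\<^sup>2) =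
      (mm n G G i i - Q) + (Q - m\<^sup>2 / (1 - m\<^sup>2)) - 2 * T * (G i i - T) - (T + m) * (T - m)"
    by (simp add: algebra_simps power2_eq_square)
  moreover have "k5 * \<delta> = 2 * k4 * \<delta> + k4 / (1 - m\<^sup>2) * \<delta> + 2 * (1 + h) * (2 * k1 * \<delta>) + (2 + h) * (k2 * \<delta>)"
    by (simp add: k5_def algebra_simps)
  ultimately show ?thesis using 1 2 3 Q_approx by linarith
qed

lemma centred_square_off_diagonal:
  assumes "i < n" "j < n" "i \<noteq> j"
  shows "\<bar>mm n G G i j - 2 * T * G i j\<bar> \<le> ((1 + c1) / h + 2 * (1 + h) * (1 / h)) * \<delta>"
proof -
  have "\<bar>2 * T * G i j\<bar> \<le> 2 * (1 + h) * (1 / h * \<delta>)"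
    unfolding abs_mult using T_bounds G_off_diagonal[OF assms(1,2)] assms(3) by (intro mult_mono) auto
  moreover have "\<bar>mm n G G i j\<bar> \<le> (1 + c1) / h * \<delta>" using GG_off_diagonal[OF assms(1,2)] assms(3) by auto
  ultimately have "\<bar>mm n G G i j - 2 * T * G i j\<bar> \<le> (1 + c1) / h * \<delta> + 2 * (1 + h) * (1 / h * \<delta>)" by linarith
  then show ?thesis by (simp only: distrib_right mult.assoc)
qed

end

text \<open>The constants of the locale depend on h, lam and m only, so a single C is fixed before
  n, e and f; \<delta> is taken to be e + 1 / n.\<close>

lemma local_law_bounds:
  fixes h lam m :: real
  assumes h: "h > 0" and lam: "lam = 2 + 4 * h" and m: "0 < m" "m < 1" "m * (lam - m) = 1"
  obtains C where "C > 0"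
    and "\<And>n e f i j. \<lbrakk>n > 0; pd n (Bmat n (lam - h) f) {..<n}; tr n (full_res n lam f) / real n \<le> 1 + h;
      small_deviations n lam e f; 0 \<le> e; e \<le> 1; i < n; j < n\<rbrakk> \<Longrightarrow>
      let G = full_res n lam f; T = tr n G / real n; A = \<lambda>a b. G a b - (if a = b then T else 0);
        AA = \<lambda>a b. mm n G G a b - 2 * T * G a b + (if a = b then T\<^sup>2 else 0) in
      \<bar>A i j\<bar> \<le> C * (e + 1 / real n) \<and>
      (if i = j then \<bar>AA i i - (m\<^sup>2 / (1 - m\<^sup>2) - m\<^sup>2)\<bar> \<le> C * (e + 1 / real n)
       else \<bar>AA i j\<bar> \<le> C * (e + 1 / real n))"
proof -
  define a where "a = 2 * local_law.k1 h lam"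
  define b where "b = 1 / h"
  define c where "c = (1 + local_law.c1 h lam) / h + 2 * (1 + h) * (1 / h)"
  define d where "d = local_law.k5 h lam m"
  define C where "C = 1 + \<bar>a\<bar> + \<bar>b\<bar> + \<bar>c\<bar> + \<bar>d\<bar>"
  have C: "C > 0" "a \<le> C" "b \<le> C" "c \<le> C" "d \<le> C" by (auto simp: C_def)
  show thesis
  proof (rule that[OF C(1)])
    fix n e f i j
    assume n: "n > 0" and pd: "pd n (Bmat n (lam - h) f) {..<n}"
      and t: "tr n (full_res n lam f) / real n \<le> 1 + h"
      and dev: "small_deviations n lam e f" and e: "0 \<le> e" "e \<le> 1" and ij: "i < n" "j < n"
    let ?\<delta> = "e + 1 / real n"
    interpret local_law n h lam m e ?\<delta> f
      by unfold_locales (use n h lam m pd t dev e in auto)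
    have \<delta>: "?\<delta> \<ge> 0" using e by simp
    have le: "x * ?\<delta> \<le> C * ?\<delta>" if "x \<le> C" for x using that \<delta> by (rule mult_right_mono)
    have 1: "\<bar>G i i - T\<bar> \<le> C * ?\<delta>" using G_diagonal[OF ij(1)] le[OF C(2)] by (simp add: a_def)
    have 2: "\<bar>G i j\<bar> \<le> C * ?\<delta>" "\<bar>mm n G G i j - 2 * T * G i j\<bar> \<le> C * ?\<delta>" if "i \<noteq> j"
      using G_off_diagonal[OF ij] centred_square_off_diagonal[OF ij that] le[OF C(3)] le[OF C(4)] that
      by (auto simp: b_def c_def)
    have 3: "\<bar>(mm n G G i i - 2 * T * G i i + T\<^sup>2) - (m\<^sup>2 / (1 - m\<^sup>2) - m\<^sup>2)\<bar> \<le> C * ?\<delta>"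
      using centred_square_diagonal[OF ij(1)] le[OF C(5)] by (simp add: d_def)
    show "let G = full_res n lam f; T = tr n G / real n; A = \<lambda>a b. G a b - (if a = b then T else 0);
        AA = \<lambda>a b. mm n G G a b - 2 * T * G a b + (if a = b then T\<^sup>2 else 0) in
      \<bar>A i j\<bar> \<le> C * (e + 1 / real n) \<and>
      (if i = j then \<bar>AA i i - (m\<^sup>2 / (1 - m\<^sup>2) - m\<^sup>2)\<bar> \<le> C * (e + 1 / real n)
       else \<bar>AA i j\<bar> \<le> C * (e + 1 / real n))"
      using 1 2 3 unfolding Let_def T_def[symmetric] by auto
  qed
qed

section \<open>Probability of large deviations in a row\<close>

definition minor_pd :: "nat \<Rightarrow> real \<Rightarrow> nat \<Rightarrow> (nat \<times> nat \<Rightarrow> real) \<Rightarrow> bool" where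
  "minor_pd n z i f \<longleftrightarrow> pivots_pos n (Bmat n z f) (filter (\<lambda>j. j \<noteq> i) [0..<n])"

lemma minor_pd_iff: "minor_pd n z i f \<longleftrightarrow> pd n (Bmat n z f) ({..<n} - {i})"
proof -
  have s: "set (filter (\<lambda>j. j \<noteq> i) [0..<n]) = {..<n} - {i}" by auto
  show ?thesis
    unfolding minor_pd_def using res_correct(1)[OF symm_mat_Bmat, of "filter (\<lambda>j. j \<noteq> i) [0..<n]"]
    unfolding s by auto
qed

text \<open>The norm bound 1 / h is applied twice to a unit vector.\<close>

lemma mm_self_row_square_le:
  assumes G: "inverse_on n (shift h B) S G" and pd: "pd n B S" and h: "h > 0" and j: "j < n"
  shows "(\<Sum>k<n. (mm n G G j k)\<^sup>2) \<le> 1 / h ^ 4"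
proof -
  have sG: "symm_mat G" using G inverse_onD(2) by auto
  let ?e = "unit_vec_at j"
  have e1: "dot n ?e ?e = 1" using j by (simp add: dot_unit_vec_at) (simp add: unit_vec_at_def)
  have "(\<Sum>k<n. (mm n G G j k)\<^sup>2) = dot n (mv n G (mv n G ?e)) (mv n G (mv n G ?e))"
    unfolding dot_def mv_mm[symmetric] using j symm_mat_mm_self[OF sG, of n] unfolding symm_mat_def
    by (intro sum.cong refl) (simp add: mv_unit_vec_at power2_eq_square)
  also have "\<dots> \<le> dot n (mv n G ?e) (mv n G ?e) / h\<^sup>2" by (rule inverse_on_shift_bound(1)[OF G pd h])
  also have "\<dots> \<le> (1 / h\<^sup>2) / h\<^sup>2"
    using inverse_on_shift_bound(1)[OF G pd h, of ?e] e1 by (intro divide_right_mono) auto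
  also have "\<dots> = 1 / h ^ 4" by (simp add: power2_eq_square power4_eq_xxxx)
  finally show ?thesis .
qed

context wigner
begin

text \<open>Markov's inequality for an even moment over the resampled row. The event
  \<open>Ev\<close> must not look at row k, which is why positivity of a minor is later used in
  place of positivity of the whole matrix.\<close>

lemma prob_deviation_le:
  assumes k: "k < n" and Ev: "Measurable.pred (fam_space n) Ev" and st: "st \<in> borel_measurable (fam_space n)"
    and mixEv: "\<And>\<omega> \<omega>'. Ev (mix k \<omega>' \<omega>) = Ev (fam \<omega>)"
    and mom: "\<And>\<omega>. Ev (fam \<omega>) \<Longrightarrow> all_moments M (\<lambda>\<omega>'. st (mix k \<omega>' \<omega>)) \<and>
      expectation (\<lambda>\<omega>'. st (mix k \<omega>' \<omega>) ^ (2 * q)) \<le> C"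
    and e: "e > 0" and C: "C \<ge> 0"
  shows "prob {\<omega> \<in> space M. Ev (fam \<omega>) \<and> \<not> \<bar>st (fam \<omega>)\<bar> \<le> e} \<le> C / e ^ (2 * q)"
proof -
  define F where "F f = ennreal (if Ev f then (st f / e) ^ (2 * q) else 0)" for f
  note [measurable] = Ev st fam_measurable
  have F: "F \<in> borel_measurable (fam_space n)" unfolding F_def[abs_def] by measurable
  have "ennreal (prob {\<omega> \<in> space M. Ev (fam \<omega>) \<and> \<not> \<bar>st (fam \<omega>)\<bar> \<le> e}) =
      (\<integral>\<^sup>+\<omega>. indicator {\<omega> \<in> space M. Ev (fam \<omega>) \<and> \<not> \<bar>st (fam \<omega>)\<bar> \<le> e} \<omega> \<partial>M)"
    by (simp add: emeasure_eq_measure)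
  also have "\<dots> \<le> (\<integral>\<^sup>+\<omega>. F (fam \<omega>) \<partial>M)"
  proof (rule nn_integral_mono)
    fix \<omega> assume "\<omega> \<in> space M"
    show "indicator {\<omega> \<in> space M. Ev (fam \<omega>) \<and> \<not> \<bar>st (fam \<omega>)\<bar> \<le> e} \<omega> \<le> F (fam \<omega>)"
    proof (cases "Ev (fam \<omega>) \<and> \<not> \<bar>st (fam \<omega>)\<bar> \<le> e")
      case True
      then have "1 \<le> \<bar>st (fam \<omega>) / e\<bar>" using e by (simp add: abs_divide)
      then have "1 \<le> \<bar>st (fam \<omega>) / e\<bar> ^ (2 * q)" by (rule one_le_power)
      then have "1 \<le> (st (fam \<omega>) / e) ^ (2 * q)" by (simp only: power_even_abs dvd_triv_left)
      then show ?thesis using True by (simp add: F_def indicator_def)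
    next
      case False
      then have "indicator {\<omega> \<in> space M. Ev (fam \<omega>) \<and> \<not> \<bar>st (fam \<omega>)\<bar> \<le> e} \<omega> = (0::ennreal)"
        by (auto simp: indicator_def)
      then show ?thesis by simp
    qed
  qed
  also have "\<dots> = (\<integral>\<^sup>+\<omega>. (\<integral>\<^sup>+\<omega>'. F (mix k \<omega>' \<omega>) \<partial>M) \<partial>M)"
    by (rule nn_integral_decouple[OF F k])
  also have "\<dots> \<le> (\<integral>\<^sup>+\<omega>. ennreal (C / e ^ (2 * q)) \<partial>M)"
  proof (rule nn_integral_mono)
    fix \<omega>
    show "(\<integral>\<^sup>+\<omega>'. F (mix k \<omega>' \<omega>) \<partial>M) \<le> ennreal (C / e ^ (2 * q))"
    proof (cases "Ev (fam \<omega>)")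
      case True
      have int: "integrable M (\<lambda>\<omega>'. st (mix k \<omega>' \<omega>) ^ (2 * q))"
        using mom[OF True] by (intro all_moments_integrable all_moments_power) auto
      have "(\<integral>\<^sup>+\<omega>'. F (mix k \<omega>' \<omega>) \<partial>M) = (\<integral>\<^sup>+\<omega>'. ennreal ((st (mix k \<omega>' \<omega>)) ^ (2 * q) / e ^ (2 * q)) \<partial>M)"
        using True by (simp add: F_def mixEv power_divide)
      also have "\<dots> = ennreal (expectation (\<lambda>\<omega>'. (st (mix k \<omega>' \<omega>)) ^ (2 * q) / e ^ (2 * q)))"
        using int e by (intro nn_integral_eq_integral) (auto simp: power_mult intro!: AE_I2 divide_nonneg_nonneg)
      also have "\<dots> \<le> ennreal (C / e ^ (2 * q))"
        using mom[OF True] e by (intro ennreal_leI) (simp add: divide_right_mono)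
      finally show ?thesis .
    next
      case False
      then show ?thesis by (simp add: F_def mixEv)
    qed
  qed
  also have "\<dots> = ennreal (C / e ^ (2 * q))" by (simp add: emeasure_space_1)
  finally show ?thesis using C e by simp
qed

lemma row_linear_moment:
  assumes k: "k < n" and A: "\<And>j. A j k = 0"
  shows "all_moments M (\<lambda>\<omega>'. mv n A (column n z k (mix k \<omega>' \<omega>)) j)"
    and "expectation (\<lambda>\<omega>'. mv n A (column n z k (mix k \<omega>' \<omega>)) j ^ (2 * q))
      \<le> linear_const \<kappa> q * (\<Sum>l<n. (A j l)\<^sup>2) ^ q / real n ^ q"
proof -
  let ?S = "{..<n} - {k}"
  have eq: "mv n A (column n z k (mix k \<omega>' \<omega>)) j = (1 / sqrt (real n)) * (\<Sum>l\<in>?S. A j l * row k l \<omega>')" for \<omega>'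
  proof -
    have "mv n A (column n z k (mix k \<omega>' \<omega>)) j = (\<Sum>l\<in>?S. A j l * column n z k (mix k \<omega>' \<omega>) l)"
      unfolding mv_def using A by (intro sum.mono_neutral_right) auto
    also have "\<dots> = (\<Sum>l\<in>?S. (1 / sqrt (real n)) * (A j l * row k l \<omega>'))"
      using k by (intro sum.cong refl) (auto simp: column_def Bmat_def entry_mix_row)
    finally show ?thesis by (simp add: sum_distrib_left)
  qed
  have am: "all_moments M (\<lambda>\<omega>'. \<Sum>l\<in>?S. A j l * row k l \<omega>')"
    using all_moments_row[OF k] by (intro all_moments_intros) auto
  show "all_moments M (\<lambda>\<omega>'. mv n A (column n z k (mix k \<omega>' \<omega>)) j)"
    unfolding eq by (intro all_moments_scale am)
  have sq: "(1 / sqrt (real n)) ^ (2 * q) = 1 / real n ^ q" by (simp add: power_mult power_divide)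
  have "expectation (\<lambda>\<omega>'. mv n A (column n z k (mix k \<omega>' \<omega>)) j ^ (2 * q)) =
      1 / real n ^ q * expectation (\<lambda>\<omega>'. (\<Sum>l\<in>?S. A j l * row k l \<omega>') ^ (2 * q))"
    unfolding eq power_mult_distrib sq by simp
  also have "\<dots> \<le> 1 / real n ^ q * (linear_const \<kappa> q * (\<Sum>l\<in>?S. (A j l)\<^sup>2) ^ q)"
    using normalised_familyD(8)[OF normalised_row[OF k]] by (intro mult_left_mono linear_moment) auto
  also have "(\<Sum>l\<in>?S. (A j l)\<^sup>2) = (\<Sum>l<n. (A j l)\<^sup>2)"
    using A by (intro sum.mono_neutral_left) auto
  finally show "expectation (\<lambda>\<omega>'. mv n A (column n z k (mix k \<omega>' \<omega>)) j ^ (2 * q))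
      \<le> linear_const \<kappa> q * (\<Sum>l<n. (A j l)\<^sup>2) ^ q / real n ^ q" by simp
qed

definition deviation_const :: "real \<Rightarrow> nat \<Rightarrow> real" where
  "deviation_const h p = \<kappa> (2 * Suc p) + quadratic_const \<kappa> p * (1 + 1 / h\<^sup>2) ^ Suc p
     + quadratic_const \<kappa> p * (1 + 1 / h ^ 4) ^ Suc p
     + linear_const \<kappa> (Suc p) * (1 / h\<^sup>2) ^ Suc p + linear_const \<kappa> (Suc p) * (1 / h ^ 4) ^ Suc p"

lemma deviation_const_ge:
  assumes "h > 0"
  shows "\<kappa> (2 * Suc p) \<le> deviation_const h p"
    "quadratic_const \<kappa> p * (1 + 1 / h\<^sup>2) ^ Suc p \<le> deviation_const h p"
    "quadratic_const \<kappa> p * (1 + 1 / h ^ 4) ^ Suc p \<le> deviation_const h p"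
    "linear_const \<kappa> (Suc p) * (1 / h\<^sup>2) ^ Suc p \<le> deviation_const h p"
    "linear_const \<kappa> (Suc p) * (1 / h ^ 4) ^ Suc p \<le> deviation_const h p"
    "0 \<le> deviation_const h p"
proof -
  have "0 \<le> \<kappa> (2 * Suc p)" "0 \<le> quadratic_const \<kappa> p * (1 + 1 / h\<^sup>2) ^ Suc p"
    "0 \<le> quadratic_const \<kappa> p * (1 + 1 / h ^ 4) ^ Suc p"
    "0 \<le> linear_const \<kappa> (Suc p) * (1 / h\<^sup>2) ^ Suc p" "0 \<le> linear_const \<kappa> (Suc p) * (1 / h ^ 4) ^ Suc p"
    by (intro mult_nonneg_nonneg zero_le_power quadratic_const_nonneg linear_const_nonneg \<kappa>_nonneg; simp)+
  then show "\<kappa> (2 * Suc p) \<le> deviation_const h p"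
    "quadratic_const \<kappa> p * (1 + 1 / h\<^sup>2) ^ Suc p \<le> deviation_const h p"
    "quadratic_const \<kappa> p * (1 + 1 / h ^ 4) ^ Suc p \<le> deviation_const h p"
    "linear_const \<kappa> (Suc p) * (1 / h\<^sup>2) ^ Suc p \<le> deviation_const h p"
    "linear_const \<kappa> (Suc p) * (1 / h ^ 4) ^ Suc p \<le> deviation_const h p"
    "0 \<le> deviation_const h p"
    unfolding deviation_const_def by linarith+
qed

text \<open>Rows of A bounded in norm give tr A^2 \<le> n * c, so the moment of order 2 * Suc p is
  of order n to the power - Suc p: deviations have size 1 / sqrt n.\<close>

lemma form_deviation_moment:
  assumes k: "k < n" and A: "symm_mat A" "\<And>j. A k j = 0" and c: "c \<ge> 0" "\<And>j. j < n \<Longrightarrow> (\<Sum>l<n. (A j l)\<^sup>2) \<le> c"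
  shows "all_moments M (\<lambda>\<omega>'. form n A (column n z k (mix k \<omega>' \<omega>)) - tr n A / real n)"
    and "expectation (\<lambda>\<omega>'. (form n A (column n z k (mix k \<omega>' \<omega>)) - tr n A / real n) ^ (2 * Suc p))
      \<le> quadratic_const \<kappa> p * (1 + c) ^ Suc p / real n ^ Suc p"
proof -
  note m = row_form_moment[OF k A, of z \<omega>, folded column_def]
  show "all_moments M (\<lambda>\<omega>'. form n A (column n z k (mix k \<omega>' \<omega>)) - tr n A / real n)"
    by (intro all_moments_diff m(1) all_moments_const)
  have N: "real n \<ge> 1" using n_pos by simp
  have "tr n (mm n A A) \<le> (\<Sum>j<n. c)"
    unfolding tr_mm_self[OF A(1)] using c by (intro sum_mono) auto
  then have t: "1 + tr n (mm n A A) \<le> real n * (1 + c)" using N by (simp add: algebra_simps)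
  have t0: "0 \<le> 1 + tr n (mm n A A)" unfolding tr_mm_self[OF A(1)] by (intro add_nonneg_nonneg sum_nonneg) auto
  have "expectation (\<lambda>\<omega>'. (form n A (column n z k (mix k \<omega>' \<omega>)) - tr n A / real n) ^ (2 * Suc p))
      \<le> quadratic_const \<kappa> p * (1 + tr n (mm n A A)) ^ Suc p / real n ^ (2 * Suc p)"
    using m(3)[of p] by simp
  also have "\<dots> \<le> quadratic_const \<kappa> p * (real n * (1 + c)) ^ Suc p / real n ^ (2 * Suc p)"
    using t t0 quadratic_const_nonneg[OF \<kappa>_nonneg]
    by (intro divide_right_mono mult_left_mono power_mono) auto
  also have "real n ^ (2 * Suc p) = real n ^ Suc p * real n ^ Suc p" by (simp only: mult_2 power_add)
  also have "quadratic_const \<kappa> p * (real n * (1 + c)) ^ Suc p / (real n ^ Suc p * real n ^ Suc p) =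
      quadratic_const \<kappa> p * (1 + c) ^ Suc p / real n ^ Suc p"
    unfolding power_mult_distrib using N by simp
  finally show "expectation (\<lambda>\<omega>'. (form n A (column n z k (mix k \<omega>' \<omega>)) - tr n A / real n) ^ (2 * Suc p))
      \<le> quadratic_const \<kappa> p * (1 + c) ^ Suc p / real n ^ Suc p" .
qed

lemma measurable_minor:
  "(\<lambda>f. minor n z i f a b) \<in> borel_measurable (fam_space n)"
  "Measurable.pred (fam_space n) (minor_pd n z i)"
  unfolding minor_def minor_pd_def[abs_def] by (auto intro!: measurable_res measurable_pivots_pos)

lemma measurable_column: "i < n \<Longrightarrow> j < n \<Longrightarrow> (\<lambda>f. column n z i f j) \<in> borel_measurable (fam_space n)"
  unfolding column_def by (intro borel_measurable_uminus measurable_Bmat)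

lemma minor_mix:
  assumes "k < n"
  shows "minor n z k (mix k \<omega>' \<omega>) = minor n z k (fam \<omega>)" "minor_pd n z k (mix k \<omega>' \<omega>) = minor_pd n z k (fam \<omega>)"
proof -
  have "Bmat n z (mix k \<omega>' \<omega>) i j = Bmat n z (fam \<omega>) i j"
    if "i \<in> set (filter (\<lambda>j. j \<noteq> k) [0..<n])" "j \<in> set (filter (\<lambda>j. j \<noteq> k) [0..<n])" for i j
    using that by (intro Bmat_cong entry_mix_block) auto
  then show "minor n z k (mix k \<omega>' \<omega>) = minor n z k (fam \<omega>)" "minor_pd n z k (mix k \<omega>' \<omega>) = minor_pd n z k (fam \<omega>)"
    unfolding minor_def minor_pd_def by (intro res_cong pivots_pos_cong; blast)+
qed

lemma minor_inverse_on_shift: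
  assumes "minor_pd n (z - h) i f" "h > 0"
  shows "inverse_on n (shift h (Bmat n (z - h) f)) ({..<n} - {i}) (minor n z i f)"
    and "pd n (Bmat n (z - h) f) ({..<n} - {i})"
proof -
  show pd: "pd n (Bmat n (z - h) f) ({..<n} - {i})" using assms(1) by (simp add: minor_pd_iff)
  have B: "Bmat n z f = shift h (Bmat n (z - h) f)" using Bmat_shift[of n "z - h" h f] by simp
  have "pd n (Bmat n z f) ({..<n} - {i})" unfolding B using pd assms(2) by (intro pd_shift) auto
  from minor_inverse_on[OF this] show "inverse_on n (shift h (Bmat n (z - h) f)) ({..<n} - {i}) (minor n z i f)"
    unfolding B .
qed

lemma prob_statistic_le:
  fixes st :: "(nat \<times> nat \<Rightarrow> real) \<Rightarrow> real"
  assumes i: "i < n" and h: "h > 0" and e: "e > 0" and st: "st \<in> borel_measurable (fam_space n)"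
    and mom: "\<And>\<omega>. minor_pd n (z - h) i (fam \<omega>) \<Longrightarrow> all_moments M (\<lambda>\<omega>'. st (mix i \<omega>' \<omega>)) \<and>
      expectation (\<lambda>\<omega>'. st (mix i \<omega>' \<omega>) ^ (2 * Suc p)) \<le> c / real n ^ Suc p"
    and c: "c \<le> deviation_const h p"
  shows "prob {\<omega> \<in> space M. minor_pd n (z - h) i (fam \<omega>) \<and> \<not> \<bar>st (fam \<omega>)\<bar> \<le> e}
      \<le> deviation_const h p / real n ^ Suc p / e ^ (2 * Suc p)"
proof (rule prob_deviation_le[OF i measurable_minor(2) st minor_mix(2)[OF i] _ e])
  show "0 \<le> deviation_const h p / real n ^ Suc p" using deviation_const_ge(6)[OF h] by simp
  fix \<omega> assume "minor_pd n (z - h) i (fam \<omega>)"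
  moreover have "c / real n ^ Suc p \<le> deviation_const h p / real n ^ Suc p"
    using c by (intro divide_right_mono) auto
  ultimately show "all_moments M (\<lambda>\<omega>'. st (mix i \<omega>' \<omega>)) \<and>
      expectation (\<lambda>\<omega>'. st (mix i \<omega>' \<omega>) ^ (2 * Suc p)) \<le> deviation_const h p / real n ^ Suc p"
    using mom by (meson order_trans)
qed

text \<open>A union bound over 3 statistics for each i and 2 for each pair (i, j).\<close>

lemma prob_not_small_deviations:
  assumes h: "h > 0" and e: "e > 0"
  shows "prob {\<omega> \<in> space M. pivots_pos n (Bmat n (z - h) (fam \<omega>)) (rev [0..<n]) \<and> \<not> small_deviations n z e (fam \<omega>)}
      \<le> real n * (3 + 2 * real n) * (deviation_const h p / real n ^ Suc p / e ^ (2 * Suc p))"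
proof -
  define c where "c = deviation_const h p / real n ^ Suc p / e ^ (2 * Suc p)"
  define H where "H i f = minor n z i f" for i f
  define st1 where "st1 i f = entry n f i i" for i f
  define st2 where "st2 i f = form n (H i f) (column n z i f) - tr n (H i f) / real n" for i f
  define st3 where "st3 i f = form n (mm n (H i f) (H i f)) (column n z i f) - tr n (mm n (H i f) (H i f)) / real n" for i f
  define st4 where "st4 i j f = mv n (H i f) (column n z i f) j" for i j f
  define st5 where "st5 i j f = mv n (mm n (H i f) (H i f)) (column n z i f) j" for i j f
  define E where "E i st = {\<omega> \<in> space M. minor_pd n (z - h) i (fam \<omega>) \<and> \<not> \<bar>st (fam \<omega>)\<bar> \<le> e}" for i and st :: "(nat \<times> nat \<Rightarrow> real) \<Rightarrow> real"
  have Hm: "(\<lambda>f. H i f a b) \<in> borel_measurable (fam_space n)" for i a b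
    unfolding H_def by (rule measurable_minor)
  have HHm: "(\<lambda>f. mm n (H i f) (H i f) a b) \<in> borel_measurable (fam_space n)" for i a b
    by (intro measurable_mm Hm)
  have ms: "st1 i \<in> borel_measurable (fam_space n)" "st2 i \<in> borel_measurable (fam_space n)"
    "st3 i \<in> borel_measurable (fam_space n)" "st4 i j \<in> borel_measurable (fam_space n)"
    "st5 i j \<in> borel_measurable (fam_space n)" if "i < n" for i j
    unfolding st1_def[abs_def] st2_def[abs_def] st3_def[abs_def] st4_def[abs_def] st5_def[abs_def]
    using that by (auto intro!: measurable_entry borel_measurable_diff borel_measurable_divide measurable_form
        measurable_tr measurable_mv Hm HHm measurable_column)
  have Em: "E i st \<in> events" if "st \<in> borel_measurable (fam_space n)" for i st
  proof -
    note [measurable] = measurable_minor(2) that fam_measurable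
    show ?thesis unfolding E_def by measurable
  qed
  have P: "prob (E i (st1 i)) \<le> c" "prob (E i (st2 i)) \<le> c" "prob (E i (st3 i)) \<le> c"
    "j < n \<Longrightarrow> prob (E i (st4 i j)) \<le> c" "j < n \<Longrightarrow> prob (E i (st5 i j)) \<le> c" if i: "i < n" for i j
  proof -
    note D = deviation_const_ge[OF h]
    have Hmix: "H i (mix i \<omega>' \<omega>) = H i (fam \<omega>)" for \<omega>' \<omega> unfolding H_def by (rule minor_mix(1)[OF i])
    have I: "symm_mat (H i (fam \<omega>))" "H i (fam \<omega>) i b = 0" "H i (fam \<omega>) b i = 0"
      "symm_mat (mm n (H i (fam \<omega>)) (H i (fam \<omega>)))"
      "mm n (H i (fam \<omega>)) (H i (fam \<omega>)) i b = 0" "mm n (H i (fam \<omega>)) (H i (fam \<omega>)) b i = 0"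
      "a < n \<Longrightarrow> (\<Sum>l<n. (H i (fam \<omega>) a l)\<^sup>2) \<le> 1 / h\<^sup>2"
      "a < n \<Longrightarrow> (\<Sum>l<n. (mm n (H i (fam \<omega>)) (H i (fam \<omega>)) a l)\<^sup>2) \<le> 1 / h ^ 4"
      if "minor_pd n (z - h) i (fam \<omega>)" for \<omega> a b
    proof -
      note J = minor_inverse_on_shift[OF that h, folded H_def]
      show s: "symm_mat (H i (fam \<omega>))" using inverse_onD(2)[OF J(1)] .
      show z: "H i (fam \<omega>) i b = 0" "H i (fam \<omega>) b i = 0" for b using inverse_onD(3,4)[OF J(1)] by auto
      show "symm_mat (mm n (H i (fam \<omega>)) (H i (fam \<omega>)))" by (rule symm_mat_mm_self[OF s])
      show "mm n (H i (fam \<omega>)) (H i (fam \<omega>)) i b = 0" "mm n (H i (fam \<omega>)) (H i (fam \<omega>)) b i = 0"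
        by (simp_all add: mm_def z)
      show "a < n \<Longrightarrow> (\<Sum>l<n. (H i (fam \<omega>) a l)\<^sup>2) \<le> 1 / h\<^sup>2"
        using inverse_on_shift_entry_bounds(4,5)[OF J h] by simp
      show "a < n \<Longrightarrow> (\<Sum>l<n. (mm n (H i (fam \<omega>)) (H i (fam \<omega>)) a l)\<^sup>2) \<le> 1 / h ^ 4"
        by (rule mm_self_row_square_le[OF J h])
    qed
    show "prob (E i (st1 i)) \<le> c"
      unfolding E_def c_def
    proof (rule prob_statistic_le[OF i h e ms(1)[OF i] _ D(1)], rule conjI)
      fix \<omega>
      have eq: "st1 i (mix i \<omega>' \<omega>) = (1 / sqrt (real n)) * row i i \<omega>'" for \<omega>'
        unfolding st1_def using entry_mix_row[OF i i] by simp
      show "all_moments M (\<lambda>\<omega>'. st1 i (mix i \<omega>' \<omega>))"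
        unfolding eq by (intro all_moments_scale all_moments_row i)
      have "expectation (\<lambda>\<omega>'. \<bar>row i i \<omega>'\<bar> ^ (2 * Suc p)) \<le> \<kappa> (2 * Suc p)"
        unfolding row_def using i by (intro bound_X pair_of_in_pairs)
      moreover have "st1 i (mix i \<omega>' \<omega>) ^ (2 * Suc p) = 1 / real n ^ Suc p * \<bar>row i i \<omega>'\<bar> ^ (2 * Suc p)" for \<omega>'
      proof -
        have "(1 / sqrt (real n)) ^ (2 * Suc p) = 1 / real n ^ Suc p"
          unfolding power_mult by (simp add: power_divide)
        then show ?thesis unfolding eq power_mult_distrib by (simp only: power_even_abs dvd_triv_left)
      qed
      ultimately show "expectation (\<lambda>\<omega>'. st1 i (mix i \<omega>' \<omega>) ^ (2 * Suc p)) \<le> \<kappa> (2 * Suc p) / real n ^ Suc p"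
        by (simp add: divide_right_mono del: mult_Suc_right power_Suc)
    qed
    show "prob (E i (st2 i)) \<le> c"
      unfolding E_def c_def
    proof (rule prob_statistic_le[OF i h e ms(2)[OF i] _ D(2)])
      fix \<omega> assume \<omega>: "minor_pd n (z - h) i (fam \<omega>)"
      show "all_moments M (\<lambda>\<omega>'. st2 i (mix i \<omega>' \<omega>)) \<and>
        expectation (\<lambda>\<omega>'. st2 i (mix i \<omega>' \<omega>) ^ (2 * Suc p)) \<le> quadratic_const \<kappa> p * (1 + 1 / h\<^sup>2) ^ Suc p / real n ^ Suc p"
        unfolding st2_def Hmix
        by (intro conjI; rule form_deviation_moment[OF i I(1)[OF \<omega>] I(2)[OF \<omega>] _ I(7)[OF \<omega>]]; simp)
    qed
    show "prob (E i (st3 i)) \<le> c"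
      unfolding E_def c_def
    proof (rule prob_statistic_le[OF i h e ms(3)[OF i] _ D(3)])
      fix \<omega> assume \<omega>: "minor_pd n (z - h) i (fam \<omega>)"
      show "all_moments M (\<lambda>\<omega>'. st3 i (mix i \<omega>' \<omega>)) \<and>
        expectation (\<lambda>\<omega>'. st3 i (mix i \<omega>' \<omega>) ^ (2 * Suc p)) \<le> quadratic_const \<kappa> p * (1 + 1 / h ^ 4) ^ Suc p / real n ^ Suc p"
        unfolding st3_def Hmix
        by (intro conjI; rule form_deviation_moment[OF i I(4)[OF \<omega>] I(5)[OF \<omega>] _ I(8)[OF \<omega>]]; simp)
    qed
    show "prob (E i (st4 i j)) \<le> c" if j: "j < n"
      unfolding E_def c_def
    proof (rule prob_statistic_le[OF i h e ms(4)[OF i] _ D(4)])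
      fix \<omega> assume \<omega>: "minor_pd n (z - h) i (fam \<omega>)"
      have "linear_const \<kappa> (Suc p) * (\<Sum>l<n. (H i (fam \<omega>) j l)\<^sup>2) ^ Suc p / real n ^ Suc p
        \<le> linear_const \<kappa> (Suc p) * (1 / h\<^sup>2) ^ Suc p / real n ^ Suc p"
        by (intro divide_right_mono mult_left_mono power_mono I(7)[OF \<omega> j] linear_const_nonneg \<kappa>_nonneg sum_nonneg) auto
      then show "all_moments M (\<lambda>\<omega>'. st4 i j (mix i \<omega>' \<omega>)) \<and>
        expectation (\<lambda>\<omega>'. st4 i j (mix i \<omega>' \<omega>) ^ (2 * Suc p)) \<le> linear_const \<kappa> (Suc p) * (1 / h\<^sup>2) ^ Suc p / real n ^ Suc p"
        unfolding st4_def Hmix using row_linear_moment[OF i, of "H i (fam \<omega>)", OF I(3)[OF \<omega>], of z \<omega> j]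
        by (meson order_trans)
    qed
    show "prob (E i (st5 i j)) \<le> c" if j: "j < n"
      unfolding E_def c_def
    proof (rule prob_statistic_le[OF i h e ms(5)[OF i] _ D(5)])
      fix \<omega> assume \<omega>: "minor_pd n (z - h) i (fam \<omega>)"
      have "linear_const \<kappa> (Suc p) * (\<Sum>l<n. (mm n (H i (fam \<omega>)) (H i (fam \<omega>)) j l)\<^sup>2) ^ Suc p / real n ^ Suc p
        \<le> linear_const \<kappa> (Suc p) * (1 / h ^ 4) ^ Suc p / real n ^ Suc p"
        by (intro divide_right_mono mult_left_mono power_mono I(8)[OF \<omega> j] linear_const_nonneg \<kappa>_nonneg sum_nonneg) auto
      then show "all_moments M (\<lambda>\<omega>'. st5 i j (mix i \<omega>' \<omega>)) \<and>
        expectation (\<lambda>\<omega>'. st5 i j (mix i \<omega>' \<omega>) ^ (2 * Suc p)) \<le> linear_const \<kappa> (Suc p) * (1 / h ^ 4) ^ Suc p / real n ^ Suc p"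
        unfolding st5_def Hmix using row_linear_moment[OF i, of "mm n (H i (fam \<omega>)) (H i (fam \<omega>))", OF I(6)[OF \<omega>], of z \<omega> j]
        by (meson order_trans)
    qed
  qed
  define U where "U i = (E i (st1 i) \<union> E i (st2 i) \<union> E i (st3 i)) \<union> (\<Union>j<n. E i (st4 i j) \<union> E i (st5 i j))" for i
  have Um: "U i \<in> events" if "i < n" for i
    unfolding U_def using ms[OF that] by (intro sets.Un sets.finite_UN Em) auto
  have PU: "prob (U i) \<le> (3 + 2 * real n) * c" if i: "i < n" for i
  proof -
    have ev: "E i (st1 i) \<in> events" "E i (st2 i) \<in> events" "E i (st3 i) \<in> events"
      "E i (st4 i j) \<in> events" "E i (st5 i j) \<in> events" for j using ms[OF i] by (auto intro!: Em)
    have 1: "prob (\<Union>j<n. E i (st4 i j) \<union> E i (st5 i j)) \<le> (\<Sum>j<n. prob (E i (st4 i j) \<union> E i (st5 i j)))"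
      using ev by (intro measure_UNION_le) auto
    have 2: "(\<Sum>j<n. prob (E i (st4 i j) \<union> E i (st5 i j))) \<le> (\<Sum>j<n. c + c)"
    proof (rule sum_mono)
      fix j assume "j \<in> {..<n}"
      then show "prob (E i (st4 i j) \<union> E i (st5 i j)) \<le> c + c"
        using measure_Un_le[OF ev(4)[of j] ev(5)[of j]] P(4,5)[OF i, of j] by auto
    qed
    have 3: "prob (E i (st1 i) \<union> E i (st2 i) \<union> E i (st3 i)) \<le> c + c + c"
      using measure_Un_le[OF sets.Un[OF ev(1,2)] ev(3)] measure_Un_le[OF ev(1,2)] P(1-3)[OF i] by linarith
    have "prob (U i) \<le> prob (E i (st1 i) \<union> E i (st2 i) \<union> E i (st3 i)) + prob (\<Union>j<n. E i (st4 i j) \<union> E i (st5 i j))"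
      unfolding U_def using ev by (intro measure_Un_le) auto
    then show ?thesis using 1 2 3 by (simp add: algebra_simps)
  qed
  have sub: "{\<omega> \<in> space M. pivots_pos n (Bmat n (z - h) (fam \<omega>)) (rev [0..<n]) \<and> \<not> small_deviations n z e (fam \<omega>)} \<subseteq> (\<Union>i<n. U i)"
  proof
    fix \<omega> assume "\<omega> \<in> {\<omega> \<in> space M. pivots_pos n (Bmat n (z - h) (fam \<omega>)) (rev [0..<n]) \<and> \<not> small_deviations n z e (fam \<omega>)}"
    then have \<omega>: "\<omega> \<in> space M" and pp: "pivots_pos n (Bmat n (z - h) (fam \<omega>)) (rev [0..<n])"
      and nsd: "\<not> small_deviations n z e (fam \<omega>)" by auto
    have "pd n (Bmat n (z - h) (fam \<omega>)) {..<n}"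
      using res_correct(1)[OF symm_mat_Bmat, of "rev [0..<n]" n] pp by (simp add: atLeast0LessThan)
    \<comment> \<open>Positivity of the whole matrix passes to every minor, so the conditioning
      events of all the bounds hold at once.\<close>
    then have mpd: "minor_pd n (z - h) i (fam \<omega>)" for i
      unfolding minor_pd_iff by (rule pd_mono) auto
    from nsd obtain i where "i < n" "\<not> \<bar>st1 i (fam \<omega>)\<bar> \<le> e \<or> \<not> \<bar>st2 i (fam \<omega>)\<bar> \<le> e \<or> \<not> \<bar>st3 i (fam \<omega>)\<bar> \<le> e
        \<or> (\<exists>j<n. \<not> \<bar>st4 i j (fam \<omega>)\<bar> \<le> e \<or> \<not> \<bar>st5 i j (fam \<omega>)\<bar> \<le> e)"
      unfolding small_deviations_def st1_def st2_def st3_def st4_def st5_def H_def by blast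
    then have "\<omega> \<in> U i" using \<omega> mpd unfolding U_def E_def by blast
    then show "\<omega> \<in> (\<Union>i<n. U i)" using \<open>i < n\<close> by blast
  qed
  have "prob {\<omega> \<in> space M. pivots_pos n (Bmat n (z - h) (fam \<omega>)) (rev [0..<n]) \<and> \<not> small_deviations n z e (fam \<omega>)} \<le> prob (\<Union>i<n. U i)"
    using sub Um by (intro finite_measure_mono sets.finite_UN) auto
  also have "\<dots> \<le> (\<Sum>i<n. prob (U i))" using Um by (intro measure_UNION_le) auto
  also have "\<dots> \<le> (\<Sum>i<n. (3 + 2 * real n) * c)" using PU by (intro sum_mono) auto
  also have "\<dots> = real n * (3 + 2 * real n) * c" by simp
  finally show ?thesis by (simp only: c_def)
qed

end

section \<open>The Cauchy transform of the semicircle law\<close>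

text \<open>It keeps the arcsine argument of the primitive below within [-1, 1] and evaluates the
  square root in its derivative.\<close>

lemma one_minus_square_identity:
  fixes z x :: real
  assumes "z - x \<noteq> 0"
  shows "1 - ((z * x - 4) / (2 * (z - x)))\<^sup>2 = (z\<^sup>2 - 4) * (4 - x\<^sup>2) / (2 * (z - x))\<^sup>2"
proof -
  have "(2 * (z - x))\<^sup>2 - (z * x - 4)\<^sup>2 = (z\<^sup>2 - 4) * (4 - x\<^sup>2)"
    by (simp add: power2_eq_square algebra_simps)
  moreover have "1 - ((z * x - 4) / (2 * (z - x)))\<^sup>2 = ((2 * (z - x))\<^sup>2 - (z * x - 4)\<^sup>2) / (2 * (z - x))\<^sup>2"
  proof -
    have "1 - (p / q)\<^sup>2 = (q\<^sup>2 - p\<^sup>2) / q\<^sup>2" if "q \<noteq> 0" for p q :: real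
      using that by (simp add: power_divide diff_divide_distrib)
    then show ?thesis using assms by simp
  qed
  ultimately show ?thesis by simp
qed

text \<open>The integrand equals (x + z - (z^2 - 4) / (z - x)) / sqrt (4 - x^2), and the three terms
  of the primitive integrate x, z and the pole. The Moebius map in the last arcsine sends -2 and 2
  to -1 and 1.\<close>

lemma semicircle_antiderivative:
  fixes z x :: real
  assumes z: "z > 2" and x: "-2 < x" "x < 2"
  defines "r \<equiv> sqrt (z\<^sup>2 - 4)"
  shows "((\<lambda>x. - sqrt (4 - x\<^sup>2) + z * arcsin (x / 2) - r * arcsin ((z * x - 4) / (2 * (z - x))))
    has_real_derivative sqrt (4 - x\<^sup>2) / (z - x)) (at x)"
proof -
  define w where "w = sqrt (4 - x\<^sup>2)"
  define y where "y = (z * x - 4) / (2 * (z - x))"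
  have x2: "x\<^sup>2 < 4" using abs_square_less_1[of "x / 2"] x by (simp add: power_divide abs_less_iff)
  have z2: "z\<^sup>2 > 4" using z power_strict_mono[of 2 z 2] by simp
  have w: "w > 0" "w\<^sup>2 = 4 - x\<^sup>2" using x2 by (simp_all add: w_def)
  have r: "r > 0" "r\<^sup>2 = z\<^sup>2 - 4" using z2 by (simp_all add: r_def)
  have zx: "z - x > 0" using z x by simp
  have y1: "1 - y\<^sup>2 = (r * w / (2 * (z - x)))\<^sup>2"
    unfolding y_def using one_minus_square_identity[of z x] zx by (simp add: power_mult_distrib power_divide r w)
  have sy: "sqrt (1 - y\<^sup>2) = r * w / (2 * (z - x))"
    unfolding y1 using r w zx by simp
  have "1 - y\<^sup>2 > 0" unfolding y1 using r w zx by simp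
  then have "\<bar>y\<bar> < 1" using abs_square_less_1[of y] by simp
  then have y11: "-1 < y" "y < 1" by auto
  have "1 - (x / 2)\<^sup>2 = (w / 2)\<^sup>2" by (simp add: power_divide w)
  then have sx: "sqrt (1 - (x / 2)\<^sup>2) = w / 2" using w by simp
  have d1: "((\<lambda>x. sqrt (4 - x\<^sup>2)) has_real_derivative (- x / w)) (at x)"
    using x2 by (auto intro!: derivative_eq_intros simp: w_def divide_simps)
  have "((\<lambda>x. arcsin (x / 2)) has_real_derivative (inverse (sqrt (1 - (x / 2)\<^sup>2)) * (1 / 2))) (at x)"
    by (rule DERIV_chain2[OF DERIV_arcsin]) (use x in \<open>auto intro!: derivative_eq_intros\<close>)
  then have d2: "((\<lambda>x. arcsin (x / 2)) has_real_derivative (1 / w)) (at x)"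
    unfolding sx by (simp add: inverse_eq_divide)
  have d3: "((\<lambda>x. (z * x - 4) / (2 * (z - x))) has_real_derivative (r\<^sup>2 / (2 * (z - x)\<^sup>2))) (at x)"
  proof -
    have "((\<lambda>x. (z * x - 4) / (2 * (z - x))) has_real_derivative
        ((z * (2 * (z - x)) - (z * x - 4) * (- 2)) / (2 * (z - x) * (2 * (z - x))))) (at x)"
      using zx by (auto intro!: derivative_eq_intros)
    moreover have "z * (2 * (z - x)) - (z * x - 4) * (- 2) = 2 * r\<^sup>2"
      unfolding r by (simp add: power2_eq_square algebra_simps)
    moreover have "2 * q / (2 * a * (2 * a)) = q / (2 * a\<^sup>2)" for q a :: real
      by (simp add: power2_eq_square)
    ultimately show ?thesis by (simp only:)
  qed
  have "((\<lambda>x. arcsin ((z * x - 4) / (2 * (z - x)))) has_real_derivative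
      (inverse (sqrt (1 - y\<^sup>2)) * (r\<^sup>2 / (2 * (z - x)\<^sup>2)))) (at x)"
    using DERIV_chain2[OF DERIV_arcsin[OF y11, unfolded y_def] d3] by (simp add: y_def)
  also have "inverse (sqrt (1 - y\<^sup>2)) * (r\<^sup>2 / (2 * (z - x)\<^sup>2)) = r / ((z - x) * w)"
  proof -
    have "inverse (r * w / (2 * t)) * (r\<^sup>2 / (2 * t\<^sup>2)) = r / (t * w)" if "t > 0" for t
      using r(1) w(1) that by (simp add: power2_eq_square field_simps)
    then show ?thesis unfolding sy using zx by blast
  qed
  finally have d4: "((\<lambda>x. arcsin ((z * x - 4) / (2 * (z - x)))) has_real_derivative (r / ((z - x) * w))) (at x)" .
  have "((\<lambda>x. - sqrt (4 - x\<^sup>2) + z * arcsin (x / 2) - r * arcsin ((z * x - 4) / (2 * (z - x))))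
    has_real_derivative (- (- x / w) + z * (1 / w) - r * (r / ((z - x) * w)))) (at x)"
    by (intro DERIV_diff DERIV_add DERIV_minus DERIV_cmult d1 d2 d4)
  also have "- (- x / w) + z * (1 / w) - r * (r / ((z - x) * w)) = ((x + z) * (z - x) - r\<^sup>2) / ((z - x) * w)"
  proof -
    have "- (- x / w) + z * (1 / w) - r * (r / (t * w)) = ((x + z) * t - r\<^sup>2) / (t * w)" if "t > 0" for t
      using w(1) that by (simp add: power2_eq_square field_simps)
    then show ?thesis using zx by blast
  qed
  also have "(x + z) * (z - x) - r\<^sup>2 = w\<^sup>2" unfolding r w by (simp add: power2_eq_square algebra_simps)
  also have "w\<^sup>2 / ((z - x) * w) = w / (z - x)" using w(1) by (simp add: power2_eq_square)
  finally show ?thesis by (simp add: w_def)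
qed

lemma semicircle_has_integral:
  fixes z :: real
  assumes z: "z > 2"
  shows "((\<lambda>x. 1 / (2 * pi) * sqrt (4 - x\<^sup>2) * (1 / (z - x))) has_integral ((z - sqrt (z\<^sup>2 - 4)) / 2)) {-2..2}"
proof -
  define r where "r = sqrt (z\<^sup>2 - 4)"
  define F where "F x = - sqrt (4 - x\<^sup>2) + z * arcsin (x / 2) - r * arcsin ((z * x - 4) / (2 * (z - x)))" for x
  have z2: "z\<^sup>2 > 4" using z power_strict_mono[of 2 z 2] by simp
  have ran: "-1 \<le> (z * x - 4) / (2 * (z - x)) \<and> (z * x - 4) / (2 * (z - x)) \<le> 1" if x: "x \<in> {-2..2}" for x
  proof -
    have "x\<^sup>2 \<le> 4" using abs_square_le_1[of "x / 2"] x by (simp add: power_divide abs_le_iff)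
    then have "0 \<le> 1 - ((z * x - 4) / (2 * (z - x)))\<^sup>2"
      using one_minus_square_identity[of z x] z z2 x by simp
    then have "\<bar>(z * x - 4) / (2 * (z - x))\<bar> \<le> 1" by (simp only: abs_square_le_1[symmetric])
    then show ?thesis unfolding abs_le_iff by linarith
  qed
  have "((\<lambda>x. sqrt (4 - x\<^sup>2) / (z - x)) has_integral (F 2 - F (-2))) {-2..2}"
  \<comment> \<open>The terms of the primitive have no finite derivative at the ends of the
    interval; continuity serves there.\<close>
  proof (rule fundamental_theorem_of_calculus_interior)
    show "continuous_on {-2..2} F"
      unfolding F_def using z ran by (intro continuous_intros continuous_on_arcsin) auto
    show "(F has_vector_derivative sqrt (4 - x\<^sup>2) / (z - x)) (at x)" if "x \<in> {-2<..<2}" for x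
      using semicircle_antiderivative[OF z, of x] that
      by (simp add: F_def[abs_def] r_def has_real_derivative_iff_has_vector_derivative[symmetric])
  qed simp
  moreover have "F 2 = z * (pi / 2) - r * (pi / 2)"
  proof -
    have "(z * 2 - 4) / (2 * (z - 2)) = 1" using z by (simp add: field_simps)
    then show ?thesis unfolding F_def by (simp only:) simp
  qed
  moreover have "F (-2) = - z * (pi / 2) + r * (pi / 2)"
  proof -
    have "(z * (-2) - 4) / (2 * (z - (-2))) = -1" using z by (simp add: field_simps)
    then show ?thesis unfolding F_def by (simp only:) simp
  qed
  ultimately have "((\<lambda>x. sqrt (4 - x\<^sup>2) / (z - x)) has_integral (pi * (z - r))) {-2..2}"
    by (simp add: algebra_simps)
  then have "((\<lambda>x. 1 / (2 * pi) * (sqrt (4 - x\<^sup>2) / (z - x))) has_integral (1 / (2 * pi) * (pi * (z - r)))) {-2..2}"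
    by (rule has_integral_mult_right)
  then show ?thesis by (simp add: r_def)
qed

text \<open>Nonnegativity of the integrand lets the gauge integral just computed be read as a
  Lebesgue integral.\<close>

lemma G_sc_eq:
  assumes z: "z > 2"
  shows "G_sc z = (z - sqrt (z\<^sup>2 - 4)) / 2"
proof -
  let ?g = "\<lambda>x. 1 / (2 * pi) * sqrt (4 - x\<^sup>2) * indicator {-2..2} x :: real"
  let ?f = "\<lambda>x. 1 / (2 * pi) * sqrt (4 - x\<^sup>2) * (1 / (z - x)) :: real"
  have sq: "sqrt (4 - x\<^sup>2) \<ge> 0" if "x \<in> {-2..2}" for x :: real
  proof -
    have "x\<^sup>2 \<le> 4" using abs_square_le_1[of "x / 2"] that by (simp add: power_divide abs_le_iff)
    then show ?thesis by simp
  qed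
  have g0: "?g x \<ge> 0" for x using sq[of x] by (cases "x \<in> {-2..2}") auto
  have f0: "?f x \<ge> 0" if "x \<in> {-2..2}" for x using sq[OF that] that z by simp
  have "G_sc z = (\<integral>x. ?g x *\<^sub>R (1 / (z - x)) \<partial>lborel)"
    unfolding G_sc_def semicircle_def using g0 by (intro integral_density) auto
  also have "\<dots> = (\<integral>x. ?f x * indicator {-2..2} x \<partial>lborel)"
    by (intro Bochner_Integration.integral_cong refl) (simp add: indicator_def)
  also have "\<dots> = enn2real (\<integral>\<^sup>+x. ennreal (?f x * indicator {-2..2} x) \<partial>lborel)"
    using f0 by (intro integral_eq_nn_integral) (auto simp: indicator_def)
  also have "(\<integral>\<^sup>+x. ennreal (?f x * indicator {-2..2} x) \<partial>lborel) = (\<integral>\<^sup>+x. ennreal (?f x) * indicator {-2..2} x \<partial>lborel)"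
    by (intro nn_integral_cong) (simp add: indicator_def)
  also have "\<dots> = ennreal ((z - sqrt (z\<^sup>2 - 4)) / 2)"
    by (rule nn_integral_has_integral_lebesgue'[OF f0 semicircle_has_integral[OF z]])
  also have "enn2real \<dots> = (z - sqrt (z\<^sup>2 - 4)) / 2"
  proof (rule enn2real_ennreal)
    have "sqrt (z\<^sup>2 - 4) \<le> sqrt (z\<^sup>2)" by (rule real_sqrt_le_mono) simp
    then show "0 \<le> (z - sqrt (z\<^sup>2 - 4)) / 2" using z by simp
  qed
  finally show ?thesis .
qed

text \<open>The value is the smaller root m of m * (z - m) = 1. With r = sqrt (z^2 - 4) one has 1 -
  m^2 = r * m, so m^2 / (1 - m^2) = m / r, which is minus the derivative of (z - r) / 2.\<close>

lemma G_sc_properties: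
  assumes z: "z > 2"
  shows "0 < G_sc z" "G_sc z < 1" "G_sc z * (z - G_sc z) = 1"
    "- deriv G_sc z - (G_sc z)\<^sup>2 = (G_sc z)\<^sup>2 / (1 - (G_sc z)\<^sup>2) - (G_sc z)\<^sup>2"
proof -
  define r where "r = sqrt (z\<^sup>2 - 4)"
  define m where "m = (z - r) / 2"
  have z2: "z\<^sup>2 > 4" using z power_strict_mono[of 2 z 2] by simp
  have r: "r > 0" "r\<^sup>2 = z\<^sup>2 - 4" using z2 by (simp_all add: r_def)
  have mG: "G_sc z = m" using G_sc_eq[OF z] by (simp add: m_def r_def)
  have "r < z" using z r power2_less_imp_less[of r z] by simp
  then have m0: "m > 0" by (simp add: m_def)
  have mm: "m * (z - m) = 1" using r by (simp add: m_def field_simps power2_eq_square)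
  have "r\<^sup>2 > (z - 2)\<^sup>2" unfolding r using z by (simp add: power2_eq_square algebra_simps)
  then have "r > z - 2" using r by (intro power2_less_imp_less[of "z - 2" r]) auto
  then have m1: "m < 1" by (simp add: m_def)
  show "0 < G_sc z" "G_sc z < 1" "G_sc z * (z - G_sc z) = 1" using m0 m1 mm mG by auto
  have "((\<lambda>z. (z - sqrt (z\<^sup>2 - 4)) / 2) has_real_derivative ((1 - z / r) / 2)) (at z)"
    using z2 by (auto intro!: derivative_eq_intros simp: r_def divide_simps)
  then have "(G_sc has_real_derivative ((1 - z / r) / 2)) (at z)"
  proof (rule has_field_derivative_transform_within_open[of _ _ _ "{2<..}"])
    show "(x - sqrt (x\<^sup>2 - 4)) / 2 = G_sc x" if "x \<in> {2<..}" for x using G_sc_eq[of x] that by simp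
  qed (use z in auto)
  then have d: "deriv G_sc z = (1 - z / r) / 2" by (rule DERIV_imp_deriv)
  have "1 - m\<^sup>2 = r * m" using r by (simp add: m_def field_simps power2_eq_square)
  then have "m\<^sup>2 / (1 - m\<^sup>2) = m / r" using m0 by (simp add: power2_eq_square)
  also have "\<dots> = - deriv G_sc z" unfolding d m_def using r(1) by (simp add: field_simps)
  finally show "- deriv G_sc z - (G_sc z)\<^sup>2 = (G_sc z)\<^sup>2 / (1 - (G_sc z)\<^sup>2) - (G_sc z)\<^sup>2" by (simp add: mG)
qed

section \<open>The largest eigenvalue and the resolvent\<close>

lemma pd_full_iff:
  "pd n B {..<n} \<longleftrightarrow> (\<forall>x. (\<exists>i<n. x i \<noteq> 0) \<longrightarrow> form n B x > 0)"
proof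
  assume pd: "pd n B {..<n}"
  show "\<forall>x. (\<exists>i<n. x i \<noteq> 0) \<longrightarrow> form n B x > 0"
  proof (intro allI impI)
    fix x assume "\<exists>i<n. x i \<noteq> (0::real)"
    then have "form n B (\<lambda>i. if i < n then x i else 0) > 0"
      by (intro pd[unfolded pd_def, rule_format]) auto
    also have "form n B (\<lambda>i. if i < n then x i else 0) = form n B x"
      unfolding form_def dot_def mv_def by (intro sum.cong refl arg_cong2[where f = "(*)"]) auto
    finally show "form n B x > 0" .
  qed
next
  assume "\<forall>x. (\<exists>i<n. x i \<noteq> 0) \<longrightarrow> form n B x > 0"
  then show "pd n B {..<n}" unfolding pd_def by auto
qed

lemma dot_self_pos: "(\<exists>i<n. x i \<noteq> 0) \<Longrightarrow> dot n x x > 0"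
  unfolding dot_def by (metis (no_types, lifting) finite_lessThan lessThan_iff not_square_less_zero
      sum_pos2 zero_less_mult_iff linorder_neqE_linordered_idom zero_le_square)

lemma form_add_scale:
  assumes "symm_mat B"
  shows "form n B (\<lambda>i. x i + t * y i) = form n B x + 2 * t * dot n y (mv n B x) + t\<^sup>2 * form n B y"
proof -
  have "dot n x (mv n B y) = dot n y (mv n B x)"
    using dot_mv[OF assms, of n y x] by (simp add: dot_commute)
  then show ?thesis
    unfolding form_def mv_add mv_scale dot_add_left dot_add_right dot_scale_left dot_scale_right
    by (simp add: power2_eq_square algebra_simps)
qed

lemma form_abs_le: "form n A x \<le> (\<Sum>i<n. \<Sum>j<n. \<bar>A i j\<bar>) * dot n x x"
proof -
  have xi: "(x i)\<^sup>2 \<le> dot n x x" if "i < n" for i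
    unfolding dot_def power2_eq_square by (rule member_le_sum) (use that in auto)
  have "form n A x = (\<Sum>i<n. \<Sum>j<n. A i j * (x i * x j))"
    by (simp add: form_def dot_def mv_def sum_distrib_left mult_ac)
  also have "\<dots> \<le> (\<Sum>i<n. \<Sum>j<n. \<bar>A i j\<bar> * dot n x x)"
  proof (intro sum_mono)
    fix i j assume "i \<in> {..<n}" "j \<in> {..<n}"
    then have "\<bar>x i * x j\<bar> \<le> dot n x x"
      using xi[of i] xi[of j] sum_squares_bound[of "\<bar>x i\<bar>" "\<bar>x j\<bar>"] by (simp add: abs_mult)
    then have "\<bar>A i j\<bar> * \<bar>x i * x j\<bar> \<le> \<bar>A i j\<bar> * dot n x x" by (intro mult_left_mono) auto
    moreover have "A i j * (x i * x j) \<le> \<bar>A i j\<bar> * \<bar>x i * x j\<bar>" by (metis abs_ge_self abs_mult)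
    ultimately show "A i j * (x i * x j) \<le> \<bar>A i j\<bar> * dot n x x" by linarith
  qed
  also have "\<dots> = (\<Sum>i<n. \<Sum>j<n. \<bar>A i j\<bar>) * dot n x x" by (simp add: sum_distrib_right)
  finally show ?thesis .
qed

text \<open>Strict positivity becomes uniform without compactness. K bounds the form of the inverse
  G, and minimising the form of B along x + t * G x, where B G x = x, gives <x, B x> \<ge> |x|^4 /
  <x, G x> \<ge> |x|^2 / K.\<close>

lemma pd_coercive:
  assumes B: "symm_mat B" and pd: "pd n B {..<n}" and G: "inverse_on n B {..<n} G"
  obtains c where "c > 0" "\<And>x. form n B x \<ge> c * dot n x x"
proof -
  define K where "K = 1 + (\<Sum>i<n. \<Sum>j<n. \<bar>G i j\<bar>)"
  have K: "K > 0" by (simp add: K_def add_pos_nonneg sum_nonneg)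
  have "form n B x \<ge> 1 / K * dot n x x" for x
  proof (cases "\<exists>i<n. x i \<noteq> 0")
    case True
    define p where "p = dot n x x"
    define f where "f = form n G x"
    let ?y = "mv n G x"
    have p: "p > 0" using dot_self_pos[OF True] by (simp add: p_def)
    have fy: "form n B ?y = f" by (simp add: f_def inverse_on_form_eq[OF G])
    have xy: "dot n ?y (mv n B x) = p"
    proof -
      have "dot n ?y (mv n B x) = dot n (mv n B ?y) x" by (simp add: dot_mv[OF B])
      also have "\<dots> = p" unfolding p_def by (intro dot_cong inverse_on_mv[OF G]) auto
      finally show ?thesis .
    qed
    have "f > 0"
    proof (rule ccontr)
      assume "\<not> f > 0"
      then have "\<not> (\<exists>i<n. ?y i \<noteq> 0)" using pd fy unfolding pd_full_iff by force
      then have "dot n ?y (mv n B x) = 0" by (simp add: dot_def)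
      then show False using xy p by simp
    qed
    have fK: "f \<le> K * p"
      using form_abs_le[of n G x] p by (simp add: f_def K_def p_def algebra_simps)
    have "0 \<le> form n B (\<lambda>i. x i + (- p / f) * ?y i)"
      using pd unfolding pd_full_iff by (metis form_zero less_eq_real_def)
    also have "\<dots> = form n B x - p\<^sup>2 / f"
      unfolding form_add_scale[OF B] xy fy using \<open>f > 0\<close> by (simp add: power2_eq_square field_simps)
    finally have 1: "p\<^sup>2 / f \<le> form n B x" by simp
    have "1 / K * p = p\<^sup>2 / (K * p)" using p by (simp add: power2_eq_square)
    also have "\<dots> \<le> p\<^sup>2 / f" using fK \<open>f > 0\<close> by (intro divide_left_mono) auto
    finally show ?thesis using 1 by (simp add: p_def)
  next
    case False
    then show ?thesis by (simp add: form_zero dot_def)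
  qed
  then show thesis using that[of "1 / K"] K by simp
qed

lemma form_neg: "form n (\<lambda>i j. - a i j) x = - form n a x"
  by (simp add: form_def dot_def mv_def sum_negf)

text \<open>
  The infimum \<open>z0\<close> of all \<open>z\<close> for which \<open>z - a\<close> is positive semidefinite is an eigenvalue, since
  \<open>z0 - a\<close> cannot be definite; this replaces the spectral theorem.
\<close>

lemma top_of_spectrum:
  fixes a :: "nat \<Rightarrow> nat \<Rightarrow> real"
  assumes n: "n > 0" and a: "symm_mat a"
  obtains z0 x where "\<And>z. pd n (shift z (\<lambda>i j. - a i j)) {..<n} \<longleftrightarrow> z0 < z"
    and "\<exists>i<n. x i \<noteq> 0" "\<And>i. i < n \<Longrightarrow> mv n a x i = z0 * x i"
    and "\<And>x. form n a x \<le> z0 * dot n x x"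
proof -
  define R where "R = {z. \<forall>x. form n a x \<le> z * dot n x x}"
  let ?B = "\<lambda>z. shift z (\<lambda>i j. - a i j)"
  have fB: "form n (?B z) x = z * dot n x x - form n a x" for z x by (simp add: form_shift form_neg)
  have sB: "symm_mat (?B z)" for z using a by (intro symm_mat_shift) (simp add: symm_mat_def)
  have e1: "dot n (unit_vec_at 0) (unit_vec_at 0) = 1" "form n a (unit_vec_at 0) = a 0 0"
    using n by (simp_all add: form_def dot_commute[of n "unit_vec_at 0" "mv n a _"] dot_unit_vec_at mv_unit_vec_at)
      (simp add: unit_vec_at_def)
  have lower: "a 0 0 \<le> z" if "z \<in> R" for z
  proof -
    have "form n a (unit_vec_at 0) \<le> z * dot n (unit_vec_at 0) (unit_vec_at 0)" using that unfolding R_def by blast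
    then show ?thesis using e1 by simp
  qed
  have R0: "R \<noteq> {}" using form_abs_le[of n a] unfolding R_def by blast
  have bdd: "bdd_below R" using lower by (rule bdd_belowI)
  define z0 where "z0 = Inf R"
  have z0: "form n a x \<le> z0 * dot n x x" for x
  proof (cases "\<exists>i<n. x i \<noteq> 0")
    case True
    then have p: "dot n x x > 0" by (rule dot_self_pos)
    have "form n a x / dot n x x \<le> z" if "z \<in> R" for z
      using that p unfolding R_def by (simp add: pos_divide_le_eq)
    then have "form n a x / dot n x x \<le> z0" unfolding z0_def using R0 by (intro cInf_greatest)
    then show ?thesis using p by (simp add: pos_divide_le_eq)
  next
    case False
    then show ?thesis by (simp add: form_zero dot_def)
  qed
  have gt: "pd n (?B z) {..<n}" if "z0 < z" for z
    unfolding pd_full_iff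
  proof (intro allI impI)
    fix x assume "\<exists>i<n. x i \<noteq> (0::real)"
    then have "z0 * dot n x x < z * dot n x x" using dot_self_pos that by (intro mult_strict_right_mono)
    then show "0 < form n (?B z) x" using z0[of x] by (simp add: fB)
  qed
  have not0: "\<not> pd n (?B z0) {..<n}"
  proof
    assume pd: "pd n (?B z0) {..<n}"
    have "inverse_on n (?B z0) {..<n} (res n (?B z0) (rev [0..<n]))"
      using res_correct(2)[OF sB, of "rev [0..<n]" n z0] pd by (simp add: atLeast0LessThan)
    then obtain c where c: "c > 0" "\<And>x. form n (?B z0) x \<ge> c * dot n x x"
      using pd_coercive[OF sB pd] by blast
    \<comment> \<open>Coercivity leaves room below \<open>z0\<close>, against its being the
      infimum.\<close>
    have "z0 - c \<in> R" unfolding R_def using c(2) by (simp add: fB algebra_simps)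
    then have "z0 \<le> z0 - c" unfolding z0_def using bdd by (intro cInf_lower)
    then show False using c(1) by simp
  qed
  have iff: "pd n (?B z) {..<n} \<longleftrightarrow> z0 < z" for z
  proof
    assume pd: "pd n (?B z) {..<n}"
    show "z0 < z"
    proof (rule ccontr)
      assume "\<not> z0 < z"
      then have "pd n (shift (z0 - z) (?B z)) {..<n}" by (intro pd_shift[OF pd]) simp
      moreover have "shift (z0 - z) (?B z) = ?B z0" by (auto simp: shift_def fun_eq_iff)
      ultimately show False using not0 by simp
    qed
  qed (rule gt)
  from not0 obtain x where x: "\<exists>i<n. x i \<noteq> 0" "\<not> form n (?B z0) x > 0" unfolding pd_full_iff by blast
  have psd: "form n (?B z0) y \<ge> 0" for y using z0[of y] by (simp add: fB)
  have fx: "form n (?B z0) x = 0" using x(2) psd[of x] by simp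
  define y where "y = mv n (?B z0) x"
  have "dot n y y = 0"
  proof (rule ccontr)
    assume "dot n y y \<noteq> 0"
    then have c: "dot n y y > 0" using dot_self_nonneg[of n y] by simp
    define f where "f = form n (?B z0) y"
    have f: "f \<ge> 0" using psd by (simp add: f_def)
    define c' where "c' = dot n y y"
    \<comment> \<open>A null vector of a semidefinite form lies in the kernel: a small step from x
      against its image y would make the form negative. The denominator is f + 1 because f may be
      0.\<close>
    have "0 \<le> form n (?B z0) (\<lambda>i. x i + (- c' / (f + 1)) * y i)" by (rule psd)
    also have "\<dots> = - (c'\<^sup>2 * (f + 2)) / (f + 1)\<^sup>2"
      unfolding form_add_scale[OF sB] fx y_def[symmetric] f_def[symmetric] c'_def[symmetric]
      using f by (simp add: power2_eq_square divide_simps) (simp add: algebra_simps)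
    also have "\<dots> < 0" using c f by (simp add: c'_def divide_neg_pos)
    finally show False by simp
  qed
  then have "y i = 0" if "i < n" for i using dot_self_pos[of n y] that by force
  then have "mv n a x i = z0 * x i" if "i < n" for i
    using that mv_shift[of i n z0 "\<lambda>i j. - a i j" x] by (simp add: y_def) (simp add: mv_def sum_negf)
  then show thesis using that[OF iff x(1) _ z0] by blast
qed

definition mat_fun :: "real mat \<Rightarrow> nat \<Rightarrow> nat \<Rightarrow> real" where
  "mat_fun A i j = (if i < dim_row A \<and> j < dim_col A then A $$ (i, j) else 0)"

text \<open>The threshold \<open>z0\<close> of definiteness is an eigenvalue, and every eigenvalue
  is a Rayleigh quotient, hence at most \<open>z0\<close>; so \<open>z0\<close> is the maximum of
  the spectrum.\<close>

lemma largest_eigenvalue_less_iff: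
  assumes A: "A \<in> carrier_mat n n" and n: "n > 0" and sym: "transpose_mat A = A"
  shows "largest_eigenvalue A < z \<longleftrightarrow> pd n (shift z (\<lambda>i j. - mat_fun A i j)) {..<n}"
proof -
  let ?a = "mat_fun A"
  have a: "symm_mat ?a"
    unfolding symm_mat_def
  proof (intro allI)
    fix i j
    show "?a i j = ?a j i"
    proof (cases "i < n \<and> j < n")
      case True
      then have "A $$ (i, j) = transpose_mat A $$ (i, j)" using sym by simp
      also have "\<dots> = A $$ (j, i)" using True A by simp
      finally show ?thesis using True A by (simp add: mat_fun_def)
    qed (use A in \<open>auto simp: mat_fun_def\<close>)
  qed
  obtain z0 x where z0: "\<And>z. pd n (shift z (\<lambda>i j. - ?a i j)) {..<n} \<longleftrightarrow> z0 < z"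
    and x: "\<exists>i<n. x i \<noteq> 0" "\<And>i. i < n \<Longrightarrow> mv n ?a x i = z0 * x i"
    and le: "\<And>x. form n ?a x \<le> z0 * dot n x x"
    using top_of_spectrum[OF n a] by blast
  have mult: "(A *\<^sub>v v) $ i = mv n ?a (\<lambda>j. v $ j) i" if "i < n" "v \<in> carrier_vec n" for v i
  proof -
    have "(A *\<^sub>v v) $ i = (\<Sum>j\<in>{0..<n}. A $$ (i, j) * v $ j)"
      using A that by (simp add: scalar_prod_def)
    then show ?thesis using A that by (simp add: mv_def mat_fun_def atLeast0LessThan)
  qed
  have "largest_eigenvalue A = z0"
    unfolding largest_eigenvalue_def
  proof (rule Max_eqI)
    show "finite (spectrum A)" by (rule card_finite_spectrum(1)[OF A])
    show "k \<le> z0" if "k \<in> spectrum A" for k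
    proof -
      from that obtain v where v: "v \<in> carrier_vec n" "v \<noteq> 0\<^sub>v n" "A *\<^sub>v v = k \<cdot>\<^sub>v v"
        using A by (auto simp: spectrum_def eigenvalue_def eigenvector_def)
      have "\<exists>i<n. v $ i \<noteq> 0" using v by (auto simp: vec_eq_iff)
      then have p: "dot n (\<lambda>i. v $ i) (\<lambda>i. v $ i) > 0" by (rule dot_self_pos)
      have "mv n ?a (\<lambda>j. v $ j) i = k * v $ i" if "i < n" for i
        using mult[OF that v(1)] v that by simp
      then have "form n ?a (\<lambda>i. v $ i) = k * dot n (\<lambda>i. v $ i) (\<lambda>i. v $ i)"
        by (simp add: form_def dot_def sum_distrib_left algebra_simps)
      then show "k \<le> z0" using le[of "\<lambda>i. v $ i"] p by simp
    qed
    have "A *\<^sub>v Matrix.vec n x = z0 \<cdot>\<^sub>v Matrix.vec n x"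
    proof (rule eq_vecI)
      fix i assume "i < dim_vec (z0 \<cdot>\<^sub>v Matrix.vec n x)"
      then have i: "i < n" by simp
      have "(A *\<^sub>v Matrix.vec n x) $ i = mv n ?a (\<lambda>j. Matrix.vec n x $ j) i" using i by (intro mult) auto
      also have "\<dots> = mv n ?a x i" by (rule arg_cong[where f = "\<lambda>g. g i"], rule mv_cong) simp
      finally show "(A *\<^sub>v Matrix.vec n x) $ i = (z0 \<cdot>\<^sub>v Matrix.vec n x) $ i" using x(2) i by simp
    qed (use A in simp)
    moreover have "Matrix.vec n x \<noteq> 0\<^sub>v n" using x(1) by (auto simp: vec_eq_iff)
    ultimately show "z0 \<in> spectrum A"
      using A unfolding spectrum_def eigenvalue_def eigenvector_def
      by (auto intro!: exI[of _ "Matrix.vec n x"])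
  qed
  then show ?thesis using z0 by simp
qed

text \<open>A two-sided inverse makes the matrix a unit, so \<open>mat_inverse\<close> returns
  \<open>Some\<close>, and uniqueness of inverses identifies the value.\<close>

lemma resolvent_eq:
  assumes A: "A \<in> carrier_mat n n" and sym: "symm_mat (mat_fun A)"
    and G: "inverse_on n (shift z (\<lambda>i j. - mat_fun A i j)) {..<n} G"
  shows "resolvent z A = Matrix.mat n n (\<lambda>(i, j). G i j)"
proof -
  let ?B = "shift z (\<lambda>i j. - mat_fun A i j)"
  define Bm where "Bm = z \<cdot>\<^sub>m 1\<^sub>m n - A"
  define Gm where "Gm = Matrix.mat n n (\<lambda>(i, j). G i j)"
  have sB: "symm_mat ?B" using sym by (intro symm_mat_shift) (simp add: symm_mat_def)
  have c: "Bm \<in> carrier_mat n n" "Gm \<in> carrier_mat n n" using A by (auto simp: Bm_def Gm_def)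
  have B: "Bm $$ (i, j) = ?B i j" if "i < n" "j < n" for i j
    using that A by (simp add: Bm_def shift_def mat_fun_def)
  have BG: "Bm * Gm = 1\<^sub>m n"
  proof (rule eq_matI)
    fix i j assume "i < dim_row (1\<^sub>m n)" "j < dim_col (1\<^sub>m n)"
    then have ij: "i < n" "j < n" by auto
    then have "(Bm * Gm) $$ (i, j) = (\<Sum>k\<in>{0..<n}. Bm $$ (i, k) * Gm $$ (k, j))"
      using c by (simp add: scalar_prod_def)
    also have "\<dots> = mm n ?B G i j" using ij by (simp add: mm_def B Gm_def atLeast0LessThan)
    finally show "(Bm * Gm) $$ (i, j) = 1\<^sub>m n $$ (i, j)" using inverse_onD(5)[OF G] ij by simp
  qed (use c in auto)
  have GB: "Gm * Bm = 1\<^sub>m n"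
  proof (rule eq_matI)
    fix i j assume "i < dim_row (1\<^sub>m n)" "j < dim_col (1\<^sub>m n)"
    then have ij: "i < n" "j < n" by auto
    then have "(Gm * Bm) $$ (i, j) = (\<Sum>k\<in>{0..<n}. Gm $$ (i, k) * Bm $$ (k, j))"
      using c by (simp add: scalar_prod_def)
    also have "\<dots> = mm n G ?B i j" using ij by (simp add: mm_def B Gm_def atLeast0LessThan)
    finally show "(Gm * Bm) $$ (i, j) = 1\<^sub>m n $$ (i, j)" using inverse_on_left[OF G sB] ij by simp
  qed (use c in auto)
  have "Bm \<in> Units (ring_mat TYPE(real) n ())"
    using c BG GB unfolding Units_def by (auto simp: ring_mat_simps)
  then obtain C where C: "mat_inverse Bm = Some C" using mat_inverse(1)[OF c(1), where b = "()"] by (cases "mat_inverse Bm") auto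
  note C' = mat_inverse(2)[OF c(1) C]
  have "C = C * (Bm * Gm)" unfolding BG using C' right_mult_one_mat[of C n n] by simp
  also have "\<dots> = (C * Bm) * Gm" using C' c assoc_mult_mat[of C n n Bm n Gm n] by metis
  also have "\<dots> = Gm" using C' c by simp
  finally show ?thesis using C A by (simp add: resolvent_def Bm_def Gm_def)
qed

section \<open>Centred resolvents of Wigner matrices\<close>

definition jmat :: "nat \<Rightarrow> (nat \<times> nat \<Rightarrow> real) \<Rightarrow> real mat" where
  "jmat n f = Matrix.mat n n (\<lambda>(i, j). entry n f i j)"

definition positive_at :: "nat \<Rightarrow> real \<Rightarrow> (nat \<times> nat \<Rightarrow> real) \<Rightarrow> bool" where
  "positive_at n z f \<longleftrightarrow> pivots_pos n (Bmat n z f) (rev [0..<n])"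

text \<open>\<open>centred_resolvent\<close> as a function of the entries, with the same value zero
  off the event.\<close>

definition centred :: "nat \<Rightarrow> real \<Rightarrow> (nat \<times> nat \<Rightarrow> real) \<Rightarrow> nat \<Rightarrow> nat \<Rightarrow> real" where
  "centred n z f i j =
     (if positive_at n z f
      then full_res n z f i j - (if i = j then tr n (full_res n z f) / real n else 0)
      else 0)"

lemma form_cong_mat:
  assumes "\<And>i j. i < n \<Longrightarrow> j < n \<Longrightarrow> B i j = C i j"
  shows "form n B x = form n C x"
  unfolding form_def dot_def mv_def using assms by (intro sum.cong refl arg_cong2[where f = "(*)"]) auto

lemma pd_cong:
  assumes "\<And>i j. i < n \<Longrightarrow> j < n \<Longrightarrow> B i j = C i j"
  shows "pd n B {..<n} = pd n C {..<n}"
  unfolding pd_full_iff using form_cong_mat[OF assms] by simp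

lemma inverse_on_cong:
  assumes "\<And>i j. i < n \<Longrightarrow> j < n \<Longrightarrow> B i j = C i j" "inverse_on n B {..<n} G"
  shows "inverse_on n C {..<n} G"
proof -
  have "mm n C G i j = mm n B G i j" if "i < n" for i j
    unfolding mm_def using that assms(1) by (intro sum.cong refl) auto
  then show ?thesis using assms(2) unfolding inverse_on_def by auto
qed

lemma positive_at_iff: "positive_at n z f \<longleftrightarrow> pd n (Bmat n z f) {..<n}"
  using res_correct(1)[of "Bmat n z f" "rev [0..<n]" n] symm_mat_Bmat
  by (simp add: positive_at_def atLeast0LessThan)

lemma centred_resolvent_jmat:
  assumes n: "n > 0"
  shows "largest_eigenvalue (jmat n f) < z \<longleftrightarrow> positive_at n z f"
    and "centred_resolvent z (jmat n f) = Matrix.mat n n (\<lambda>(i, j). centred n z f i j)"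
proof -
  let ?A = "jmat n f"
  let ?S = "shift z (\<lambda>i j. - mat_fun ?A i j)"
  have A: "?A \<in> carrier_mat n n" by (simp add: jmat_def)
  have sym: "transpose_mat ?A = ?A"
    unfolding jmat_def by (intro eq_matI) (auto simp: entry_commute)
  have mf: "mat_fun ?A i j = (if i < n \<and> j < n then entry n f i j else 0)" for i j
    by (simp add: mat_fun_def jmat_def)
  have smf: "symm_mat (mat_fun ?A)" by (auto simp: symm_mat_def mf entry_commute)
  have B: "?S i j = Bmat n z f i j" if "i < n" "j < n" for i j
    using that by (simp add: shift_def mf Bmat_def)
  show less: "largest_eigenvalue ?A < z \<longleftrightarrow> positive_at n z f"
    unfolding largest_eigenvalue_less_iff[OF A n sym] positive_at_iff by (rule pd_cong[OF B])
  show "centred_resolvent z ?A = Matrix.mat n n (\<lambda>(i, j). centred n z f i j)"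
  proof (cases "positive_at n z f")
    case True
    then have pd: "pd n (Bmat n z f) {..<n}" by (simp add: positive_at_iff)
    have "inverse_on n ?S {..<n} (full_res n z f)"
      by (rule inverse_on_cong[OF B[symmetric] full_res_inverse_on[OF pd]])
    then have res: "resolvent z ?A = Matrix.mat n n (\<lambda>(i, j). full_res n z f i j)"
      by (rule resolvent_eq[OF A smf])
    have t: "mat_trace (resolvent z ?A) = tr n (full_res n z f)"
      by (simp add: res mat_trace_def tr_def)
    have d: "dim_row ?A = n" using A by simp
    show ?thesis
      unfolding centred_resolvent_def using True less t d res
      by (intro eq_matI) (auto simp: centred_def)
  next
    case False
    then show ?thesis
      unfolding centred_resolvent_def using less A by (intro eq_matI) (auto simp: centred_def)
  qed
qed

lemma symm_mat_centred: "symm_mat (centred n z f)"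
proof (cases "positive_at n z f")
  case True
  then have "symm_mat (full_res n z f)"
    using inverse_onD(2)[OF full_res_inverse_on] by (simp add: positive_at_iff)
  then show ?thesis by (auto simp: symm_mat_def centred_def)
qed (auto simp: symm_mat_def centred_def)

lemma measurable_positive_at: "Measurable.pred (fam_space n) (positive_at n z)"
  unfolding positive_at_def[abs_def] by (rule measurable_pivots_pos) auto

lemma measurable_full_res: "(\<lambda>f. full_res n z f i j) \<in> borel_measurable (fam_space n)"
  unfolding full_res_def by (rule measurable_res) auto

lemma measurable_centred: "(\<lambda>f. centred n z f i j) \<in> borel_measurable (fam_space n)"
proof -
  have [measurable]: "(\<lambda>f. tr n (full_res n z f)) \<in> borel_measurable (fam_space n)"
    by (intro measurable_tr measurable_full_res)
  note [measurable] = measurable_positive_at measurable_full_res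
  show ?thesis unfolding centred_def by measurable
qed

subsection \<open>Sign symmetry\<close>

definition flip :: "nat \<Rightarrow> (nat \<Rightarrow> real) \<Rightarrow> (nat \<times> nat \<Rightarrow> real) \<Rightarrow> nat \<times> nat \<Rightarrow> real" where
  "flip n s f = (\<lambda>p\<in>pairs n. s (fst p) * s (snd p) * f p)"

lemma entry_flip: "i < n \<Longrightarrow> j < n \<Longrightarrow> entry n (flip n s f) i j = s i * s j * entry n f i j"
  using pair_of_in_pairs[of i n j] by (auto simp: entry_def flip_def pair_of_def min_def max_def)

context
  fixes n :: nat and s :: "nat \<Rightarrow> real"
  assumes s: "\<And>i. i < n \<Longrightarrow> s i \<in> {-1, 1}"
begin

lemma sign_square: "i < n \<Longrightarrow> s i * s i = 1"
  using s[of i] by auto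

lemma Bmat_flip: "i < n \<Longrightarrow> j < n \<Longrightarrow> Bmat n z (flip n s f) i j = s i * s j * Bmat n z f i j"
  using sign_square[of i] by (auto simp: Bmat_def entry_flip algebra_simps)

lemma form_flip: "form n (Bmat n z (flip n s f)) x = form n (Bmat n z f) (\<lambda>i. s i * x i)"
proof -
  have "form n (Bmat n z (flip n s f)) x = (\<Sum>i<n. \<Sum>j<n. x i * (Bmat n z (flip n s f) i j * x j))"
    by (simp add: form_def dot_def mv_def sum_distrib_left)
  also have "\<dots> = (\<Sum>i<n. \<Sum>j<n. (s i * x i) * (Bmat n z f i j * (s j * x j)))"
    by (intro sum.cong refl) (simp add: Bmat_flip)
  finally show ?thesis by (simp add: form_def dot_def mv_def sum_distrib_left)
qed

text \<open>Conjugation substitutes s x for x in the form, an involution that preserves nonzero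
  vectors.\<close>

lemma positive_at_flip: "positive_at n z (flip n s f) \<longleftrightarrow> positive_at n z f"
proof -
  have sx: "(\<lambda>i. s i * (s i * x i)) = (\<lambda>i. (s i * s i) * x i)" for x by (simp add: mult.assoc)
  have ff: "form n (Bmat n z f) x = form n (Bmat n z (flip n s f)) (\<lambda>i. s i * x i)" for x
  proof -
    have "form n (Bmat n z f) (\<lambda>i. s i * (s i * x i)) = form n (Bmat n z f) x"
      unfolding sx form_def dot_def mv_def by (intro sum.cong refl arg_cong2[where f = "(*)"]) (auto simp: sign_square)
    then show ?thesis by (simp add: form_flip)
  qed
  have nz: "(\<exists>i<n. s i * x i \<noteq> 0) \<longleftrightarrow> (\<exists>i<n. x i \<noteq> 0)" for x
    using s by fastforce
  show ?thesis
    unfolding positive_at_iff pd_full_iff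
  proof (intro iffI allI impI)
    fix x assume a: "\<forall>x. (\<exists>i<n. x i \<noteq> 0) \<longrightarrow> 0 < form n (Bmat n z (flip n s f)) x" and x: "\<exists>i<n. x i \<noteq> (0::real)"
    show "0 < form n (Bmat n z f) x"
      unfolding ff by (rule a[rule_format]) (simp only: nz x)
  next
    fix x assume a: "\<forall>x. (\<exists>i<n. x i \<noteq> 0) \<longrightarrow> 0 < form n (Bmat n z f) x" and x: "\<exists>i<n. x i \<noteq> (0::real)"
    show "0 < form n (Bmat n z (flip n s f)) x"
      unfolding form_flip by (rule a[rule_format]) (simp only: nz x)
  qed
qed

text \<open>The conjugated resolvent inverts the conjugated matrix, and inverses are unique; the
  elimination recursion is never unfolded.\<close>

lemma full_res_flip:
  assumes pos: "positive_at n z f"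
  shows "full_res n z (flip n s f) i j = s i * s j * full_res n z f i j"
proof -
  let ?G = "full_res n z f"
  have G: "inverse_on n (Bmat n z f) {..<n} ?G"
    using pos by (intro full_res_inverse_on) (simp add: positive_at_iff)
  have "inverse_on n (Bmat n z (flip n s f)) {..<n} (\<lambda>i j. s i * s j * ?G i j)"
    unfolding inverse_on_def
  proof (intro conjI ballI allI impI)
    show "symm_mat (\<lambda>i j. s i * s j * ?G i j)"
      using inverse_onD(6)[OF G] by (simp add: symm_mat_def)
    show "s i * s j * ?G i j = 0" if "i \<notin> {..<n}" for i j using inverse_onD(3)[OF G that] by simp
    fix i j assume i: "i \<in> {..<n}"
    have "mm n (Bmat n z (flip n s f)) (\<lambda>i j. s i * s j * ?G i j) i j = (\<Sum>k<n. s i * s j * (Bmat n z f i k * ?G k j))"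
      unfolding mm_def
    proof (intro sum.cong refl)
      fix k assume k: "k \<in> {..<n}"
      have "Bmat n z (flip n s f) i k * (s k * s j * ?G k j) = (s k * s k) * (s i * s j * (Bmat n z f i k * ?G k j))"
        using i k by (simp add: Bmat_flip)
      also have "s k * s k = 1" using k sign_square by simp
      finally show "Bmat n z (flip n s f) i k * (s k * s j * ?G k j) = s i * s j * (Bmat n z f i k * ?G k j)"
        by simp
    qed
    also have "\<dots> = s i * s j * mm n (Bmat n z f) ?G i j" by (simp add: mm_def sum_distrib_left)
    also have "\<dots> = (if i = j then 1 else 0)"
      using inverse_onD(5)[OF G i, of j] sign_square[of i] i by auto
    finally show "mm n (Bmat n z (flip n s f)) (\<lambda>i j. s i * s j * ?G i j) i j = (if i = j then 1 else 0)" .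
  qed simp
  moreover have "inverse_on n (Bmat n z (flip n s f)) {..<n} (full_res n z (flip n s f))"
    using pos by (intro full_res_inverse_on) (simp only: positive_at_iff[symmetric] positive_at_flip)
  ultimately have "full_res n z (flip n s f) = (\<lambda>i j. s i * s j * ?G i j)"
    using inverse_on_unique symm_mat_Bmat by blast
  then show ?thesis by simp
qed

lemma centred_flip:
  assumes "i < n" "j < n"
  shows "centred n z (flip n s f) i j = s i * s j * centred n z f i j"
proof (cases "positive_at n z f")
  case True
  have "tr n (full_res n z (flip n s f)) = tr n (full_res n z f)"
    unfolding tr_def using full_res_flip[OF True] sign_square by (intro sum.cong refl) auto
  then show ?thesis
    using True full_res_flip[OF True, of i j] sign_square[OF assms(1)]
    by (auto simp: centred_def positive_at_flip algebra_simps)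
next
  case False
  then show ?thesis by (simp add: centred_def positive_at_flip)
qed

end

definition centred_entries :: "nat \<Rightarrow> real \<Rightarrow> (nat \<times> nat \<Rightarrow> real) \<Rightarrow> nat \<times> nat \<Rightarrow> real" where
  "centred_entries n z f = restrict (\<lambda>(i, j). centred n z f i j) ({..<n} \<times> {..<n})"

lemma measurable_centred_entries: "centred_entries n z \<in> measurable (fam_space n) (entry_space n)"
  unfolding centred_entries_def[abs_def] entry_space_def
  by (intro measurable_restrict) (auto simp: case_prod_beta intro!: measurable_centred)

lemma mat_entries_centred: "mat_entries n (Matrix.mat n n (\<lambda>(i, j). centred n z f i j)) = centred_entries n z f"
  by (auto simp: mat_entries_def centred_entries_def restrict_def fun_eq_iff)

lemma measurable_flip: "flip n s \<in> measurable (fam_space n) (fam_space n)"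
  unfolding flip_def[abs_def] by (intro measurable_restrict) measurable

context wigner
begin

lemma distr_flip_fam:
  assumes sym: "\<And>p. p \<in> pairs n \<Longrightarrow> distr M borel (X p) = distr M borel (\<lambda>\<omega>. - X p \<omega>)"
    and s: "\<And>i. i < n \<Longrightarrow> s i \<in> {-1, 1}"
  shows "distr M (fam_space n) (\<lambda>\<omega>. flip n s (fam \<omega>)) = distr M (fam_space n) fam"
proof -
  let ?c = "\<lambda>p. s (fst p) * s (snd p)"
  have ne: "pairs n \<noteq> {}" using n_pos by (auto simp: pairs_def)
  have rv: "random_variable borel (X p)" if "p \<in> pairs n" for p using X_measurable[OF that] .
  have ind: "indep_vars (\<lambda>_. borel) (\<lambda>p \<omega>. ?c p * X p \<omega>) (pairs n)"
    by (rule indep_vars_compose2[OF indep_X]) measurable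
  have rv': "random_variable borel (\<lambda>\<omega>. ?c p * X p \<omega>)" if "p \<in> pairs n" for p using rv[OF that] by simp
  have "flip n s (fam \<omega>) = (\<lambda>p\<in>pairs n. ?c p * X p \<omega>)" for \<omega>
    by (auto simp: flip_def fam_def fun_eq_iff)
  then have "distr M (fam_space n) (\<lambda>\<omega>. flip n s (fam \<omega>)) = PiM (pairs n) (\<lambda>p. distr M borel (\<lambda>\<omega>. ?c p * X p \<omega>))"
    using ind indep_vars_iff_distr_eq_PiM'[OF ne rv'] by simp
  also have "\<dots> = PiM (pairs n) (\<lambda>p. distr M borel (X p))"
  proof (intro PiM_cong refl)
    fix p assume p: "p \<in> pairs n"
    then have "fst p < n" "snd p < n" by (auto simp: pairs_def)
    then have "?c p = 1 \<or> ?c p = -1" using s[of "fst p"] s[of "snd p"] by auto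
    then show "distr M borel (\<lambda>\<omega>. ?c p * X p \<omega>) = distr M borel (X p)"
      using sym[OF p] by auto
  qed
  also have "\<dots> = distr M (fam_space n) fam"
    using indep_X indep_vars_iff_distr_eq_PiM'[OF ne rv] by (simp add: fam_def[abs_def])
  finally show ?thesis .
qed

text \<open>Conjugation by a fixed sign vector already preserves the law; integrating over the
  random signs then leaves it unchanged.\<close>

lemma mat_law_sign_invariant:
  assumes sym: "\<And>p. p \<in> pairs n \<Longrightarrow> distr M borel (X p) = distr M borel (\<lambda>\<omega>. - X p \<omega>)"
    and C: "\<And>\<omega>. \<omega> \<in> space M \<Longrightarrow> C \<omega> = Matrix.mat n n (\<lambda>(i, j). centred n z (fam \<omega>) i j)"
  shows "random_mat n M C"
    and "mat_law n M C = mat_law n (M \<Otimes>\<^sub>M sign_measure n) (\<lambda>(\<omega>, s). mat_diag n s * C \<omega> * mat_diag n s)"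
proof -
  let ?E = "entry_space n" and ?S = "sign_measure n"
  let ?h = "centred_entries n z"
  have ent: "mat_entries n (C \<omega>) = ?h (fam \<omega>)" if "\<omega> \<in> space M" for \<omega>
    using C[OF that] mat_entries_centred by simp
  have hm: "(\<lambda>\<omega>. ?h (fam \<omega>)) \<in> measurable M ?E"
    using fam_measurable measurable_centred_entries by (rule measurable_compose)
  show "random_mat n M C"
    unfolding random_mat_def
  proof (intro conjI ballI)
    show "C \<omega> \<in> carrier_mat n n" if "\<omega> \<in> space M" for \<omega> using C[OF that] by simp
    have "(\<lambda>\<omega>. mat_entries n (C \<omega>)) \<in> measurable M ?E \<longleftrightarrow> (\<lambda>\<omega>. ?h (fam \<omega>)) \<in> measurable M ?E"
      by (rule measurable_cong[OF ent])
    then show "(\<lambda>\<omega>. mat_entries n (C \<omega>)) \<in> measurable M ?E" using hm by simp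
  qed
  interpret S: prob_space ?S
    unfolding sign_measure_def by (intro prob_space_PiM measure_pmf.prob_space_axioms)
  interpret pair: pair_sigma_finite M ?S ..
  define H where "H = (\<lambda>(\<omega>, s). restrict (\<lambda>(i, j). s i * centred n z (fam \<omega>) i j * s j) ({..<n} \<times> {..<n}))"
  have cm: "(\<lambda>\<omega>. centred n z (fam \<omega>) i j) \<in> borel_measurable M" for i j
    using fam_measurable measurable_centred by (rule measurable_compose)
  have sm: "(\<lambda>s. s i) \<in> borel_measurable ?S" if "i < n" for i
  proof -
    have "(\<lambda>s. s i) \<in> measurable ?S (measure_pmf (pmf_of_set {-1, 1 :: real}))"
      unfolding sign_measure_def using that by (intro measurable_component_singleton) auto
    moreover have "(\<lambda>x. x) \<in> borel_measurable (measure_pmf (pmf_of_set {-1, 1 :: real}))" by simp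
    ultimately show ?thesis by (rule measurable_compose)
  qed
  have Hm: "H \<in> measurable (M \<Otimes>\<^sub>M ?S) ?E"
    unfolding H_def entry_space_def case_prod_beta
  proof (intro measurable_restrict)
    fix p assume "p \<in> {..<n} \<times> {..<n}"
    then have p: "fst p < n" "snd p < n" by auto
    note [measurable] = cm sm[OF p(1)] sm[OF p(2)]
    show "(\<lambda>x. snd x (fst p) * centred n z (fam (fst x)) (fst p) (snd p) * snd x (snd p)) \<in> borel_measurable (M \<Otimes>\<^sub>M ?S)"
      by measurable
  qed
  have He: "mat_entries n (mat_diag n s * C \<omega> * mat_diag n s) = H (\<omega>, s)" if "\<omega> \<in> space M" for \<omega> s
  proof -
    have c: "C \<omega> \<in> carrier_mat n n" using C[OF that] by simp
    have "mat_diag n s * C \<omega> * mat_diag n s = Matrix.mat n n (\<lambda>(i, j). s i * centred n z (fam \<omega>) i j * s j)"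
      unfolding mat_diag_mult_left[OF c] by (subst mat_diag_mult_right[of _ n n]) (auto simp: C[OF that] intro!: eq_matI)
    then show ?thesis by (auto simp: mat_entries_def H_def restrict_def fun_eq_iff)
  qed
  have law1: "mat_law n M C = distr M ?E (\<lambda>\<omega>. ?h (fam \<omega>))"
    unfolding mat_law_def by (intro distr_cong refl ent)
  have law2: "mat_law n (M \<Otimes>\<^sub>M ?S) (\<lambda>(\<omega>, s). mat_diag n s * C \<omega> * mat_diag n s) = distr (M \<Otimes>\<^sub>M ?S) ?E H"
    unfolding mat_law_def using He by (intro distr_cong refl) (auto simp: space_pair_measure)
  have "distr (M \<Otimes>\<^sub>M ?S) ?E H = distr M ?E (\<lambda>\<omega>. ?h (fam \<omega>))"
  proof (rule measure_eqI)
    fix A assume "A \<in> sets (distr (M \<Otimes>\<^sub>M ?S) ?E H)"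
    then have A: "A \<in> sets ?E" by simp
    let ?c = "emeasure (distr M ?E (\<lambda>\<omega>. ?h (fam \<omega>))) A"
    have "emeasure (distr (M \<Otimes>\<^sub>M ?S) ?E H) A = emeasure (M \<Otimes>\<^sub>M ?S) (H -` A \<inter> space (M \<Otimes>\<^sub>M ?S))"
      by (rule emeasure_distr[OF Hm A])
    also have "\<dots> = (\<integral>\<^sup>+s. emeasure M ((\<lambda>\<omega>. (\<omega>, s)) -` (H -` A \<inter> space (M \<Otimes>\<^sub>M ?S))) \<partial>?S)"
      by (rule pair.emeasure_pair_measure_alt2) (rule measurable_sets[OF Hm A])
    also have "\<dots> = (\<integral>\<^sup>+s. ?c \<partial>?S)"
    \<comment> \<open>The space of \<open>sign_measure\<close> holds all real families on the index
      set; their values are signs only almost surely.\<close>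
    proof (rule nn_integral_cong_AE)
      have "AE s in ?S. s i \<in> {-1, 1}" if "i < n" for i
        unfolding sign_measure_def
      proof (rule AE_PiM_component)
        show "AE x in measure_pmf (pmf_of_set {-1, 1 :: real}). x \<in> {-1, 1}"
          using AE_measure_pmf[of "pmf_of_set {-1, 1 :: real}"] by (simp add: set_pmf_of_set)
      qed (use that in \<open>auto intro: measure_pmf.prob_space_axioms\<close>)
      then have "AE s in ?S. \<forall>i\<in>{..<n}. s i \<in> {-1, 1}" by (intro AE_finite_allI) auto
      then show "AE s in ?S. emeasure M ((\<lambda>\<omega>. (\<omega>, s)) -` (H -` A \<inter> space (M \<Otimes>\<^sub>M ?S))) = ?c"
        using AE_space
      proof eventually_elim
        case (elim s)
        then have s: "\<And>i. i < n \<Longrightarrow> s i \<in> {-1, 1}" by auto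
        have Hs: "H (\<omega>, s) = ?h (flip n s (fam \<omega>))" for \<omega>
          using centred_flip[OF s] by (auto simp: H_def centred_entries_def restrict_def fun_eq_iff)
        have fm: "(\<lambda>\<omega>. flip n s (fam \<omega>)) \<in> measurable M (fam_space n)"
          using fam_measurable measurable_flip by (rule measurable_compose)
        have "(\<lambda>\<omega>. (\<omega>, s)) -` (H -` A \<inter> space (M \<Otimes>\<^sub>M ?S)) = (\<lambda>\<omega>. ?h (flip n s (fam \<omega>))) -` A \<inter> space M"
          using elim(2) by (auto simp: Hs space_pair_measure)
        then have "emeasure M ((\<lambda>\<omega>. (\<omega>, s)) -` (H -` A \<inter> space (M \<Otimes>\<^sub>M ?S))) =
            emeasure (distr M ?E (\<lambda>\<omega>. ?h (flip n s (fam \<omega>)))) A"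
          using measurable_compose[OF fm measurable_centred_entries] A by (simp add: emeasure_distr)
        also have "distr M ?E (\<lambda>\<omega>. ?h (flip n s (fam \<omega>))) = distr (distr M (fam_space n) (\<lambda>\<omega>. flip n s (fam \<omega>))) ?E ?h"
          by (simp add: distr_distr[OF measurable_centred_entries fm] comp_def)
        also have "\<dots> = distr (distr M (fam_space n) fam) ?E ?h" using distr_flip_fam[OF sym s] by simp
        also have "\<dots> = distr M ?E (\<lambda>\<omega>. ?h (fam \<omega>))"
          by (simp add: distr_distr[OF measurable_centred_entries fam_measurable] comp_def)
        finally show ?case .
      qed
    qed
    also have "\<dots> = ?c" by (simp add: S.emeasure_space_1)
    finally show "emeasure (distr (M \<Otimes>\<^sub>M ?S) ?E H) A = ?c" .
  qed simp
  then show "mat_law n M C = mat_law n (M \<Otimes>\<^sub>M ?S) (\<lambda>(\<omega>, s). mat_diag n s * C \<omega> * mat_diag n s)"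
    by (simp only: law1 law2)
qed

end

subsection \<open>The operator norm\<close>

lemma op_norm_le_iff:
  assumes c: "c \<ge> 0"
  shows "op_norm (Matrix.mat n n (\<lambda>(i, j). a i j)) \<le> c \<longleftrightarrow> (\<forall>x. dot n (mv n a x) (mv n a x) \<le> c\<^sup>2 * dot n x x)"
proof -
  let ?A = "Matrix.mat n n (\<lambda>(i, j). a i j)"
  let ?U = "{v \<in> carrier_vec n. vec_norm2 v \<le> 1}"
  have nrm: "vec_norm2 v = sqrt (dot n (vec_index v) (vec_index v))" if "v \<in> carrier_vec n" for v
    using that by (simp add: vec_norm2_def scalar_prod_def dot_def atLeast0LessThan)
  have Av: "vec_norm2 (?A *\<^sub>v v) = sqrt (dot n (mv n a (vec_index v)) (mv n a (vec_index v)))" if "v \<in> carrier_vec n" for v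
  proof -
    have "vec_index (?A *\<^sub>v v) i = mv n a (vec_index v) i" if "i < n" for i
      using that \<open>v \<in> carrier_vec n\<close> by (simp add: scalar_prod_def mv_def atLeast0LessThan)
    then have "dot n (vec_index (?A *\<^sub>v v)) (vec_index (?A *\<^sub>v v)) = dot n (mv n a (vec_index v)) (mv n a (vec_index v))"
      by (intro dot_cong) auto
    moreover have "?A *\<^sub>v v \<in> carrier_vec n" using that by (intro mult_mat_vec_carrier[of _ n n]) auto
    ultimately show ?thesis using nrm[of "?A *\<^sub>v v"] by simp
  qed
  have op: "op_norm ?A = (SUP v\<in>?U. vec_norm2 (?A *\<^sub>v v))" by (simp add: op_norm_def)
  have U0: "0\<^sub>v n \<in> ?U" by (simp add: vec_norm2_def)
  have sq: "dot n (mv n a x) (mv n a x) = form n (mm n (\<lambda>i j. a j i) a) x" for x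
  proof -
    have "form n (mm n (\<lambda>i j. a j i) a) x = (\<Sum>i<n. \<Sum>j<n. x i * (a j i * mv n a x j))"
      by (simp add: form_def mv_mm dot_def mv_def[of n "\<lambda>i j. a j i"] sum_distrib_left)
    also have "\<dots> = (\<Sum>j<n. \<Sum>i<n. x i * (a j i * mv n a x j))" by (rule sum.swap)
    also have "\<dots> = (\<Sum>j<n. mv n a x j * mv n a x j)"
      by (simp add: mv_def[of n a] sum_distrib_right mult_ac)
    finally show ?thesis by (simp add: dot_def)
  qed
  \<comment> \<open>A real supremum is informative only over a bounded set; the crude bound on the
    form of the transpose times a provides this.\<close>
  define K where "K = (\<Sum>i<n. \<Sum>j<n. \<bar>mm n (\<lambda>i j. a j i) a i j\<bar>)"
  have K0: "K \<ge> 0" by (simp add: K_def sum_nonneg)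
  have bdd: "bdd_above ((\<lambda>v. vec_norm2 (?A *\<^sub>v v)) ` ?U)"
  proof (rule bdd_aboveI2)
    fix v assume v: "v \<in> ?U"
    then have "dot n (vec_index v) (vec_index v) \<le> 1" using nrm[of v] by simp
    then have "K * dot n (vec_index v) (vec_index v) \<le> K" using K0 by (simp add: mult_left_le)
    then have "dot n (mv n a (vec_index v)) (mv n a (vec_index v)) \<le> K"
      using form_abs_le[of n "mm n (\<lambda>i j. a j i) a" "vec_index v"] by (simp add: sq K_def)
    then show "vec_norm2 (?A *\<^sub>v v) \<le> sqrt K" using v by (simp add: Av)
  qed
  show ?thesis
  proof
    assume le: "op_norm ?A \<le> c"
    show "\<forall>x. dot n (mv n a x) (mv n a x) \<le> c\<^sup>2 * dot n x x"
    proof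
      fix x
      show "dot n (mv n a x) (mv n a x) \<le> c\<^sup>2 * dot n x x"
      proof (cases "\<exists>i<n. x i \<noteq> 0")
        case True
        define l where "l = sqrt (dot n x x)"
        have l: "l > 0" "l\<^sup>2 = dot n x x" using dot_self_pos[OF True] by (simp_all add: l_def)
        define v where "v = Matrix.vec n (\<lambda>i. (1 / l) * x i)"
        have v: "v \<in> carrier_vec n" by (simp add: v_def)
        have "dot n (vec_index v) (vec_index v) = dot n (\<lambda>i. (1 / l) * x i) (\<lambda>i. (1 / l) * x i)"
          by (intro dot_cong) (simp_all add: v_def)
        also have "\<dots> = 1"
          unfolding dot_scale_left dot_scale_right l(2)[symmetric] using l(1) by (simp add: power2_eq_square)
        finally have "v \<in> ?U" using v by (simp add: nrm)
        then have "vec_norm2 (?A *\<^sub>v v) \<le> c" using cSUP_upper[OF _ bdd, of v] le op by simp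
        then have "dot n (mv n a (vec_index v)) (mv n a (vec_index v)) \<le> c\<^sup>2"
          using c by (simp add: Av[OF v] sqrt_le_D)
        also have "mv n a (vec_index v) = mv n a (\<lambda>i. (1 / l) * x i)" by (rule mv_cong) (simp add: v_def)
        also have "\<dots> = (\<lambda>i. (1 / l) * mv n a x i)" by (rule mv_scale)
        finally have "(1 / l) * ((1 / l) * dot n (mv n a x) (mv n a x)) \<le> c\<^sup>2"
          by (simp only: dot_scale_left dot_scale_right)
        then have "dot n (mv n a x) (mv n a x) / l\<^sup>2 \<le> c\<^sup>2" by (simp add: power2_eq_square)
        then show ?thesis unfolding l(2) using dot_self_pos[OF True] by (simp add: pos_divide_le_eq)
      next
        case False
        then have "mv n a x = (\<lambda>i. 0)" by (simp add: mv_def)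
        then show ?thesis by (simp add: dot_def sum_nonneg)
      qed
    qed
  next
    assume le: "\<forall>x. dot n (mv n a x) (mv n a x) \<le> c\<^sup>2 * dot n x x"
    show "op_norm ?A \<le> c"
      unfolding op
    proof (rule cSUP_least)
      fix v assume v: "v \<in> ?U"
      then have "dot n (vec_index v) (vec_index v) \<le> 1" using nrm[of v] by simp
      then have "c\<^sup>2 * dot n (vec_index v) (vec_index v) \<le> c\<^sup>2" by (simp add: mult_left_le)
      then have "dot n (mv n a (vec_index v)) (mv n a (vec_index v)) \<le> c\<^sup>2" using le[rule_format, of "vec_index v"] by linarith
      then show "vec_norm2 (?A *\<^sub>v v) \<le> c" using v c by (simp add: Av real_le_lsqrt real_sqrt_le_iff' real_sqrt_unique)
    qed (use U0 in blast)
  qed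
qed

text \<open>
  The operator norm is a supremum over an uncountable set; positive definiteness of
  \<open>c\<^sup>2 + 1 / (k + 1) - a\<^sup>2\<close> for all \<open>k\<close> is a countable condition on pivots.
\<close>

lemma measurable_op_norm_le:
  fixes a :: "'q \<Rightarrow> nat \<Rightarrow> nat \<Rightarrow> real"
  assumes a: "\<And>i j. (\<lambda>f. a f i j) \<in> borel_measurable Q" and sym: "\<And>f. symm_mat (a f)" and c: "c \<ge> 0"
  shows "Measurable.pred Q (\<lambda>f. op_norm (Matrix.mat n n (\<lambda>(i, j). a f i j)) \<le> c)"
proof -
  define B where "B k f = shift (c\<^sup>2 + 1 / real (Suc k)) (\<lambda>i j. - mm n (a f) (a f) i j)" for k f
  have fB: "form n (B k f) x = (c\<^sup>2 + 1 / real (Suc k)) * dot n x x - dot n (mv n (a f) x) (mv n (a f) x)" for k f x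
    by (simp add: B_def form_shift form_neg form_mm_self[OF sym])
  have sB: "symm_mat (B k f)" for k f
    unfolding B_def using symm_mat_mm_self[OF sym] by (intro symm_mat_shift) (simp add: symm_mat_def)
  have eq: "op_norm (Matrix.mat n n (\<lambda>(i, j). a f i j)) \<le> c \<longleftrightarrow> (\<forall>k. pivots_pos n (B k f) (rev [0..<n]))" for f
  proof -
    have "pivots_pos n (B k f) (rev [0..<n]) \<longleftrightarrow> pd n (B k f) {..<n}" for k
      using res_correct(1)[OF sB, of "rev [0..<n]" n] by (simp add: atLeast0LessThan)
    moreover have "(\<forall>k. pd n (B k f) {..<n}) \<longleftrightarrow> (\<forall>x. dot n (mv n (a f) x) (mv n (a f) x) \<le> c\<^sup>2 * dot n x x)"
    proof
      assume pd: "\<forall>k. pd n (B k f) {..<n}"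
      show "\<forall>x. dot n (mv n (a f) x) (mv n (a f) x) \<le> c\<^sup>2 * dot n x x"
      proof
        fix x
        show "dot n (mv n (a f) x) (mv n (a f) x) \<le> c\<^sup>2 * dot n x x"
        proof (cases "\<exists>i<n. x i \<noteq> 0")
          case True
          have "dot n (mv n (a f) x) (mv n (a f) x) \<le> c\<^sup>2 * dot n x x + dot n x x * (1 / real (Suc k))" for k
            using pd True fB[of k f x] unfolding pd_full_iff by (smt (verit) distrib_right mult.commute)
          moreover have "(\<lambda>k. c\<^sup>2 * dot n x x + dot n x x * (1 / real (Suc k))) \<longlonglongrightarrow> c\<^sup>2 * dot n x x + dot n x x * 0"
            by (intro tendsto_intros LIMSEQ_Suc[OF lim_1_over_n])
          ultimately show ?thesis by (intro LIMSEQ_le_const[of _ "c\<^sup>2 * dot n x x"]) auto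
        next
          case False
          then have "mv n (a f) x = (\<lambda>i. 0)" by (simp add: mv_def)
          then show ?thesis by (simp add: dot_def sum_nonneg)
        qed
      qed
    next
      assume le: "\<forall>x. dot n (mv n (a f) x) (mv n (a f) x) \<le> c\<^sup>2 * dot n x x"
      show "\<forall>k. pd n (B k f) {..<n}"
        unfolding pd_full_iff
      proof (intro allI impI)
        fix k x assume "\<exists>i<n. x i \<noteq> (0::real)"
        then have "1 / real (Suc k) * dot n x x > 0" using dot_self_pos by simp
        then show "form n (B k f) x > 0" using le[rule_format, of x] unfolding fB distrib_right by linarith
      qed
    qed
    ultimately show ?thesis using op_norm_le_iff[OF c, of n "a f"] by simp
  qed
  have "Measurable.pred Q (\<lambda>f. pivots_pos n (B k f) (rev [0..<n]))" for k
  proof (rule measurable_pivots_pos_family)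
    show "(\<lambda>f. B k f i j) \<in> borel_measurable Q" for i j
      unfolding B_def shift_def using measurable_mm[OF a a, of n] by simp
  qed auto
  then show ?thesis unfolding eq by measurable
qed

section \<open>Events of high probability\<close>

lemma whpI:
  assumes ev: "\<forall>\<^sub>F N in sequentially. prob_space (P N) \<and> {\<omega> \<in> space (P N). E N \<omega>} \<in> sets (P N) \<and>
      measure (P N) {\<omega> \<in> space (P N). \<not> E N \<omega>} \<le> b N"
    and b: "b \<longlonglongrightarrow> 0"
  shows "whp P E"
  unfolding whp_def
proof (rule tendsto_sandwich[of "\<lambda>N. 1 - b N" _ _ "\<lambda>_. 1"])
  show "\<forall>\<^sub>F N in sequentially. 1 - b N \<le> measure (P N) {\<omega> \<in> space (P N). E N \<omega>}"
    using ev
  proof eventually_elim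
    case (elim N)
    then interpret prob_space "P N" by simp
    have "{\<omega> \<in> space (P N). \<not> E N \<omega>} = space (P N) - {\<omega> \<in> space (P N). E N \<omega>}" by auto
    then show ?case using elim prob_compl[of "{\<omega> \<in> space (P N). E N \<omega>}"] by simp
  qed
  show "\<forall>\<^sub>F N in sequentially. measure (P N) {\<omega> \<in> space (P N). E N \<omega>} \<le> 1"
    using ev by eventually_elim (simp add: prob_space.prob_le_1)
  show "(\<lambda>N. 1 - b N) \<longlonglongrightarrow> 1" using tendsto_diff[OF tendsto_const b, of 1] by simp
qed simp

text \<open>\<open>measure\<close> is 0 on non-measurable sets, so the larger event has to be shown
  measurable; hence the measurability proofs for the events of the theorem.\<close>

lemma whp_mono:
  assumes E: "whp P E"
    and ev: "\<forall>\<^sub>F N in sequentially. prob_space (P N) \<and> {\<omega> \<in> space (P N). F N \<omega>} \<in> sets (P N) \<and>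
      (\<forall>\<omega>\<in>space (P N). E N \<omega> \<longrightarrow> F N \<omega>)"
  shows "whp P F"
  unfolding whp_def
proof (rule tendsto_sandwich[of "\<lambda>N. measure (P N) {\<omega> \<in> space (P N). E N \<omega>}" _ _ "\<lambda>_. 1"])
  show "\<forall>\<^sub>F N in sequentially. measure (P N) {\<omega> \<in> space (P N). E N \<omega>} \<le> measure (P N) {\<omega> \<in> space (P N). F N \<omega>}"
    using ev
  proof eventually_elim
    case (elim N)
    then interpret prob_space "P N" by simp
    show ?case using elim by (intro finite_measure_mono) auto
  qed
  show "\<forall>\<^sub>F N in sequentially. measure (P N) {\<omega> \<in> space (P N). F N \<omega>} \<le> 1"
    using ev by eventually_elim (simp add: prob_space.prob_le_1)
qed (use E in \<open>simp_all add: whp_def\<close>)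

definition regular :: "nat \<Rightarrow> real \<Rightarrow> real \<Rightarrow> (nat \<times> nat \<Rightarrow> real) \<Rightarrow> bool" where
  "regular n h \<epsilon> f \<longleftrightarrow> stay n h n f \<and> small_deviations n (2 + 4 * h) (real n powr (- 1 / 2 + \<epsilon>)) f"

text \<open>The walk ends at level lam - h with normalised trace at most 1 + h; raising the
  parameter by the remaining h only lowers the trace.\<close>

lemma regularD:
  assumes n: "n > 0" and h: "h > 0" and lam: "lam = 2 + 4 * h" and r: "regular n h \<epsilon> f"
  shows "pd n (Bmat n (lam - h) f) {..<n}" "tr n (full_res n lam f) / real n \<le> 1 + h"
    "small_deviations n lam (real n powr (- 1 / 2 + \<epsilon>)) f" "positive_at n lam f"
proof -
  have st: "stay n h n f" using r by (simp add: regular_def)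
  have lv: "level n h n = lam - h" using n by (simp add: level_def lam)
  show pd: "pd n (Bmat n (lam - h) f) {..<n}" using stay_pd[OF n h order_refl st] by (simp only: lv)
  have B: "Bmat n lam f = shift h (Bmat n (lam - h) f)" using Bmat_shift[of n "lam - h" h f] by simp
  have pd': "pd n (Bmat n lam f) {..<n}" unfolding B using pd h by (intro pd_shift) auto
  then show "positive_at n lam f" by (simp add: positive_at_iff)
  have I: "inverse_on n (Bmat n (lam - h) f) {..<n} (full_res n (lam - h) f)"
    and I': "inverse_on n (shift h (Bmat n (lam - h) f)) {..<n} (full_res n lam f)"
    using full_res_inverse_on[OF pd] full_res_inverse_on[OF pd'] by (simp_all only: B)
  have "tr n (full_res n lam f) + h * tr n (mm n (full_res n lam f) (full_res n lam f)) \<le> tr n (full_res n (lam - h) f)"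
    using h by (intro tr_shift_le[OF symm_mat_Bmat I I' pd]) simp
  moreover have "tr n (mm n (full_res n lam f) (full_res n lam f)) \<ge> 0"
    using tr_inverse_on_nonneg(2)[OF full_res_inverse_on[OF pd'] pd'] .
  ultimately have le: "tr n (full_res n lam f) \<le> tr n (full_res n (lam - h) f)"
    using h by (smt (verit) mult_nonneg_nonneg)
  have "block n h n f = full_res n (lam - h) f" by (simp add: block_def full_res_def lv)
  then have "tr n (full_res n (lam - h) f) / real n \<le> 1 + h"
    using stay_in_range[OF h st] n by (simp add: in_range_def block_tr_def)
  then show "tr n (full_res n lam f) / real n \<le> 1 + h"
    using le divide_right_mono[OF le, of "real n"] by simp
  show "small_deviations n lam (real n powr (- 1 / 2 + \<epsilon>)) f" using r by (simp add: regular_def lam)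
qed

lemma measurable_small_deviations: "Measurable.pred (fam_space n) (small_deviations n z e)"
proof -
  have H: "(\<lambda>f. minor n z i f a b) \<in> borel_measurable (fam_space n)" for i a b
    unfolding minor_def by (rule measurable_res) auto
  have HH: "(\<lambda>f. mm n (minor n z i f) (minor n z i f) a b) \<in> borel_measurable (fam_space n)" for i a b
    by (intro measurable_mm H)
  have c: "(\<lambda>f. column n z i f j) \<in> borel_measurable (fam_space n)" if "i < n" "j < n" for i j
    unfolding column_def using that by (intro borel_measurable_uminus measurable_Bmat)
  have pred_abs_le: "Measurable.pred (fam_space n) (\<lambda>f. \<bar>u f\<bar> \<le> e)" if "u \<in> borel_measurable (fam_space n)" for u
    using that by measurable
  have P: "Measurable.pred (fam_space n) (\<lambda>f. \<bar>entry n f i i\<bar> \<le> e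
     \<and> \<bar>form n (minor n z i f) (column n z i f) - tr n (minor n z i f) / real n\<bar> \<le> e
     \<and> \<bar>form n (mm n (minor n z i f) (minor n z i f)) (column n z i f)
          - tr n (mm n (minor n z i f) (minor n z i f)) / real n\<bar> \<le> e
     \<and> (\<forall>j\<in>{..<n}. \<bar>mv n (minor n z i f) (column n z i f) j\<bar> \<le> e
          \<and> \<bar>mv n (mm n (minor n z i f) (minor n z i f)) (column n z i f) j\<bar> \<le> e))" if i: "i \<in> {..<n}" for i
  proof -
    have ms: "(\<lambda>f. entry n f i i) \<in> borel_measurable (fam_space n)"
      "(\<lambda>f. form n (minor n z i f) (column n z i f)) \<in> borel_measurable (fam_space n)"
      "(\<lambda>f. tr n (minor n z i f)) \<in> borel_measurable (fam_space n)"
      "(\<lambda>f. form n (mm n (minor n z i f) (minor n z i f)) (column n z i f)) \<in> borel_measurable (fam_space n)"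
      "(\<lambda>f. tr n (mm n (minor n z i f) (minor n z i f))) \<in> borel_measurable (fam_space n)"
      "(\<lambda>f. mv n (minor n z i f) (column n z i f) j) \<in> borel_measurable (fam_space n)"
      "(\<lambda>f. mv n (mm n (minor n z i f) (minor n z i f)) (column n z i f) j) \<in> borel_measurable (fam_space n)" for j
      using i by (auto intro!: measurable_entry measurable_form measurable_tr measurable_mv H HH c)
    show ?thesis
      by (intro pred_intros_logic pred_intros_finite finite_lessThan pred_abs_le borel_measurable_diff
          borel_measurable_divide borel_measurable_const ms)
  qed
  have "Measurable.pred (fam_space n) (\<lambda>f. \<forall>i\<in>{..<n}. \<bar>entry n f i i\<bar> \<le> e
     \<and> \<bar>form n (minor n z i f) (column n z i f) - tr n (minor n z i f) / real n\<bar> \<le> e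
     \<and> \<bar>form n (mm n (minor n z i f) (minor n z i f)) (column n z i f)
          - tr n (mm n (minor n z i f) (minor n z i f)) / real n\<bar> \<le> e
     \<and> (\<forall>j\<in>{..<n}. \<bar>mv n (minor n z i f) (column n z i f) j\<bar> \<le> e
          \<and> \<bar>mv n (mm n (minor n z i f) (minor n z i f)) (column n z i f) j\<bar> \<le> e))"
    using P by (intro pred_intros_finite) auto
  then show ?thesis
    unfolding small_deviations_def[abs_def] Ball_def lessThan_iff .
qed

lemma measurable_regular: "Measurable.pred (fam_space n) (regular n h \<epsilon>)"
proof -
  note [measurable] = measurable_stay[OF order_refl, of n h] measurable_small_deviations
  show ?thesis unfolding regular_def[abs_def] by measurable
qed

text \<open>The moment over the power of the threshold is of order n to the power - 2 * Suc p *
  \<epsilon>, at most n^(-3), against at most 5 * n^2 events.\<close>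

lemma deviation_rate:
  fixes D \<epsilon> :: real
  assumes n: "n > 0" and D: "D \<ge> 0" and p: "2 * real (Suc p) * \<epsilon> \<ge> 3"
  shows "real n * (3 + 2 * real n) * (D / real n ^ Suc p / (real n powr (- 1 / 2 + \<epsilon>)) ^ (2 * Suc p)) \<le> 5 * D / real n"
proof -
  have N: "real n \<ge> 1" using n by simp
  have "(real n powr (- 1 / 2 + \<epsilon>)) ^ (2 * Suc p) = real n powr ((- 1 / 2 + \<epsilon>) * real (2 * Suc p))"
    using n by (subst powr_realpow[symmetric]) (simp_all only: powr_powr powr_gt_zero of_nat_0_less_iff of_nat_eq_0_iff)
  moreover have "real n ^ Suc p = real n powr (real (Suc p))"
    using n by (subst powr_realpow) simp_all
  ultimately have "real n ^ Suc p * (real n powr (- 1 / 2 + \<epsilon>)) ^ (2 * Suc p) =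
      real n powr (real (Suc p)) * real n powr ((- 1 / 2 + \<epsilon>) * real (2 * Suc p))" by simp
  also have "\<dots> = real n powr (2 * real (Suc p) * \<epsilon>)"
    unfolding powr_add[symmetric] by (rule arg_cong[where f = "\<lambda>x. real n powr x"]) (simp add: field_simps)
  also have "\<dots> \<ge> real n powr 3" using N p by (intro powr_mono) auto
  finally have ge: "real n ^ Suc p * (real n powr (- 1 / 2 + \<epsilon>)) ^ (2 * Suc p) \<ge> real n ^ 3"
    using N by simp
  have "D / real n ^ Suc p / (real n powr (- 1 / 2 + \<epsilon>)) ^ (2 * Suc p) \<le> D / real n ^ 3"
    unfolding divide_divide_eq_left using ge D N by (intro divide_left_mono mult_pos_pos zero_less_power) auto
  then have "real n * (3 + 2 * real n) * (D / real n ^ Suc p / (real n powr (- 1 / 2 + \<epsilon>)) ^ (2 * Suc p)) \<le>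
      real n * (5 * real n) * (D / real n ^ 3)"
    using N D by (intro mult_mono) auto
  also have "\<dots> = 5 * D / real n" using N by (simp add: power3_eq_cube)
  finally show ?thesis .
qed

lemma whp_regular:
  assumes wig: "\<And>N. N > 0 \<Longrightarrow> wigner (P N) N (X N) \<kappa>" and h: "h > 0" and \<epsilon>: "\<epsilon> > 0"
  shows "whp P (\<lambda>N \<omega>. regular N h \<epsilon> (\<lambda>p\<in>pairs N. X N p \<omega>))"
proof -
  obtain p :: nat where p: "3 / (2 * \<epsilon>) \<le> real p" using real_arch_simple by blast
  have "3 / (2 * \<epsilon>) \<le> real (Suc p)" using p by simp
  then have p: "2 * real (Suc p) * \<epsilon> \<ge> 3" using \<epsilon> by (simp add: divide_le_eq algebra_simps)
  define c where "c = (1 + quadratic_const \<kappa> 0) * (1 + 1 / h)"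
  define d where "d = (quadratic_const \<kappa> 0 + h\<^sup>2) / h\<^sup>2 + 16 / h ^ 4 * quadratic_const \<kappa> 1 + 16 / h ^ 4 * \<kappa> 4"
  \<comment> \<open>\<open>deviation_const\<close> belongs to the locale; written out, it shows no
    dependence on N.\<close>
  define D where "D = \<kappa> (2 * Suc p) + quadratic_const \<kappa> p * (1 + 1 / h\<^sup>2) ^ Suc p
     + quadratic_const \<kappa> p * (1 + 1 / h ^ 4) ^ Suc p
     + linear_const \<kappa> (Suc p) * (1 / h\<^sup>2) ^ Suc p + linear_const \<kappa> (Suc p) * (1 / h ^ 4) ^ Suc p"
  define b where "b N = real N * (4 / ln (real N) * c / real N + d * (1 + real N powr (1/4))\<^sup>2 / (real N)\<^sup>2) + 5 * D / real N" for N
  show ?thesis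
  proof (rule whpI)
    show "b \<longlonglongrightarrow> 0"
      unfolding b_def using tendsto_add[OF step_error_tendsto[of c d] lim_const_over_n[of "5 * D"]] by simp
    show "\<forall>\<^sub>F N in sequentially. prob_space (P N) \<and>
        {\<omega> \<in> space (P N). regular N h \<epsilon> (\<lambda>p\<in>pairs N. X N p \<omega>)} \<in> sets (P N) \<and>
        measure (P N) {\<omega> \<in> space (P N). \<not> regular N h \<epsilon> (\<lambda>p\<in>pairs N. X N p \<omega>)} \<le> b N"
      using eventually_ge_at_top[of 2]
    proof eventually_elim
      case (elim N)
      then have N: "N > 0" by simp
      interpret wigner "P N" N "X N" \<kappa> by (rule wig[OF N])
      let ?e = "real N powr (- 1 / 2 + \<epsilon>)"
      have fam: "(\<lambda>p\<in>pairs N. X N p \<omega>) = fam \<omega>" for \<omega> by (simp add: fam_def)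
      note [measurable] = fam_measurable measurable_regular measurable_stay[OF order_refl, of N h]
        measurable_small_deviations
      have pm [measurable]: "Measurable.pred (fam_space N) (\<lambda>f. pivots_pos N (Bmat N (2 + 4 * h - h) f) (rev [0..<N]))"
        by (rule measurable_pivots_pos) auto
      have ms: "{\<omega> \<in> space (P N). regular N h \<epsilon> (fam \<omega>)} \<in> sets (P N)" by measurable
      let ?A = "{\<omega> \<in> space (P N). \<not> stay N h N (fam \<omega>)}"
      let ?B = "{\<omega> \<in> space (P N). pivots_pos N (Bmat N (2 + 4 * h - h) (fam \<omega>)) (rev [0..<N]) \<and>
          \<not> small_deviations N (2 + 4 * h) ?e (fam \<omega>)}"
      have lv: "level N h N = 2 + 4 * h - h" using N by (simp add: level_def)
      have pp: "pivots_pos N (Bmat N (2 + 4 * h - h) f) (rev [0..<N])" if "stay N h N f" for f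
        using stay_pd[OF N h order_refl that] unfolding lv
        using res_correct(1)[of "Bmat N (2 + 4 * h - h) f" "rev [0..<N]" N] symm_mat_Bmat
        by (simp add: atLeast0LessThan)
      have "prob {\<omega> \<in> space (P N). \<not> regular N h \<epsilon> (fam \<omega>)} \<le> prob (?A \<union> ?B)"
      proof (rule finite_measure_mono)
        show "{\<omega> \<in> space (P N). \<not> regular N h \<epsilon> (fam \<omega>)} \<subseteq> ?A \<union> ?B"
          using pp by (auto simp: regular_def)
        have "?A \<in> sets (P N)" by measurable
        moreover have "?B \<in> sets (P N)" by measurable
        ultimately show "?A \<union> ?B \<in> sets (P N)" by (rule sets.Un)
      qed
      also have "\<dots> \<le> prob ?A + prob ?B" by (intro measure_Un_le) measurable
      also have "prob ?A \<le> real N * (4 / ln (real N) * c / real N + d * (1 + real N powr (1/4))\<^sup>2 / (real N)\<^sup>2)"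
        using prob_not_stay[OF h elim] by (simp only: step_error_def c_def d_def)
      also have "prob ?B \<le> 5 * D / real N"
      proof -
        have "prob ?B \<le> real N * (3 + 2 * real N) * (deviation_const h p / real N ^ Suc p / ?e ^ (2 * Suc p))"
          using N by (intro prob_not_small_deviations h) simp
        also have "\<dots> \<le> 5 * deviation_const h p / real N"
          by (rule deviation_rate[OF N deviation_const_ge(6)[OF h] p])
        finally show ?thesis by (simp only: deviation_const_def D_def)
      qed
      finally show ?case using ms prob_space_axioms by (simp add: fam b_def)
    qed
  qed
qed

lemma whp_of_regular:
  assumes wig: "\<And>N. N > 0 \<Longrightarrow> wigner (P N) N (X N) \<kappa>" and h: "h > 0" and \<epsilon>: "\<epsilon> > 0"
    and Q: "\<And>N. N > 0 \<Longrightarrow> Measurable.pred (fam_space N) (Q N)"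
    and imp: "\<forall>\<^sub>F N in sequentially. \<forall>f. regular N h \<epsilon> f \<longrightarrow> Q N f"
    and F: "\<And>N \<omega>. N > 0 \<Longrightarrow> \<omega> \<in> space (P N) \<Longrightarrow> F N \<omega> \<longleftrightarrow> Q N (\<lambda>p\<in>pairs N. X N p \<omega>)"
  shows "whp P F"
proof (rule whp_mono[OF whp_regular[OF wig h \<epsilon>]])
  show "\<forall>\<^sub>F N in sequentially. prob_space (P N) \<and> {\<omega> \<in> space (P N). F N \<omega>} \<in> sets (P N) \<and>
      (\<forall>\<omega>\<in>space (P N). regular N h \<epsilon> (\<lambda>p\<in>pairs N. X N p \<omega>) \<longrightarrow> F N \<omega>)"
    using imp eventually_gt_at_top[of 0]
  proof eventually_elim
    case (elim N)
    interpret wigner "P N" N "X N" \<kappa> using elim by (intro wig)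
    have fam: "(\<lambda>p\<in>pairs N. X N p \<omega>) = fam \<omega>" for \<omega> by (simp add: fam_def)
    note [measurable] = fam_measurable Q[OF elim(2)]
    have "{\<omega> \<in> space (P N). F N \<omega>} = {\<omega> \<in> space (P N). Q N (fam \<omega>)}"
      using F[OF elim(2)] by (auto simp: fam)
    moreover have "{\<omega> \<in> space (P N). Q N (fam \<omega>)} \<in> sets (P N)" by measurable
    ultimately show ?case using elim F prob_space_axioms by auto
  qed
qed

section \<open>Bounds for the centred resolvent on the regular event\<close>

lemma mm_centred:
  assumes "i < n" "j < n"
  shows "mm n (\<lambda>a b. G a b - (if a = b then t else 0)) (\<lambda>a b. G a b - (if a = b then t else 0)) i j =
    mm n G G i j - 2 * t * G i j + (if i = j then t\<^sup>2 else 0)"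
proof -
  have "mm n (\<lambda>a b. G a b - (if a = b then t else 0)) (\<lambda>a b. G a b - (if a = b then t else 0)) i j =
      (\<Sum>k<n. G i k * G k j - (t * G i k) * (if k = j then 1 else 0) - (t * G k j) * (if k = i then 1 else 0)
        + (if k = j then t\<^sup>2 else 0) * (if k = i then 1 else 0))"
    unfolding mm_def by (intro sum.cong refl) (auto simp: algebra_simps power2_eq_square)
  also have "\<dots> = mm n G G i j - t * G i j - t * G i j + (if i = j then t\<^sup>2 else 0)"
    using assms by (simp only: sum.distrib sum_subtractf sum_mult_if mm_def) simp
  finally show ?thesis by simp
qed

text \<open>For 0 < \<epsilon> \<le> 1 / 2 the threshold N powr (- 1 / 2 + \<epsilon>) lies between
  1 / N and 1, so it is admissible as deviation bound and absorbs the term 1 / N.\<close>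

lemma centred_entries_eventually:
  fixes h lam m \<epsilon> :: real
  assumes h: "h > 0" and lam: "lam = 2 + 4 * h" and m: "0 < m" "m < 1" "m * (lam - m) = 1"
    and \<epsilon>: "0 < \<epsilon>" "\<epsilon> \<le> 1 / 2"
  obtains C where "C > 0"
    and "\<And>N f i j. \<lbrakk>N > 0; regular N h \<epsilon> f; i < N; j < N\<rbrakk> \<Longrightarrow>
      \<bar>centred N lam f i j\<bar> \<le> C * real N powr (- 1 / 2 + \<epsilon>) \<and>
      (if i = j then \<bar>mm N (centred N lam f) (centred N lam f) i i - (m\<^sup>2 / (1 - m\<^sup>2) - m\<^sup>2)\<bar> \<le> C * real N powr (- 1 / 2 + \<epsilon>)
       else \<bar>mm N (centred N lam f) (centred N lam f) i j\<bar> \<le> C * real N powr (- 1 / 2 + \<epsilon>))"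
proof -
  obtain C where C: "C > 0"
    and bd: "\<And>n e f i j. \<lbrakk>n > 0; pd n (Bmat n (lam - h) f) {..<n}; tr n (full_res n lam f) / real n \<le> 1 + h;
      small_deviations n lam e f; 0 \<le> e; e \<le> 1; i < n; j < n\<rbrakk> \<Longrightarrow>
      let G = full_res n lam f; T = tr n G / real n; A = \<lambda>a b. G a b - (if a = b then T else 0);
        AA = \<lambda>a b. mm n G G a b - 2 * T * G a b + (if a = b then T\<^sup>2 else 0) in
      \<bar>A i j\<bar> \<le> C * (e + 1 / real n) \<and>
      (if i = j then \<bar>AA i i - (m\<^sup>2 / (1 - m\<^sup>2) - m\<^sup>2)\<bar> \<le> C * (e + 1 / real n)
       else \<bar>AA i j\<bar> \<le> C * (e + 1 / real n))"
    using local_law_bounds[OF h lam m] by blast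
  show thesis
  proof (rule that[of "2 * C"])
    fix N f i j assume N: "N > 0" and r: "regular N h \<epsilon> f" and ij: "i < N" "j < N"
    let ?e = "real N powr (- 1 / 2 + \<epsilon>)"
    let ?G = "full_res N lam f"
    let ?T = "tr N ?G / real N"
    note R = regularD[OF N h lam r]
    have N1: "real N \<ge> 1" using N by simp
    have e: "0 \<le> ?e" by simp
    have e1: "?e \<le> 1" using powr_mono[of "- 1 / 2 + \<epsilon>" 0 "real N"] N1 \<epsilon> by simp
    have "1 / real N = real N powr (-1)" using N1 by (simp add: powr_minus_divide)
    also have "\<dots> \<le> ?e" using N1 \<epsilon> by (intro powr_mono) auto
    finally have "C * (?e + 1 / real N) \<le> C * (?e + ?e)" using C by (intro mult_left_mono) auto
    then have le: "C * (?e + 1 / real N) \<le> 2 * C * ?e" by simp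
    have ce: "centred N lam f = (\<lambda>a b. ?G a b - (if a = b then ?T else 0))"
      using R(4) by (simp add: centred_def fun_eq_iff)
    show "\<bar>centred N lam f i j\<bar> \<le> 2 * C * ?e \<and>
      (if i = j then \<bar>mm N (centred N lam f) (centred N lam f) i i - (m\<^sup>2 / (1 - m\<^sup>2) - m\<^sup>2)\<bar> \<le> 2 * C * ?e
       else \<bar>mm N (centred N lam f) (centred N lam f) i j\<bar> \<le> 2 * C * ?e)"
      using bd[OF N R(1-3) e e1 ij] le
      unfolding ce mm_centred[OF ij] mm_centred[OF ij(1) ij(1)] Let_def
      by (auto split: if_splits)
  qed (use C in simp)
qed

text \<open>The resolvent and its normalised trace contribute 1 / h each.\<close>

lemma op_norm_centred_le:
  assumes n: "n > 0" and h: "h > 0" and lam: "lam = 2 + 4 * h" and r: "regular n h \<epsilon> f"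
  shows "op_norm (Matrix.mat n n (\<lambda>(i, j). centred n lam f i j)) \<le> 2 / h"
proof (subst op_norm_le_iff)
  show "0 \<le> 2 / h" using h by simp
  let ?G = "full_res n lam f"
  let ?T = "tr n ?G / real n"
  note R = regularD[OF n h lam r]
  have "Bmat n lam f = shift h (Bmat n (lam - h) f)" using Bmat_shift[of n "lam - h" h f] by simp
  then have I: "inverse_on n (shift h (Bmat n (lam - h) f)) {..<n} ?G"
    using full_res_inverse_on[of n lam f] R(4) by (simp add: positive_at_iff)
  have T: "0 \<le> ?T" "?T \<le> 1 / h"
  proof -
    show "0 \<le> ?T" unfolding tr_def
      using inverse_on_shift_entry_bounds(1)[OF I R(1) h] by (intro divide_nonneg_nonneg sum_nonneg) auto
    show "?T \<le> 1 / h" by (rule tr_divide_le[OF n inverse_on_shift_entry_bounds(2)[OF I R(1) h]])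
  qed
  show "\<forall>x. dot n (mv n (centred n lam f) x) (mv n (centred n lam f) x) \<le> (2 / h)\<^sup>2 * dot n x x"
  proof
    fix x
    have mvc: "mv n (centred n lam f) x i = mv n ?G x i + (- ?T) * x i" if "i < n" for i
    proof -
      have "mv n (centred n lam f) x i = (\<Sum>j<n. ?G i j * x j + (- ?T * x j) * (if j = i then 1 else 0))"
        unfolding mv_def using R(4) by (intro sum.cong refl) (auto simp: centred_def algebra_simps)
      then show ?thesis using that by (simp only: sum.distrib sum_mult_if mv_def) simp
    qed
    have "dot n (mv n (centred n lam f) x) (mv n (centred n lam f) x) \<le>
        (\<Sum>i<n. 2 * (mv n ?G x i * mv n ?G x i) + 2 * ?T\<^sup>2 * (x i * x i))"
      unfolding dot_def
    proof (rule sum_mono)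
      fix i assume i: "i \<in> {..<n}"
      have "(a + b) * (a + b) \<le> 2 * (a * a) + 2 * (b * b)" for a b :: real
        using sum_squares_bound[of a b] by (simp add: power2_eq_square algebra_simps)
      from this[of "mv n ?G x i" "(- ?T) * x i"]
      show "mv n (centred n lam f) x i * mv n (centred n lam f) x i \<le> 2 * (mv n ?G x i * mv n ?G x i) + 2 * ?T\<^sup>2 * (x i * x i)"
        using mvc[of i] i by (simp add: power2_eq_square mult_ac)
    qed
    also have "\<dots> = 2 * dot n (mv n ?G x) (mv n ?G x) + 2 * ?T\<^sup>2 * dot n x x"
      by (simp add: dot_def sum.distrib sum_distrib_left)
    also have "\<dots> \<le> 2 * (dot n x x / h\<^sup>2) + 2 * (1 / h)\<^sup>2 * dot n x x"
      using inverse_on_shift_bound(1)[OF I R(1) h, of x] T dot_self_nonneg[of n x]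
      by (intro add_mono mult_left_mono mult_right_mono power_mono) auto
    also have "\<dots> = (2 / h)\<^sup>2 * dot n x x" using h by (simp add: power_divide field_simps)
    finally show "dot n (mv n (centred n lam f) x) (mv n (centred n lam f) x) \<le> (2 / h)\<^sup>2 * dot n x x" .
  qed
qed

section \<open>From random matrices to families of entries\<close>

lemma wigner_entries:
  fixes A :: "'w \<Rightarrow> real mat"
  assumes n: "n > 0" and prob: "prob_space Q"
    and indep: "prob_space.indep_vars Q (\<lambda>_. borel) (\<lambda>p \<omega>. A \<omega> $$ p) (pairs n)"
    and law_off: "\<And>i j. i < j \<Longrightarrow> j < n \<Longrightarrow> distr Q borel (\<lambda>\<omega>. A \<omega> $$ (i, j)) = \<mu>"
    and law_diag: "\<And>i. i < n \<Longrightarrow> distr Q borel (\<lambda>\<omega>. A \<omega> $$ (i, i)) = \<nu>"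
    and moments: "\<And>i j k. i \<le> j \<Longrightarrow> j < n \<Longrightarrow> integrable Q (\<lambda>\<omega>. (A \<omega> $$ (i, j)) ^ (k::nat))"
    and mean: "\<And>i j. i \<le> j \<Longrightarrow> j < n \<Longrightarrow> (\<integral>\<omega>. A \<omega> $$ (i, j) \<partial>Q) = 0"
    and second: "\<And>i j. i < j \<Longrightarrow> j < n \<Longrightarrow> (\<integral>\<omega>. (A \<omega> $$ (i, j))\<^sup>2 \<partial>Q) = 1"
  shows "wigner Q n (\<lambda>p \<omega>. A \<omega> $$ p) (\<lambda>r. (\<integral>x. \<bar>x\<bar> ^ r \<partial>\<mu>) + (\<integral>x. \<bar>x\<bar> ^ r \<partial>\<nu>))"
proof -
  interpret prob_space Q by (rule prob)
  have meas: "random_variable borel (\<lambda>\<omega>. A \<omega> $$ p)" if "p \<in> pairs n" for p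
    using indep that unfolding indep_vars_def by auto
  show ?thesis
  proof
    fix p assume p: "p \<in> pairs n"
    then obtain i j where ij: "p = (i, j)" "i \<le> j" "j < n" by (auto simp: pairs_def)
    have "integrable Q (\<lambda>\<omega>. \<bar>A \<omega> $$ p\<bar> ^ k)" for k
      using integrable_abs[OF moments[OF ij(2,3), of k]] by (simp add: ij power_abs)
    then show "all_moments Q (\<lambda>\<omega>. A \<omega> $$ p)" using meas[OF p] by (simp add: all_moments_def)
    show "expectation (\<lambda>\<omega>. A \<omega> $$ p) = 0" using mean ij by simp
    fix r :: nat
    have "expectation (\<lambda>\<omega>. \<bar>A \<omega> $$ p\<bar> ^ r) = (\<integral>x. \<bar>x\<bar> ^ r \<partial>distr Q borel (\<lambda>\<omega>. A \<omega> $$ p))"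
      using meas[OF p] by (subst integral_distr) auto
    \<comment> \<open>Both absolute moments are nonnegative, so their sum bounds either of them, on
      and off the diagonal.\<close>
    also have "\<dots> \<le> (\<integral>x. \<bar>x\<bar> ^ r \<partial>\<mu>) + (\<integral>x. \<bar>x\<bar> ^ r \<partial>\<nu>)"
    proof (cases "i = j")
      case True
      then show ?thesis using law_diag[of i] ij by (simp add: integral_nonneg)
    next
      case False
      then show ?thesis using law_off[of i j] ij by (simp add: integral_nonneg)
    qed
    finally show "expectation (\<lambda>\<omega>. \<bar>A \<omega> $$ p\<bar> ^ r) \<le> (\<integral>x. \<bar>x\<bar> ^ r \<partial>\<mu>) + (\<integral>x. \<bar>x\<bar> ^ r \<partial>\<nu>)" .
  qed (use n indep second in \<open>auto intro!: add_nonneg_nonneg integral_nonneg\<close>)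
qed

lemma scaled_symmetric_eq_jmat:
  assumes A: "A \<in> carrier_mat n n" and sym: "transpose_mat A = A"
  shows "(1 / sqrt (real n)) \<cdot>\<^sub>m A = jmat n (\<lambda>p\<in>pairs n. A $$ p)"
proof (rule eq_matI)
  fix i j assume "i < dim_row (jmat n (\<lambda>p\<in>pairs n. A $$ p))" "j < dim_col (jmat n (\<lambda>p\<in>pairs n. A $$ p))"
  then have ij: "i < n" "j < n" by (simp_all add: jmat_def)
  have "A $$ (i, j) = A $$ (j, i)"
    using arg_cong[OF sym, of "\<lambda>B. B $$ (j, i)"] ij A by simp
  then have "A $$ pair_of i j = A $$ (i, j)" by (cases "i \<le> j") (simp_all add: pair_of_def)
  then show "((1 / sqrt (real n)) \<cdot>\<^sub>m A) $$ (i, j) = jmat n (\<lambda>p\<in>pairs n. A $$ p) $$ (i, j)"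
    using ij A by (simp add: jmat_def entry_def pair_of_in_pairs)
qed (use A in \<open>simp_all add: jmat_def\<close>)

lemma centred_mult_transpose:
  assumes "i < n" "j < n"
  shows "(Matrix.mat n n (\<lambda>(i, j). centred n z f i j) *
      transpose_mat (Matrix.mat n n (\<lambda>(i, j). centred n z f i j))) $$ (i, j) =
    mm n (centred n z f) (centred n z f) i j"
proof -
  have "centred n z f j k = centred n z f k j" for k
    using symm_mat_centred[of n z f] by (simp add: symm_mat_def)
  then show ?thesis using assms by (simp add: scalar_prod_def mm_def atLeast0LessThan)
qed

theorem lemma3:
  fixes P :: "nat \<Rightarrow> 'w measure"
    and W :: "nat \<Rightarrow> 'w \<Rightarrow> real mat"
    and \<mu>_off \<mu>_diag :: "real measure"
    and lam :: real
  defines "J \<equiv> \<lambda>N \<omega>. (1 / sqrt (real N)) \<cdot>\<^sub>m W N \<omega>"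
  defines "M \<equiv> \<lambda>N \<omega>. centred_resolvent lam (J N \<omega>)"
  defines "\<sigma>2 \<equiv> - deriv G_sc lam - (G_sc lam)\<^sup>2"
  assumes prob: "\<And>N. N > 0 \<Longrightarrow> prob_space (P N)"
    and dim: "\<And>N \<omega>. N > 0 \<Longrightarrow> \<omega> \<in> space (P N) \<Longrightarrow> W N \<omega> \<in> carrier_mat N N"
    and symm: "\<And>N \<omega>. N > 0 \<Longrightarrow> \<omega> \<in> space (P N) \<Longrightarrow> transpose_mat (W N \<omega>) = W N \<omega>"
    and indep: "\<And>N. N > 0 \<Longrightarrow>
      prob_space.indep_vars (P N) (\<lambda>_. borel) (\<lambda>ij \<omega>. W N \<omega> $$ ij) {(i, j). i \<le> j \<and> j < N}"
    and law_off: "\<And>N i j. i < j \<Longrightarrow> j < N \<Longrightarrow> distr (P N) borel (\<lambda>\<omega>. W N \<omega> $$ (i, j)) = \<mu>_off"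
    and law_diag: "\<And>N i. i < N \<Longrightarrow> distr (P N) borel (\<lambda>\<omega>. W N \<omega> $$ (i, i)) = \<mu>_diag"
    and law_sym: "\<And>N i j. i \<le> j \<Longrightarrow> j < N \<Longrightarrow>
      distr (P N) borel (\<lambda>\<omega>. W N \<omega> $$ (i, j)) = distr (P N) borel (\<lambda>\<omega>. - (W N \<omega> $$ (i, j)))"
    and moments: "\<And>N i j k. i \<le> j \<Longrightarrow> j < N \<Longrightarrow> integrable (P N) (\<lambda>\<omega>. (W N \<omega> $$ (i, j)) ^ (k::nat))"
    and mean: "\<And>N i j. i \<le> j \<Longrightarrow> j < N \<Longrightarrow> (\<integral>\<omega>. W N \<omega> $$ (i, j) \<partial>P N) = 0"
    and second: "\<And>N i j. i \<le> j \<Longrightarrow> j < N \<Longrightarrow>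
      (\<integral>\<omega>. (W N \<omega> $$ (i, j))\<^sup>2 \<partial>P N) = (if i = j then 2 else 1)"
    and lam_gt: "lam > 2"
  shows "whp P (\<lambda>N \<omega>. largest_eigenvalue (J N \<omega>) < lam)
    \<and> (\<forall>N>0. random_mat N (P N) (M N)
        \<and> mat_law N (P N) (M N)
          = mat_law N (P N \<Otimes>\<^sub>M sign_measure N)
              (\<lambda>(\<omega>, s). mat_diag N s * M N \<omega> * mat_diag N s))
    \<and> (\<exists>C. whp P (\<lambda>N \<omega>. op_norm (M N \<omega>) \<le> C))
    \<and> (\<forall>\<epsilon>>0. whp P (\<lambda>N \<omega>.
          (\<forall>i<N. \<forall>j<N. \<bar>M N \<omega> $$ (i, j)\<bar> \<le> real N powr (- 1 / 2 + \<epsilon>))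
        \<and> (\<forall>i<N. \<forall>j<N. i \<noteq> j \<longrightarrow>
             \<bar>(M N \<omega> * transpose_mat (M N \<omega>)) $$ (i, j)\<bar> \<le> real N powr (- 1 / 2 + \<epsilon>))))
    \<and> (\<forall>\<delta>>0. whp P (\<lambda>N \<omega>.
          \<forall>i<N. \<bar>(M N \<omega> * transpose_mat (M N \<omega>)) $$ (i, i) - \<sigma>2\<bar> \<le> \<delta>))"
proof -
  define h where "h = (lam - 2) / 4"
  have h: "h > 0" and lam: "lam = 2 + 4 * h" using lam_gt by (simp_all add: h_def field_simps)
  define X where "X N p \<omega> = W N \<omega> $$ p" for N p \<omega>
  define \<kappa> where "\<kappa> r = (\<integral>x. \<bar>x\<bar> ^ r \<partial>\<mu>_off) + (\<integral>x. \<bar>x\<bar> ^ r \<partial>\<mu>_diag)" for r :: nat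
  define c where "c N f = Matrix.mat N N (\<lambda>(i, j). centred N lam f i j)" for N f
  have pairs: "{(i, j). i \<le> j \<and> j < N} = pairs N" for N by (simp add: pairs_def)
  have wig: "wigner (P N) N (X N) \<kappa>" if N: "N > 0" for N
    unfolding X_def[abs_def] \<kappa>_def[abs_def]
    using prob[OF N] indep[OF N] law_off law_diag moments mean second
    by (intro wigner_entries N) (simp_all add: pairs)
  have J: "J N \<omega> = jmat N (\<lambda>p\<in>pairs N. X N p \<omega>)" if "N > 0" "\<omega> \<in> space (P N)" for N \<omega>
    unfolding J_def X_def by (rule scaled_symmetric_eq_jmat[OF dim[OF that] symm[OF that]])
  have M: "M N \<omega> = c N (\<lambda>p\<in>pairs N. X N p \<omega>)" if "N > 0" "\<omega> \<in> space (P N)" for N \<omega>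
    by (simp only: M_def J[OF that] centred_resolvent_jmat(2)[OF that(1)] c_def)
  note G = G_sc_properties[OF lam_gt]
  have whp: "whp P F" if "\<epsilon> > 0" "\<forall>\<^sub>F N in sequentially. \<forall>f. regular N h \<epsilon> f \<longrightarrow> Q N f"
    "\<And>N. N > 0 \<Longrightarrow> Measurable.pred (fam_space N) (Q N)"
    "\<And>N \<omega>. N > 0 \<Longrightarrow> \<omega> \<in> space (P N) \<Longrightarrow> F N \<omega> \<longleftrightarrow> Q N (\<lambda>p\<in>pairs N. X N p \<omega>)" for \<epsilon> Q F
    using whp_of_regular[of P X \<kappa> h \<epsilon> Q F] wig h that by blast
  note cm = measurable_centred[of _ lam]
  have mmc: "(\<lambda>f. mm N (centred N lam f) (centred N lam f) i j) \<in> borel_measurable (fam_space N)" for N i j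
    by (intro measurable_mm cm)
  have cij: "c N f $$ (i, j) = centred N lam f i j" if "i < N" "j < N" for N f i j
    using that by (simp add: c_def)
  have ccij: "(c N f * transpose_mat (c N f)) $$ (i, j) = mm N (centred N lam f) (centred N lam f) i j"
    if "i < N" "j < N" for N f i j
    unfolding c_def by (rule centred_mult_transpose[OF that])
  have "whp P (\<lambda>N \<omega>. largest_eigenvalue (J N \<omega>) < lam)"
  \<comment> \<open>Positivity comes from the walk, so any positive \<epsilon> does.\<close>
  proof (rule whp[where \<epsilon> = 1 and Q = "\<lambda>N. positive_at N lam"])
    show "\<forall>\<^sub>F N in sequentially. \<forall>f. regular N h 1 f \<longrightarrow> positive_at N lam f"
      using eventually_gt_at_top[of 0] by eventually_elim (use regularD(4)[OF _ h lam] in blast)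
  qed (simp_all add: J centred_resolvent_jmat(1) measurable_positive_at)
  moreover have "\<forall>N>0. random_mat N (P N) (M N) \<and> mat_law N (P N) (M N)
      = mat_law N (P N \<Otimes>\<^sub>M sign_measure N) (\<lambda>(\<omega>, s). mat_diag N s * M N \<omega> * mat_diag N s)"
  proof (intro allI impI)
    fix N :: nat assume N: "N > 0"
    interpret wigner "P N" N "X N" \<kappa> by (rule wig[OF N])
    have sym: "distr (P N) borel (X N p) = distr (P N) borel (\<lambda>\<omega>. - X N p \<omega>)" if "p \<in> pairs N" for p
      using that law_sym unfolding X_def[abs_def] by (auto simp: pairs_def)
    have "M N \<omega> = Matrix.mat N N (\<lambda>(i, j). centred N lam (fam \<omega>) i j)" if "\<omega> \<in> space (P N)" for \<omega>
      using M[OF N that] by (simp add: fam_def c_def)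
    from mat_law_sign_invariant[OF sym this]
    show "random_mat N (P N) (M N) \<and> mat_law N (P N) (M N)
      = mat_law N (P N \<Otimes>\<^sub>M sign_measure N) (\<lambda>(\<omega>, s). mat_diag N s * M N \<omega> * mat_diag N s)" by blast
  qed
  moreover have "\<exists>C. whp P (\<lambda>N \<omega>. op_norm (M N \<omega>) \<le> C)"
  proof (intro exI, rule whp[where \<epsilon> = 1 and Q = "\<lambda>N f. op_norm (c N f) \<le> 2 / h"])
    show "\<forall>\<^sub>F N in sequentially. \<forall>f. regular N h 1 f \<longrightarrow> op_norm (c N f) \<le> 2 / h"
      using eventually_gt_at_top[of 0] unfolding c_def
      by eventually_elim (use op_norm_centred_le[OF _ h lam] in blast)
    show "Measurable.pred (fam_space N) (\<lambda>f. op_norm (c N f) \<le> 2 / h)" for N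
      unfolding c_def using h by (intro measurable_op_norm_le cm symm_mat_centred) simp
  qed (simp_all add: M)
  moreover have "\<forall>\<epsilon>>0. whp P (\<lambda>N \<omega>.
          (\<forall>i<N. \<forall>j<N. \<bar>M N \<omega> $$ (i, j)\<bar> \<le> real N powr (- 1 / 2 + \<epsilon>))
        \<and> (\<forall>i<N. \<forall>j<N. i \<noteq> j \<longrightarrow>
             \<bar>(M N \<omega> * transpose_mat (M N \<omega>)) $$ (i, j)\<bar> \<le> real N powr (- 1 / 2 + \<epsilon>)))"
  proof (intro allI impI)
    fix \<epsilon> :: real assume \<epsilon>: "\<epsilon> > 0"
    \<comment> \<open>A strictly smaller exponent, so that the constant C is absorbed for large N;
      the cap keeps it at most 1 / 2.\<close>
    define e where "e = min (\<epsilon> / 2) (1 / 4)"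
    have e: "0 < e" "e \<le> 1 / 2" "e < \<epsilon>" using \<epsilon> by (auto simp: e_def)
    obtain C where C: "C > 0" and bd: "\<And>N f i j. \<lbrakk>N > 0; regular N h e f; i < N; j < N\<rbrakk> \<Longrightarrow>
      \<bar>centred N lam f i j\<bar> \<le> C * real N powr (- 1 / 2 + e) \<and>
      (if i = j then \<bar>mm N (centred N lam f) (centred N lam f) i i - ((G_sc lam)\<^sup>2 / (1 - (G_sc lam)\<^sup>2) - (G_sc lam)\<^sup>2)\<bar>
          \<le> C * real N powr (- 1 / 2 + e)
       else \<bar>mm N (centred N lam f) (centred N lam f) i j\<bar> \<le> C * real N powr (- 1 / 2 + e))"
      using centred_entries_eventually[OF h lam G(1-3) e(1,2)] by blast
    define R where "R N f \<longleftrightarrow> (\<forall>i\<in>{..<N}. \<forall>j\<in>{..<N}. \<bar>centred N lam f i j\<bar> \<le> real N powr (- 1 / 2 + \<epsilon>)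
        \<and> (i \<noteq> j \<longrightarrow> \<bar>mm N (centred N lam f) (centred N lam f) i j\<bar> \<le> real N powr (- 1 / 2 + \<epsilon>)))" for N f
    have "\<forall>\<^sub>F N in sequentially. C * real N powr (- 1 / 2 + e) \<le> real N powr (- 1 / 2 + \<epsilon>)"
      using e(3) by real_asymp
    then have ev: "\<forall>\<^sub>F N in sequentially. \<forall>f. regular N h e f \<longrightarrow> R N f"
      using eventually_gt_at_top[of 0]
    proof eventually_elim
      case (elim N)
      show ?case unfolding R_def using bd[OF elim(2)] order_trans[OF _ elim(1)] by (metis lessThan_iff)
    qed
    show "whp P (\<lambda>N \<omega>.
          (\<forall>i<N. \<forall>j<N. \<bar>M N \<omega> $$ (i, j)\<bar> \<le> real N powr (- 1 / 2 + \<epsilon>))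
        \<and> (\<forall>i<N. \<forall>j<N. i \<noteq> j \<longrightarrow>
             \<bar>(M N \<omega> * transpose_mat (M N \<omega>)) $$ (i, j)\<bar> \<le> real N powr (- 1 / 2 + \<epsilon>)))"
    proof (rule whp[where \<epsilon> = e and Q = R, OF e(1) ev])
      note [measurable] = cm mmc
      show "Measurable.pred (fam_space N) (R N)" for N
        unfolding R_def[abs_def] by (intro pred_intros_finite finite_lessThan) measurable
    qed (auto simp: M cij ccij R_def)
  qed
  moreover have "\<forall>\<delta>>0. whp P (\<lambda>N \<omega>.
          \<forall>i<N. \<bar>(M N \<omega> * transpose_mat (M N \<omega>)) $$ (i, i) - \<sigma>2\<bar> \<le> \<delta>)"
  proof (intro allI impI)
    fix \<delta> :: real assume \<delta>: "\<delta> > 0"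
    \<comment> \<open>With \<epsilon> = 1 / 4 the error is C * N powr (- 1 / 4), which falls below
      any fixed \<delta>.\<close>
    obtain C where C: "C > 0" and bd: "\<And>N f i j. \<lbrakk>N > 0; regular N h (1/4) f; i < N; j < N\<rbrakk> \<Longrightarrow>
      \<bar>centred N lam f i j\<bar> \<le> C * real N powr (- 1 / 2 + 1/4) \<and>
      (if i = j then \<bar>mm N (centred N lam f) (centred N lam f) i i - ((G_sc lam)\<^sup>2 / (1 - (G_sc lam)\<^sup>2) - (G_sc lam)\<^sup>2)\<bar>
          \<le> C * real N powr (- 1 / 2 + 1/4)
       else \<bar>mm N (centred N lam f) (centred N lam f) i j\<bar> \<le> C * real N powr (- 1 / 2 + 1/4))"
      using centred_entries_eventually[OF h lam G(1-3), of "1/4"] by auto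
    define R where "R N f \<longleftrightarrow> (\<forall>i\<in>{..<N}. \<bar>mm N (centred N lam f) (centred N lam f) i i - \<sigma>2\<bar> \<le> \<delta>)" for N f
    have "\<forall>\<^sub>F N in sequentially. C * real N powr (- 1 / 2 + 1/4) \<le> \<delta>"
      using \<delta> by real_asymp
    then have ev: "\<forall>\<^sub>F N in sequentially. \<forall>f. regular N h (1/4) f \<longrightarrow> R N f"
      using eventually_gt_at_top[of 0]
    proof eventually_elim
      case (elim N)
      show ?case unfolding R_def \<sigma>2_def G(4) using bd[OF elim(2)] order_trans[OF _ elim(1)] by (metis lessThan_iff)
    qed
    show "whp P (\<lambda>N \<omega>. \<forall>i<N. \<bar>(M N \<omega> * transpose_mat (M N \<omega>)) $$ (i, i) - \<sigma>2\<bar> \<le> \<delta>)"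
    proof (rule whp[where \<epsilon> = "1/4" and Q = R, OF _ ev])
      note [measurable] = mmc
      show "Measurable.pred (fam_space N) (R N)" for N
        unfolding R_def[abs_def] by (intro pred_intros_finite finite_lessThan) measurable
    qed (auto simp: M ccij R_def)
  qed
  ultimately show ?thesis by blast
qed

end
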